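(* Let $(U,\boldsymbol\lambda)$ be a space of quasi-exponentials of the $(\boldsymbol m,(z_1,\dots,z_M),\boldsymbol n,(\lambda_1,\dots,\lambda_N))$-type. Let $V$ be the complex vector space spanned by all functions $$\hat f_i(x)=\int_{\gamma_i}x^uf(u)\,du,\qquad i=1,\dots,N,\ f\in U^\bullet .$$ Then: (i) $V$, together with $(z_1,\dots,z_M)$, is a space of quasi-polynomials of the $(\boldsymbol n,(\lambda_1-1,\dots,\lambda_N-1),\boldsymbol m,(z_1,\dots,z_M))$-type. (ii) Let $\tilde D_U=\sum_{i=0}^N\sum_{j=0}^M A_{ij}\,u^i\tau_u^j$, with $A_{ij}\in\mathbb C$, be the special fundamental difference operator of $(U,\boldsymbol\lambda)$. Then $\sum_{i=0}^N\sum_{j=0}^M A_{ij}\,x^j(x\partial_x)^i$ is the special fundamental differential operator of $V$.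
   Context: **Special spaces of quasi-exponentials.** $(\tau_uf)(u)=f(u+1)$ and $z^u=e^{u\ln z}$ for nonzero $z$ with fixed argument. Let $M>1$, $\boldsymbol m=(m_1,\dots,m_M)$ nonnegative integers, $\boldsymbol z=(z_1,\dots,z_M)$ distinct nonzero numbers with fixed arguments, $q_a\in\mathbb C[u]$ of degree $m_a$, and $U$ the $M$-dimensional span of the functions $z_a^uq_a(u)$. The discrete exponents of $U$ at $\mu\in\mathbb C$ are the unique nonnegative integers $c_1<\dots<c_M$ for which there is a basis $f_1,\dots,f_M$ of $U$ with $f_i(\mu+j)=0$ for $0\le j<c_i$ and $f_i(\mu+c_i)\neq0$. Let $N>1$ and $\boldsymbol\lambda=(\lambda_1,\dots,\lambda_N)$ with $\lambda_i-\lambda_j\notin\mathbb Z$ for $i\ne j$, such that the discrete exponents of $U$ at $\lambda_i$ are $0<1<\dots<M-2<M-1+n_i$ with $n_i\ge0$, and $\sum_in_i=\sum_am_a$, where $\boldsymbol n=(n_1,\dots,n_N)$. Then $(U,\boldsymbol\lambda)$ is called a space of quasi-exponentials of the $(\boldsymbol m,\boldsymbol z,\boldsymbol n,\boldsymbol\lambda)$-type. Its special fundamental difference operator is $\tilde D_U=\prod_{i=1}^N(u-\lambda_i-n_i+1)\,\bar D_U$, where $\bar D_U$ is the monic linear difference operator $\tau_u^M+\dots$ of order $M$ annihilating $U$. Write $\tilde D_U=B_0(u)\tau_u^M+\dots+B_M(u)$; the $B_k$ are polynomials of degree at most $N$. $\mathrm{Wr}^{(d)}(f_1,\dots,f_i)$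 is the determinant of the $i\times i$ matrix whose $j$-th row is $f_j(u),\dots,f_j(u+i-1)$; $\mathrm{Wr}^{(d)}_U$ is the discrete Wronskian of a basis of $U$. The special regularized conjugate space $U^\bullet$ is the span of all $\dfrac{\tau_u(\mathrm{Wr}^{(d)}(f_1,\dots,f_{M-1}))}{B_M(u)\,\mathrm{Wr}^{(d)}_U(u)}$ with $f_1,\dots,f_{M-1}\in U$. For $i=1,\dots,N$ let $S_i=\{\lambda_i-1,\lambda_i,\lambda_i+1,\dots,\lambda_i+n_i-1\}$, and let $\gamma_i$ be a non-self-intersecting closed connected curve in $\mathbb C$, oriented counterclockwise, encircling $S_i$ and neither containing inside nor meeting points of $S_j$, $j\ne i$. **Special spaces of quasi-polynomials.** Let $\boldsymbol\mu=(\mu_1,\dots,\mu_N)\in\mathbb C^N$ with $\mu_i-\mu_j\notin\mathbb Z$ for $i\ne j$; let $p_i\in\mathbb C[x]$ be of degree $n_i$ with $p_i(0)\ne0$, and let $V$ be the $N$-dimensional span of the multivalued functions $x^{\mu_i}p_i(x)$, $i=1,\dots,N$. The exponents of $V$ at $z\in\mathbb C^*$ are the unique integers $e_1<\dots<e_N$ such that for each $i$ some $f\in V$ has a root at $z$ of multiplicity $e_i$; $z$ is singular if $\{e_i\}\ne\{0,\dots,N-1\}$. Let $\boldsymbol z=(z_1,\dots,z_M)$ be distinct nonzero complex numbers containing all singular points of $V$ in $\mathbb C^*$ such that the exponents at $z_a$ are $0<1<\dots<N-2<N-1+m_a$, $m_a\ge0$. Then $(V,\boldsymbol z)$ is called a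 space of quasi-polynomials of the $(\boldsymbol n,\boldsymbol\mu,\boldsymbol m,\boldsymbol z)$-type. Its special fundamental differential operator is $\tilde D_V=x^N\prod_{a=1}^M(x-z_a)\,\bar D_V$, where $\bar D_V$ is the monic linear differential operator of order $N$ annihilating $V$ ($\partial_x=d/dx$). *)

theory Defs
  imports
    "HOL-Complex_Analysis.Complex_Analysis"
    "HOL-Library.Function_Algebras"
    "Jordan_Normal_Form.Determinant"
begin

text \<open>
  Families indexed by \<open>1, \<dots>, k\<close> on paper are functions on \<open>nat\<close> restricted to \<open>{..<k}\<close>.
\<close>

definition cfun_scale :: "complex \<Rightarrow> (complex \<Rightarrow> complex) \<Rightarrow> complex \<Rightarrow> complex" where
  "cfun_scale c f = (\<lambda>u. c * f u)"

interpretation cfun: vector_space cfun_scale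
  by unfold_locales (auto simp: cfun_scale_def fun_eq_iff algebra_simps)

definition basis_of :: "(complex \<Rightarrow> complex) set \<Rightarrow> nat \<Rightarrow> (nat \<Rightarrow> complex \<Rightarrow> complex) \<Rightarrow> bool" where
  "basis_of W k f \<longleftrightarrow>
     inj_on f {..<k} \<and> \<not> cfun.dependent (f ` {..<k}) \<and> cfun.span (f ` {..<k}) = W"

text \<open>The function \<open>z\<^sup>u = exp (u ln z)\<close> for nonzero \<open>z\<close> with the fixed argument \<open>\<theta>\<close>.\<close>

definition arg_powr :: "complex \<Rightarrow> real \<Rightarrow> complex \<Rightarrow> complex" where
  "arg_powr z \<theta> u = exp (u * (of_real (ln (cmod z)) + \<i> * of_real \<theta>))"

definition shift :: "(complex \<Rightarrow> complex) \<Rightarrow> complex \<Rightarrow> complex" where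
  "shift f = (\<lambda>u. f (u + 1))"

definition has_discrete_exponents ::
    "(complex \<Rightarrow> complex) set \<Rightarrow> nat \<Rightarrow> complex \<Rightarrow> (nat \<Rightarrow> nat) \<Rightarrow> bool" where
  "has_discrete_exponents U M \<mu> c \<longleftrightarrow>
     strict_mono_on {..<M} c \<and>
     (\<exists>f. basis_of U M f \<and>
        (\<forall>i<M. (\<forall>j<c i. f i (\<mu> + of_nat j) = 0) \<and> f i (\<mu> + of_nat (c i)) \<noteq> 0))"

text \<open>
  The condition \<open>q a \<noteq> 0\<close> is needed because the zero polynomial has \<open>degree\<close> zero.
\<close>

definition quasi_exponential_space ::
    "(complex \<Rightarrow> complex) set \<Rightarrow> nat \<Rightarrow> nat \<Rightarrow> (nat \<Rightarrow> nat) \<Rightarrow> (nat \<Rightarrow> complex) \<Rightarrow> (nat \<Rightarrow> real) \<Rightarrow>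
     (nat \<Rightarrow> nat) \<Rightarrow> (nat \<Rightarrow> complex) \<Rightarrow> bool" where
  "quasi_exponential_space U M N m z \<theta> n lam \<longleftrightarrow>
     1 < M \<and> 1 < N \<and>
     inj_on z {..<M} \<and> (\<forall>a<M. z a \<noteq> 0 \<and> is_Arg (z a) (\<theta> a)) \<and>
     (\<exists>q :: nat \<Rightarrow> complex poly.
        (\<forall>a<M. q a \<noteq> 0 \<and> degree (q a) = m a) \<and>
        U = cfun.span ((\<lambda>a u. arg_powr (z a) (\<theta> a) u * poly (q a) u) ` {..<M})) \<and>
     cfun.dim U = M \<and>
     (\<forall>i<N. \<forall>j<N. i \<noteq> j \<longrightarrow> lam i - lam j \<notin> \<int>) \<and>
     (\<forall>i<N. has_discrete_exponents U M (lam i) (\<lambda>k. if k = M - 1 then M - 1 + n i else k)) \<and>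
     (\<Sum>i<N. n i) = (\<Sum>a<M. m a)"

text \<open>
  A linear difference operator \<open>b\<^sub>0 \<tau>\<^sup>M + b\<^sub>1 \<tau>\<^sup>M\<^sup>-\<^sup>1 + \<dots> + b\<^sub>M\<close> is given by its meromorphic
  coefficient functions. Values at poles carry no meaning, hence identities
  between meromorphic functions are required only off a sparse set.
\<close>

definition fundamental_difference_op ::
    "(complex \<Rightarrow> complex) set \<Rightarrow> nat \<Rightarrow> (nat \<Rightarrow> complex \<Rightarrow> complex) \<Rightarrow> bool" where
  "fundamental_difference_op U M b \<longleftrightarrow>
     (\<forall>k\<le>M. b k meromorphic_on UNIV) \<and> (\<forall>u. b 0 u = 1) \<and>
     (\<forall>f\<in>U. eventually (\<lambda>u. (\<Sum>k\<le>M. b k u * (shift ^^ (M - k)) f u) = 0) (cosparse UNIV))"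

text \<open>
  The coefficient polynomials \<open>B\<^sub>0, \<dots>, B\<^sub>M\<close> of \<open>B\<^sub>0 \<tau>\<^sup>M + \<dots> + B\<^sub>M\<close>. They are unique because the
  discrete Wronskian of \<open>U\<close> is not identically zero; the clause for \<open>k > M\<close> only makes the
  family \<open>B\<close> unique as a function on \<open>nat\<close>.
\<close>

definition special_fundamental_difference_op ::
    "(complex \<Rightarrow> complex) set \<Rightarrow> nat \<Rightarrow> nat \<Rightarrow> (nat \<Rightarrow> nat) \<Rightarrow> (nat \<Rightarrow> complex) \<Rightarrow>
     nat \<Rightarrow> complex poly" where
  "special_fundamental_difference_op U M N n lam =
     (THE B. (\<forall>k>M. B k = 0) \<and>
        (\<exists>b. fundamental_difference_op U M b \<and>
           (\<forall>k\<le>M. eventually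
              (\<lambda>u. poly (B k) u = (\<Prod>i<N. u - lam i - of_nat (n i) + 1) * b k u)
              (cosparse UNIV))))"

definition discrete_wronskian ::
    "nat \<Rightarrow> (nat \<Rightarrow> complex \<Rightarrow> complex) \<Rightarrow> complex \<Rightarrow> complex" where
  "discrete_wronskian k f u = Determinant.det (Matrix.mat k k (\<lambda>(i, j). f i (u + of_nat j)))"

text \<open>
  The Wronskian of a basis \<open>h\<close> of \<open>U\<close> depends on the basis only up to a nonzero constant, so
  that letting \<open>h\<close> range over all bases does not change the span.
\<close>

definition special_conjugate_space ::
    "(complex \<Rightarrow> complex) set \<Rightarrow> nat \<Rightarrow> nat \<Rightarrow> (nat \<Rightarrow> nat) \<Rightarrow> (nat \<Rightarrow> complex) \<Rightarrow>
     (complex \<Rightarrow> complex) set" where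
  "special_conjugate_space U M N n lam =
     cfun.span {\<lambda>u. shift (discrete_wronskian (M - 1) f) u /
                      (poly (special_fundamental_difference_op U M N n lam M) u *
                       discrete_wronskian M h u) | f h.
                (\<forall>i<M - 1. f i \<in> U) \<and> basis_of U M h}"

text \<open>
  The set \<open>S\<^sub>i = {\<lambda>\<^sub>i - 1, \<lambda>\<^sub>i, \<dots>, \<lambda>\<^sub>i + n\<^sub>i - 1}\<close>, which contains the poles congruent to \<open>\<lambda>\<^sub>i\<close>
  modulo the integers of the functions in the conjugate space.
\<close>

definition pole_set :: "(nat \<Rightarrow> nat) \<Rightarrow> (nat \<Rightarrow> complex) \<Rightarrow> nat \<Rightarrow> complex set" where
  "pole_set n lam i = {lam i - 1 + of_nat k | k. k \<le> n i}"

text \<open>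
  \<open>valid_path\<close> is piecewise \<open>C\<^sup>1\<close>, as contour integrals require. A simple closed path is oriented
  counterclockwise iff its winding number about the points inside is \<open>1\<close> (and not \<open>-1\<close>).
\<close>

definition admissible_contour ::
    "nat \<Rightarrow> (nat \<Rightarrow> nat) \<Rightarrow> (nat \<Rightarrow> complex) \<Rightarrow> nat \<Rightarrow> (real \<Rightarrow> complex) \<Rightarrow> bool" where
  "admissible_contour N n lam i g \<longleftrightarrow>
     valid_path g \<and> simple_path g \<and> pathfinish g = pathstart g \<and>
     (\<forall>w\<in>inside (path_image g). winding_number g w = 1) \<and>
     pole_set n lam i \<subseteq> inside (path_image g) \<and>
     (\<forall>j<N. j \<noteq> i \<longrightarrow> pole_set n lam j \<inter> (inside (path_image g) \<union> path_image g) = {})"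

text \<open>
  A multivalued function of \<open>x \<in> \<complex> - {0}\<close> is represented by a function \<open>F\<close> on the universal
  cover, i.e. as a function of \<open>t = ln x\<close>, where \<open>x = exp t\<close>. For instance \<open>x\<^sup>\<mu>\<close> is
  \<open>\<lambda>t. exp (\<mu> * t)\<close>. The single-valued branch of \<open>F\<close> near \<open>x\<^sub>0 = exp t\<^sub>0\<close> whose logarithm takes the
  value \<open>t\<^sub>0\<close> at \<open>x\<^sub>0\<close> is \<open>branch F t\<^sub>0\<close>.
\<close>

definition branch :: "(complex \<Rightarrow> complex) \<Rightarrow> complex \<Rightarrow> complex \<Rightarrow> complex" where
  "branch F t\<^sub>0 x = F (t\<^sub>0 + Ln (x / exp t\<^sub>0))"

definition mv_deriv :: "(complex \<Rightarrow> complex) \<Rightarrow> complex \<Rightarrow> complex" where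
  "mv_deriv F t = deriv (branch F t) (exp t)"

definition mv_euler :: "(complex \<Rightarrow> complex) \<Rightarrow> complex \<Rightarrow> complex" where
  "mv_euler F t = exp t * mv_deriv F t"

text \<open>
  \<open>V\<close> consists of multivalued functions, so \<open>has_exponents\<close> asks for the root of multiplicity
  \<open>e i\<close> at \<open>z\<close> on every branch. For spans of functions \<open>x\<^sup>\<mu> p(x)\<close>, which are invariant under
  monodromy, the exponents do not depend on the branch.
\<close>

definition has_exponents ::
    "(complex \<Rightarrow> complex) set \<Rightarrow> nat \<Rightarrow> complex \<Rightarrow> (nat \<Rightarrow> int) \<Rightarrow> bool" where
  "has_exponents V N z e \<longleftrightarrow>
     strict_mono_on {..<N} e \<and>
     (\<forall>t. exp t = z \<longrightarrow> (\<forall>i<N. \<exists>f\<in>V. f \<noteq> 0 \<and> zorder (branch f t) z = e i))"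

definition singular_point :: "(complex \<Rightarrow> complex) set \<Rightarrow> nat \<Rightarrow> complex \<Rightarrow> bool" where
  "singular_point V N z \<longleftrightarrow> (\<forall>e. has_exponents V N z e \<longrightarrow> e ` {..<N} \<noteq> {0..<int N})"

definition quasi_polynomial_space ::
    "(complex \<Rightarrow> complex) set \<Rightarrow> nat \<Rightarrow> nat \<Rightarrow> (nat \<Rightarrow> nat) \<Rightarrow> (nat \<Rightarrow> complex) \<Rightarrow> (nat \<Rightarrow> nat) \<Rightarrow>
     (nat \<Rightarrow> complex) \<Rightarrow> bool" where
  "quasi_polynomial_space V N M n \<mu> m z \<longleftrightarrow>
     (\<forall>i<N. \<forall>j<N. i \<noteq> j \<longrightarrow> \<mu> i - \<mu> j \<notin> \<int>) \<and>
     (\<exists>p :: nat \<Rightarrow> complex poly.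
        (\<forall>i<N. degree (p i) = n i \<and> poly (p i) 0 \<noteq> 0) \<and>
        V = cfun.span ((\<lambda>i t. exp (\<mu> i * t) * poly (p i) (exp t)) ` {..<N})) \<and>
     cfun.dim V = N \<and>
     inj_on z {..<M} \<and> (\<forall>a<M. z a \<noteq> 0) \<and>
     (\<forall>x. x \<noteq> 0 \<and> singular_point V N x \<longrightarrow> x \<in> z ` {..<M}) \<and>
     (\<forall>a<M. has_exponents V N (z a)
        (\<lambda>i. if i = N - 1 then int (N - 1 + m a) else int i))"

text \<open>
  As for difference operators, \<open>c k\<close> is the coefficient of \<open>\<partial>\<^sub>x\<^sup>N\<^sup>-\<^sup>k\<close>; it is a single-valued
  function of \<open>x = exp t\<close>.
\<close>

definition fundamental_differential_op ::
    "(complex \<Rightarrow> complex) set \<Rightarrow> nat \<Rightarrow> (nat \<Rightarrow> complex \<Rightarrow> complex) \<Rightarrow> bool" where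
  "fundamental_differential_op V N c \<longleftrightarrow>
     (\<forall>k\<le>N. c k meromorphic_on UNIV) \<and> (\<forall>x. c 0 x = 1) \<and>
     (\<forall>f\<in>V. eventually (\<lambda>t. (\<Sum>k\<le>N. c k (exp t) * (mv_deriv ^^ (N - k)) f t) = 0)
        (cosparse UNIV))"

text \<open>
  \<open>D\<close> is the operator \<open>x\<^sup>N \<Prod>\<^sub>a (x - z\<^sub>a) D\<^sub>V\<close>, where \<open>D\<^sub>V\<close> is the monic operator of order \<open>N\<close>
  annihilating \<open>V\<close>. Equality of differential operators is equality of their actions on all
  holomorphic functions on the universal cover; already \<open>1, x, \<dots>, x\<^sup>N\<close> determine the coefficients.
\<close>

definition special_fundamental_differential_op ::
    "(complex \<Rightarrow> complex) set \<Rightarrow> nat \<Rightarrow> nat \<Rightarrow> (nat \<Rightarrow> complex) \<Rightarrow>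
     ((complex \<Rightarrow> complex) \<Rightarrow> complex \<Rightarrow> complex) \<Rightarrow> bool" where
  "special_fundamental_differential_op V N M z D \<longleftrightarrow>
     (\<exists>c. fundamental_differential_op V N c \<and>
        (\<forall>F. F holomorphic_on UNIV \<longrightarrow>
           eventually (\<lambda>t. D F t = exp t ^ N * (\<Prod>a<M. exp t - z a) *
                             (\<Sum>k\<le>N. c k (exp t) * (mv_deriv ^^ (N - k)) F t))
             (cosparse UNIV)))"

text \<open>The multivalued function \<open>x \<mapsto> \<integral>\<^sub>g x\<^sup>u f(u) du\<close>, as a function of \<open>t = ln x\<close>.\<close>

definition integral_transform ::
    "(real \<Rightarrow> complex) \<Rightarrow> (complex \<Rightarrow> complex) \<Rightarrow> complex \<Rightarrow> complex" where
  "integral_transform g f t = contour_integral g (\<lambda>u. exp (u * t) * f u)"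

end

theory Submission
  imports Defs "HOL-Combinatorics.Stirling"
begin

text \<open>
  The transform turns multiplication by \<open>u\<close> into \<open>x \<partial>\<^sub>x\<close> and the inverse shift into multiplication by
  \<open>x\<close>. The conjugate space consists of solutions of the difference equation adjoint to the one of
  \<open>U\<close>, so the operator of part (ii) annihilates the transforms, and everything else is read off
  from that differential equation. The four ingredients are these.

  \<^item> \<^emph>\<open>The difference operator of\<close> \<open>U\<close>. Up to the entire factor \<open>\<Prod>\<^sub>a z\<^sub>a\<^sup>u\<close> the discrete Wronskian of \<open>U\<close>
    is a polynomial \<open>W\<close> of degree at most \<open>\<Sum>\<^sub>a m\<^sub>a\<close>. The exponents at \<open>\<lambda>\<^sub>i\<close> force the zeros
    \<open>\<lambda>\<^sub>i, \<dots>, \<lambda>\<^sub>i + n\<^sub>i - 1\<close>, and \<open>\<Sum>\<^sub>i n\<^sub>i = \<Sum>\<^sub>a m\<^sub>a\<close> leaves room for no other zero (\<open>W_factor\<close>). The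
    coefficients of the operator come from Cramer's rule, and since the zeros of \<open>W\<close> are known,
    they are seen to be polynomials of degree at most \<open>N\<close> after multiplication by
    \<open>\<Prod>\<^sub>i (u - \<lambda>\<^sub>i - n\<^sub>i + 1)\<close> (\<open>special_difference_op_eq_B\<close>).

  \<^item> \<^emph>\<open>The transforms.\<close> By the formula for \<open>W\<close>, the functions in the conjugate space have at most
    simple poles, all of them in the sets \<open>S\<^sub>i\<close>. In a basis of \<open>U\<close> that realises the exponents at
    \<open>\<lambda>\<^sub>i\<close>, the last basis function vanishes along the whole progression. Hence the residues on \<open>S\<^sub>i\<close> of
    any two functions of the conjugate space are proportional, and for the function built from such a
    basis the residues at both ends of \<open>S\<^sub>i\<close> are nonzero. So each contour contributes a single function
    \<open>x\<^bsup>\<lambda>\<^sub>i - 1\<^esup> p\<^sub>i(x)\<close> with \<open>deg p\<^sub>i = n\<^sub>i\<close> and \<open>p\<^sub>i(0) \<noteq> 0\<close> (\<open>span_transforms_eq\<close>).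

  \<^item> \<^emph>\<open>The differential equation.\<close> Taking residues in the adjoint equation gives a recursion for the
    coefficients of \<open>p\<^sub>i\<close>, which says exactly that the transformed operator annihilates
    \<open>x\<^bsup>\<lambda>\<^sub>i - 1\<^esup> p\<^sub>i(x)\<close> (\<open>adjoint_equation_residues\<close>, \<open>transform_fun_ode\<close>).

  \<^item> \<^emph>\<open>The exponents.\<close> Comparing the two highest powers of \<open>u\<close> in the equation for \<open>z\<^sub>a\<^sup>u q\<^sub>a(u)\<close> shows that
    the coefficient of \<open>(x \<partial>\<^sub>x)\<^sup>N\<close> is \<open>\<Prod>\<^sub>a (x - z\<^sub>a)\<close> and determines the coefficient of
    \<open>(x \<partial>\<^sub>x)\<^bsup>N - 1\<^esup>\<close> at \<open>z\<^sub>a\<close> (\<open>theta_coeff_N_eq\<close>, \<open>theta_coeff_subleading\<close>). Away from the \<open>z\<^sub>a\<close>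
    the equation is regular, so a nonzero solution vanishes to order less than \<open>N\<close>. At \<open>z\<^sub>a\<close> the
    indicial equation has the roots \<open>0, \<dots>, N - 2, N - 1 + m\<^sub>a\<close>. As \<open>V\<close> has dimension \<open>N\<close>, each of
    these \<open>N\<close> possible orders occurs (\<open>orders_of_function_space\<close>).

  Multivalued functions of \<open>x = exp t\<close> are entire functions of \<open>t\<close> throughout, so that \<open>x \<partial>\<^sub>x\<close> is
  the ordinary derivative with respect to \<open>t\<close>.
\<close>

section \<open>Determinants of matrices given by their entries\<close>

text \<open>
  Matrices are functions of two natural numbers here, because determinants of sizes \<open>M\<close> and \<open>M - 1\<close>
  and entries that are polynomials, their values and functions of \<open>u\<close> occur side by side.
\<close>

definition detn :: "nat \<Rightarrow> (nat \<Rightarrow> nat \<Rightarrow> 'a :: comm_ring_1) \<Rightarrow> 'a" where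
  "detn n A = Determinant.det (Matrix.mat n n (\<lambda>(i, j). A i j))"

lemma detn_leibniz:
  "detn n A = (\<Sum>p \<in> {p. p permutes {0..<n}}. signof p * (\<Prod>i = 0..<n. A i (p i)))"
  unfolding detn_def
  by (subst det_def'[of _ n]) (auto intro!: sum.cong prod.cong arg_cong2[of _ _ _ _ "(*)"])

lemma detn_cong:
  assumes "\<And>i j. i < n \<Longrightarrow> j < n \<Longrightarrow> A i j = B i j"
  shows "detn n A = detn n B"
  unfolding detn_def by (intro arg_cong[of _ _ Determinant.det] eq_matI) (auto simp: assms)

lemma detn_mult:
  "detn n (\<lambda>i j. \<Sum>k<n. A i k * B k j) = detn n A * detn n B"
proof -
  have "Matrix.mat n n (\<lambda>(i, j). \<Sum>k<n. A i k * B k j)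
        = Matrix.mat n n (\<lambda>(i, j). A i j) * Matrix.mat n n (\<lambda>(i, j). B i j)"
    by (rule eq_matI) (auto simp: scalar_prod_def lessThan_atLeast0)
  then show ?thesis
    unfolding detn_def by (simp add: Determinant.det_mult[of _ n])
qed

lemma detn_transpose: "detn n (\<lambda>i j. A j i) = detn n A"
proof -
  have "Matrix.mat n n (\<lambda>(i, j). A j i) = Matrix.transpose_mat (Matrix.mat n n (\<lambda>(i, j). A i j))"
    by (rule eq_matI) auto
  then show ?thesis
    unfolding detn_def by (simp add: Determinant.det_transpose[of _ n])
qed

lemma detn_scale_rows: "detn n (\<lambda>i j. c i * A i j) = (\<Prod>i<n. c i) * detn n A"
  unfolding detn_leibniz
  by (simp add: prod.distrib sum_distrib_left lessThan_atLeast0 mult_ac)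

lemma poly_detn: "poly (detn n A) u = detn n (\<lambda>i j. poly (A i j) u)"
proof -
  have "poly (signof p) u = signof p" for p :: "nat \<Rightarrow> nat"
    by (simp add: sign_def)
  then show ?thesis
    unfolding detn_leibniz by (simp add: poly_sum poly_prod)
qed

lemma degree_detn_le:
  assumes "\<And>i j. i < n \<Longrightarrow> j < n \<Longrightarrow> degree (A i j) \<le> d i"
  shows "degree (detn n A) \<le> (\<Sum>i<n. d i)"
  unfolding detn_leibniz
proof (rule degree_sum_le)
  show "finite {p. p permutes {0..<n}}" by (simp add: finite_permutations)
next
  fix p :: "nat \<Rightarrow> nat"
  assume "p \<in> {p. p permutes {0..<n}}"
  then have p: "p permutes {0..<n}" by simp
  have "degree (signof p * (\<Prod>i = 0..<n. A i (p i))) \<le> degree (\<Prod>i = 0..<n. A i (p i))"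
    by (rule order.trans[OF degree_mult_le]) (simp add: sign_def)
  also have "\<dots> \<le> (\<Sum>i = 0..<n. degree (A i (p i)))"
    using degree_prod_sum_le[of "{0..<n}" "\<lambda>i. A i (p i)"] by (simp add: o_def)
  also have "\<dots> \<le> (\<Sum>i = 0..<n. d i)"
    by (rule sum_mono, rule assms) (use permutes_in_image[OF p] in auto)
  finally show "degree (signof p * (\<Prod>i = 0..<n. A i (p i))) \<le> (\<Sum>i<n. d i)"
    by (simp add: lessThan_atLeast0)
qed

lemma detn_eq_0_iff:
  fixes A :: "nat \<Rightarrow> nat \<Rightarrow> 'a :: idom"
  shows "detn n A = 0 \<longleftrightarrow> (\<exists>v. (\<exists>k<n. v k \<noteq> 0) \<and> (\<forall>i<n. (\<Sum>j<n. A i j * v j) = 0))"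
proof -
  let ?A = "Matrix.mat n n (\<lambda>(i, j). A i j)"
  have "detn n A = 0 \<longleftrightarrow>
      (\<exists>v. v \<in> carrier_vec n \<and> v \<noteq> 0\<^sub>v n \<and> ?A *\<^sub>v v = 0\<^sub>v n)"
    unfolding detn_def by (rule det_0_iff_vec_prod_zero) auto
  also have "\<dots> \<longleftrightarrow> (\<exists>v. (\<exists>k<n. v k \<noteq> 0) \<and> (\<forall>i<n. (\<Sum>j<n. A i j * v j) = 0))"
  proof
    assume "\<exists>v. v \<in> carrier_vec n \<and> v \<noteq> 0\<^sub>v n \<and> ?A *\<^sub>v v = 0\<^sub>v n"
    then obtain v where v: "v \<in> carrier_vec n" "v \<noteq> 0\<^sub>v n" "?A *\<^sub>v v = 0\<^sub>v n"
      by blast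
    have "\<exists>k<n. vec_index v k \<noteq> 0"
      using v(1,2) by (auto simp: vec_eq_iff)
    moreover have "(\<Sum>j<n. A i j * vec_index v j) = 0" if "i < n" for i
    proof -
      have "vec_index (?A *\<^sub>v v) i = 0" using v(3) that by simp
      then show ?thesis using that v(1)
        by (simp add: scalar_prod_def lessThan_atLeast0)
    qed
    ultimately show "\<exists>v. (\<exists>k<n. v k \<noteq> 0) \<and> (\<forall>i<n. (\<Sum>j<n. A i j * v j) = 0)"
      by blast
  next
    assume "\<exists>v. (\<exists>k<n. v k \<noteq> 0) \<and> (\<forall>i<n. (\<Sum>j<n. A i j * v j) = 0)"
    then obtain v k where v: "k < n" "v k \<noteq> 0" "\<And>i. i < n \<Longrightarrow> (\<Sum>j<n. A i j * v j) = 0"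
      by blast
    have "Matrix.vec n v \<noteq> 0\<^sub>v n"
      using v(1,2) by (auto simp: vec_eq_iff)
    moreover have "?A *\<^sub>v Matrix.vec n v = 0\<^sub>v n"
      by (rule eq_vecI) (use v(3) in \<open>auto simp: scalar_prod_def lessThan_atLeast0\<close>)
    ultimately show "\<exists>v. v \<in> carrier_vec n \<and> v \<noteq> 0\<^sub>v n \<and> ?A *\<^sub>v v = 0\<^sub>v n"
      by (intro exI[of _ "Matrix.vec n v"]) auto
  qed
  finally show ?thesis .
qed

text \<open>
  A nontrivial relation between the rows is how all zeros of discrete Wronskians are found below.
\<close>

lemma detn_eq_0_iff_left:
  fixes A :: "nat \<Rightarrow> nat \<Rightarrow> 'a :: idom"
  shows "detn n A = 0 \<longleftrightarrow> (\<exists>v. (\<exists>k<n. v k \<noteq> 0) \<and> (\<forall>j<n. (\<Sum>i<n. v i * A i j) = 0))"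
  using detn_eq_0_iff[of n "\<lambda>i j. A j i"] by (simp add: detn_transpose[of n A] mult.commute)

abbreviation replace_column ::
    "(nat \<Rightarrow> nat \<Rightarrow> 'a) \<Rightarrow> nat \<Rightarrow> (nat \<Rightarrow> 'a) \<Rightarrow> nat \<Rightarrow> nat \<Rightarrow> 'a" where
  "replace_column A k b \<equiv> \<lambda>i j. if j = k then b i else A i j"

lemma detn_scale_column:
  assumes "k < n"
  shows "detn n (replace_column A k (\<lambda>i. c * b i)) = c * detn n (replace_column A k b)"
proof -
  have eq: "(\<Prod>i = 0..<n. if p i = k then c * b i else A i (p i))
        = c * (\<Prod>i = 0..<n. if p i = k then b i else A i (p i))"
    if p: "p permutes {0..<n}" for p
  proof -
    obtain l where l: "l < n" "p l = k"
      using permutes_surj[OF p] permutes_in_image[OF p] assms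
      by (metis atLeastLessThan_iff surj_def zero_le)
    have ne: "p i \<noteq> k" if "i \<noteq> l" for i
      using permutes_inj[OF p] l(2) that by (metis injD)
    have "(\<Prod>i = 0..<n. if p i = k then c * b i else A i (p i))
        = (if p l = k then c * b l else A l (p l)) *
          (\<Prod>i \<in> {0..<n} - {l}. if p i = k then c * b i else A i (p i))"
      by (rule prod.remove) (use l in auto)
    also have "(\<Prod>i \<in> {0..<n} - {l}. if p i = k then c * b i else A i (p i))
        = (\<Prod>i \<in> {0..<n} - {l}. if p i = k then b i else A i (p i))"
      by (rule prod.cong) (use ne in auto)
    also have "(if p l = k then c * b l else A l (p l)) * \<dots>
        = c * ((if p l = k then b l else A l (p l)) * \<dots>)"
      using l by simp
    also have "(if p l = k then b l else A l (p l)) *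
          (\<Prod>i \<in> {0..<n} - {l}. if p i = k then b i else A i (p i))
        = (\<Prod>i = 0..<n. if p i = k then b i else A i (p i))"
      by (rule prod.remove[symmetric]) (use l in auto)
    finally show ?thesis .
  qed
  show ?thesis
    unfolding detn_leibniz sum_distrib_left
    by (rule sum.cong) (auto simp: eq)
qed

lemma cramer_column:
  assumes "k < n" and "\<And>i. i < n \<Longrightarrow> (\<Sum>j<n. A i j * x j) = b i"
  shows "detn n (replace_column A k b) = x k * detn n A"
proof -
  let ?A = "Matrix.mat n n (\<lambda>(i, j). A i j)"
  have "vec_index (?A *\<^sub>v Matrix.vec n x) i = b i" if "i < n" for i
    using assms(2)[OF that] that by (simp add: scalar_prod_def lessThan_atLeast0)
  then have "Matrix.mat n n (\<lambda>(i, j). if j = k then b i else A i j)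
      = replace_col ?A (?A *\<^sub>v Matrix.vec n x) k"
    by (intro eq_matI) (auto simp: replace_col_def simp del: index_mult_mat_vec)
  then show ?thesis
    using cramer_lemma_mat[of ?A n "Matrix.vec n x" k] assms(1) by (simp add: detn_def)
qed

text \<open>
  Cramer's rule without denominators. The adjugate applied to \<open>b\<close> solves the system with right-hand
  side \<open>det A \<cdot> b\<close>; Cramer's rule for that system identifies its entries, since the factor
  \<open>det A\<close> cancels in an integral domain.
\<close>

lemma cramer_solution:
  fixes A :: "nat \<Rightarrow> nat \<Rightarrow> 'a :: idom"
  assumes "detn n A \<noteq> 0" and "i < n"
  shows "(\<Sum>k<n. A i k * detn n (replace_column A k b)) = detn n A * b i"
proof -
  let ?A = "Matrix.mat n n (\<lambda>(i, j). A i j)"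
  define y where "y = adj_mat ?A *\<^sub>v Matrix.vec n b"
  have car: "?A \<in> carrier_mat n n" by simp
  have y: "y \<in> carrier_vec n"
    unfolding y_def using adj_mat(1)[OF car] by (intro mult_mat_vec_carrier) auto
  have "?A *\<^sub>v y = (?A * adj_mat ?A) *\<^sub>v Matrix.vec n b"
    unfolding y_def using adj_mat(1)[OF car] by (intro assoc_mult_mat_vec[symmetric]) auto
  also have "\<dots> = detn n A \<cdot>\<^sub>v Matrix.vec n b"
    unfolding adj_mat(2)[OF car] detn_def by (rule eq_vecI) auto
  finally have Ay: "?A *\<^sub>v y = detn n A \<cdot>\<^sub>v Matrix.vec n b" .
  have sys: "(\<Sum>k<n. A i k * vec_index y k) = detn n A * b i" if "i < n" for i
    using arg_cong[OF Ay, of "\<lambda>v. vec_index v i"] that y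
    by (simp add: scalar_prod_def lessThan_atLeast0)
  have "vec_index y k = detn n (replace_column A k b)" if "k < n" for k
  proof -
    have "detn n (replace_column A k (\<lambda>i. detn n A * b i)) = vec_index y k * detn n A"
      by (rule cramer_column[OF that sys])
    then show ?thesis
      using assms(1) detn_scale_column[OF that, where A = A and c = "detn n A" and b = b] by simp
  qed
  then show ?thesis
    using sys[OF assms(2)] by simp
qed

lemma detn_last_column:
  assumes "\<And>i. i < n \<Longrightarrow> A i n = 0"
  shows "detn (Suc n) A = A n n * detn n A"
proof -
  let ?A = "Matrix.mat (Suc n) (Suc n) (\<lambda>(i, j). A i j)"
  have "detn (Suc n) A = (\<Sum>i<Suc n. ?A $$ (i, n) * cofactor ?A i n)"
    unfolding detn_def by (rule laplace_expansion_column) auto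
  also have "\<dots> = A n n * cofactor ?A n n"
    using assms by simp
  also have "cofactor ?A n n = detn n A"
  proof -
    have "mat_delete ?A n n = Matrix.mat n n (\<lambda>(i, j). A i j)"
      by (rule eq_matI) (auto simp: mat_delete_def)
    then show ?thesis by (simp add: cofactor_def detn_def)
  qed
  finally show ?thesis .
qed

lemma detn_last_row:
  assumes "\<And>j. j < n \<Longrightarrow> A n j = 0"
  shows "detn (Suc n) A = A n n * detn n A"
  using detn_last_column[of n "\<lambda>i j. A j i"] assms by (simp add: detn_transpose[of n A] detn_transpose[of "Suc n" A])

lemma detn_upper_triangular:
  assumes "\<And>i j. i < n \<Longrightarrow> j < i \<Longrightarrow> A i j = 0"
  shows "detn n A = (\<Prod>i<n. A i i)"
  using assms
proof (induction n)
  case 0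
  then show ?case by (simp add: detn_leibniz)
next
  case (Suc n)
  then show ?case by (simp add: detn_last_row mult.commute)
qed

text \<open>
  The case of Cramer's rule that produces the coefficient of \<open>\<tau>\<^sup>0\<close>: replacing the first of the columns
  \<open>0, \<dots>, n - 1\<close> by column \<open>n\<close> gives the determinant of the columns \<open>1, \<dots>, n\<close>, up to sign.
\<close>

lemma detn_rotate_columns:
  assumes "0 < n"
  shows "detn n (replace_column A 0 (\<lambda>i. A i n)) = (-1) ^ (n - 1) * detn n (\<lambda>i j. A i (Suc j))"
proof -
  let ?A = "Matrix.mat n n (\<lambda>(i, j). A i (Suc j))"
  have n: "n = 1 + (n - 1)" using assms by simp
  have "Determinant.det ?A = (-1) ^ (1 * (n - 1)) *
      Determinant.det (Matrix.mat (1 + (n - 1)) (1 + (n - 1))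
        (\<lambda>(i, j). ?A $$ (i, if j < 1 then j + (n - 1) else j - 1)))"
    by (rule det_swap_cols) (use assms in auto)
  also have "Matrix.mat (1 + (n - 1)) (1 + (n - 1))
        (\<lambda>(i, j). ?A $$ (i, if j < 1 then j + (n - 1) else j - 1))
      = Matrix.mat n n (\<lambda>(i, j). replace_column A 0 (\<lambda>i. A i n) i j)"
    using assms by (intro eq_matI) auto
  finally have "detn n (\<lambda>i j. A i (Suc j)) = (-1) ^ (n - 1) * detn n (replace_column A 0 (\<lambda>i. A i n))"
    by (simp add: detn_def)
  then have "(-1) ^ (n - 1) * detn n (\<lambda>i j. A i (Suc j))
      = ((-1) ^ (n - 1) * (-1) ^ (n - 1)) * detn n (replace_column A 0 (\<lambda>i. A i n))"
    by (simp add: mult.assoc)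
  then show ?thesis by (simp flip: power_mult_distrib)
qed

section \<open>Finite-dimensional spaces of functions\<close>

lemma sum_fun_apply: "(\<Sum>a\<in>A. f a) x = (\<Sum>a\<in>A. f a x)"
  by (induction A rule: infinite_finite_induct) auto

lemma cfun_span_image_iff:
  fixes k :: nat
  shows "f \<in> cfun.span (g ` {..<k}) \<longleftrightarrow> (\<exists>c. f = (\<lambda>u. \<Sum>a<k. c a * g a u))"
proof
  assume "f \<in> cfun.span (g ` {..<k})"
  then show "\<exists>c. f = (\<lambda>u. \<Sum>a<k. c a * g a u)"
  proof (induction rule: cfun.span_induct_alt)
    case base
    show ?case by (rule exI[of _ "\<lambda>_. 0"]) (simp add: zero_fun_def)
  next
    case (step x h y)
    obtain b where b: "b < k" "h = g b" using step.hyps by auto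
    obtain c where c: "y = (\<lambda>u. \<Sum>a<k. c a * g a u)" using step.IH by blast
    have eq: "cfun_scale x h + y = (\<lambda>u. \<Sum>a<k. ((if a = b then x else 0) + c a) * g a u)"
    proof
      fix u
      have "(\<Sum>a<k. ((if a = b then x else 0) + c a) * g a u)
          = (\<Sum>a<k. (if a = b then x * g b u else 0) + c a * g a u)"
        by (rule sum.cong) (auto simp: algebra_simps)
      then show "(cfun_scale x h + y) u = (\<Sum>a<k. ((if a = b then x else 0) + c a) * g a u)"
        using b by (simp add: cfun_scale_def c sum.distrib)
    qed
    show ?case by (rule exI, rule eq)
  qed
next
  assume "\<exists>c. f = (\<lambda>u. \<Sum>a<k. c a * g a u)"
  then obtain c where c: "f = (\<lambda>u. \<Sum>a<k. c a * g a u)" by blast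
  have "f = (\<Sum>a<k. cfun_scale (c a) (g a))"
    by (simp add: c fun_eq_iff sum_fun_apply cfun_scale_def)
  also have "\<dots> \<in> cfun.span (g ` {..<k})"
    by (intro cfun.span_sum cfun.span_scale cfun.span_base) auto
  finally show "f \<in> cfun.span (g ` {..<k})" .
qed

lemma basis_of_independent:
  assumes "basis_of U k h" and "\<And>u. (\<Sum>a<k. c a * h a u) = 0" and "b < k"
  shows "c b = 0"
proof -
  have inj: "inj_on h {..<k}" and ind: "\<not> cfun.dependent (h ` {..<k})"
    using assms(1) by (auto simp: basis_of_def)
  define d where "d = (\<lambda>f. c (the_inv_into {..<k} h f))"
  have d: "d (h a) = c a" if "a < k" for a
    using that inj by (simp add: d_def the_inv_into_f_f)
  have "(\<Sum>f\<in>h ` {..<k}. cfun_scale (d f) f) = (\<Sum>a<k. cfun_scale (d (h a)) (h a))"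
    using inj by (simp add: sum.reindex)
  also have "\<dots> = 0"
    by (simp add: fun_eq_iff sum_fun_apply cfun_scale_def d assms(2))
  finally have "(\<Sum>f\<in>h ` {..<k}. cfun_scale (d f) f) = 0" .
  then have "d (h b) = 0"
    by (intro cfun.independentD[OF ind, of "h ` {..<k}" d]) (use assms(3) in auto)
  then show ?thesis using d assms(3) by simp
qed

lemma cfun_dim_span:
  fixes k :: nat
  assumes "\<And>c. (\<And>u. (\<Sum>a<k. c a * h a u) = 0) \<Longrightarrow> (\<forall>a<k. c a = 0)"
  shows "cfun.dim (cfun.span (h ` {..<k})) = k"
proof -
  have inj: "inj_on h {..<k}"
  proof (rule inj_onI, rule ccontr)
    fix a b assume ab: "a \<in> {..<k}" "b \<in> {..<k}" "h a = h b" "a \<noteq> b"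
    have "(\<Sum>i<k. (if i = a then 1 else if i = b then -1 else 0) * h i u) = 0" for u
    proof -
      have "(\<Sum>i<k. (if i = a then 1 else if i = b then -1 else 0) * h i u)
          = (\<Sum>i<k. (if i = a then h i u else 0) - (if i = b then h i u else 0))"
        using ab(4) by (intro sum.cong) auto
      then show ?thesis using ab(1-3) by (simp add: sum_subtractf)
    qed
    from assms[OF this] show False using ab by (auto split: if_splits)
  qed
  have "\<not> cfun.dependent (h ` {..<k})"
  proof (rule cfun.independent_if_scalars_zero)
    show "finite (h ` {..<k})" by simp
    fix d f assume *: "(\<Sum>f\<in>h ` {..<k}. cfun_scale (d f) f) = 0" "f \<in> h ` {..<k}"
    have "(\<Sum>a<k. cfun_scale (d (h a)) (h a)) = 0"
      using *(1) inj by (simp add: sum.reindex)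
    then have "(\<Sum>a<k. d (h a) * h a u) = 0" for u
      by (auto simp: fun_eq_iff sum_fun_apply cfun_scale_def)
    from assms[OF this] show "d f = 0" using *(2) by auto
  qed
  then have "cfun.dim (cfun.span (h ` {..<k})) = card (h ` {..<k})"
    by (rule cfun.dim_span_eq_card_independent)
  then show ?thesis using inj by (simp add: card_image)
qed

text \<open>
  A nontrivial relation between the rows of the transition matrix would be a linear relation between
  the functions \<open>h i\<close>.
\<close>

lemma basis_of_transition:
  assumes "basis_of U k h" and "U = cfun.span (F ` {..<k})"
  obtains T where "\<And>i u. i < k \<Longrightarrow> h i u = (\<Sum>a<k. T i a * F a u)" and "detn k T \<noteq> 0"
proof -
  have "h i \<in> cfun.span (F ` {..<k})" if "i < k" for i
    using assms that by (auto simp: basis_of_def intro: cfun.span_base)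
  then have "\<forall>i\<in>{..<k}. \<exists>c. h i = (\<lambda>u. \<Sum>a<k. c a * F a u)"
    by (auto simp: cfun_span_image_iff)
  then obtain T where "\<forall>i\<in>{..<k}. h i = (\<lambda>u. \<Sum>a<k. T i a * F a u)"
    by (rule bchoice[THEN exE])
  then have T: "h i u = (\<Sum>a<k. T i a * F a u)" if "i < k" for i u
    using that by simp
  have "detn k T \<noteq> 0"
  proof
    assume "detn k T = 0"
    then obtain v l where v: "l < k" "v l \<noteq> 0" "\<And>a. a < k \<Longrightarrow> (\<Sum>i<k. v i * T i a) = 0"
      by (auto simp: detn_eq_0_iff_left)
    have "(\<Sum>i<k. v i * h i u) = 0" for u
    proof -
      have "(\<Sum>i<k. v i * h i u) = (\<Sum>i<k. \<Sum>a<k. v i * T i a * F a u)"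
        by (simp add: T sum_distrib_left mult.assoc)
      also have "\<dots> = (\<Sum>a<k. (\<Sum>i<k. v i * T i a) * F a u)"
        by (subst sum.swap) (simp add: sum_distrib_right)
      finally show ?thesis by (simp add: v)
    qed
    then show False using basis_of_independent[OF assms(1)] v(1,2) by blast
  qed
  with T show thesis by (rule that)
qed

section \<open>Polynomials with prescribed simple roots\<close>

lemma prod_linear_factors_dvd:
  fixes p :: "'a :: idom poly"
  assumes "finite R" and "\<And>r. r \<in> R \<Longrightarrow> poly p r = 0"
  shows "(\<Prod>r\<in>R. [:-r, 1:]) dvd p"
  using assms
proof (induction R rule: finite_induct)
  case (insert r R)
  then obtain k where k: "p = (\<Prod>r\<in>R. [:-r, 1:]) * k" by (auto elim: dvdE)
  have "poly p r = 0" using insert.prems by simp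
  then have "poly k r = 0"
    using insert.hyps by (auto simp: k poly_prod)
  then have "[:-r, 1:] dvd k" by (simp add: poly_eq_0_iff_dvd)
  then have "[:-r, 1:] * (\<Prod>r\<in>R. [:-r, 1:]) dvd k * (\<Prod>r\<in>R. [:-r, 1:])"
    by (rule mult_dvd_mono) simp
  then show ?case
    by (subst prod.insert[OF insert.hyps]) (simp only: k mult.commute)
qed simp

lemma degree_prod_linear_factors:
  "degree (\<Prod>r\<in>R. [:-r, 1 :: 'a :: idom:]) = card R"
  by (cases "finite R") (simp_all add: degree_prod_eq_sum_degree)

lemma poly_eq_smult_prod_linear_factors:
  fixes p :: "'a :: idom poly"
  assumes "finite R" and "\<And>r. r \<in> R \<Longrightarrow> poly p r = 0" and "p \<noteq> 0" and "degree p \<le> card R"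
  obtains c where "c \<noteq> 0" and "p = Polynomial.smult c (\<Prod>r\<in>R. [:-r, 1:])"
proof -
  obtain k where k: "p = (\<Prod>r\<in>R. [:-r, 1:]) * k"
    using prod_linear_factors_dvd[OF assms(1,2)] by (auto elim: dvdE)
  have "k \<noteq> 0" using assms(3) k by auto
  moreover have "(\<Prod>r\<in>R. [:-r, 1:]) \<noteq> (0 :: 'a poly)"
    using assms(1) by simp
  ultimately have "degree p = card R + degree k"
    using k by (simp add: degree_mult_eq degree_prod_linear_factors)
  then have "degree k = 0" using assms(4) by simp
  then obtain c where "k = [:c:]" by (rule degree_eq_zeroE)
  with k \<open>k \<noteq> 0\<close> show thesis by (intro that[of c]) auto
qed

section \<open>Difference equations satisfied by quasi-exponentials\<close>

lemma coeff_mult_top: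
  assumes "degree p \<le> n" and "degree q \<le> m"
  shows "coeff (p * q) (n + m) = coeff p n * coeff q m"
proof -
  have "coeff (p * q) (n + m) = (\<Sum>i\<le>n + m. coeff p i * coeff q (n + m - i))"
    by (simp add: coeff_mult)
  also have "\<dots> = (\<Sum>i\<in>{n}. coeff p i * coeff q (n + m - i))"
  proof (rule sum.mono_neutral_right)
    show "\<forall>i\<in>{..n + m} - {n}. coeff p i * coeff q (n + m - i) = 0"
    proof
      fix i assume "i \<in> {..n + m} - {n}"
      then consider "i < n" | "i > n" by force
      then show "coeff p i * coeff q (n + m - i) = 0"
      proof cases
        case 1
        then have "coeff q (n + m - i) = 0" by (intro coeff_eq_0) (use assms in simp)
        then show ?thesis by simp
      next
        case 2
        then have "coeff p i = 0" by (intro coeff_eq_0) (use assms in simp)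
        then show ?thesis by simp
      qed
    qed
  qed auto
  finally show ?thesis by simp
qed

lemma coeff_mult_second:
  assumes "degree p \<le> Suc n" and "degree q \<le> Suc m"
  shows "coeff (p * q) (Suc n + m) = coeff p n * coeff q (Suc m) + coeff p (Suc n) * coeff q m"
proof -
  have "coeff (p * q) (Suc n + m) = (\<Sum>i\<le>Suc n + m. coeff p i * coeff q (Suc n + m - i))"
    by (simp add: coeff_mult)
  also have "\<dots> = (\<Sum>i\<in>{n, Suc n}. coeff p i * coeff q (Suc n + m - i))"
  proof (rule sum.mono_neutral_right)
    show "\<forall>i\<in>{..Suc n + m} - {n, Suc n}. coeff p i * coeff q (Suc n + m - i) = 0"
    proof
      fix i assume "i \<in> {..Suc n + m} - {n, Suc n}"
      then consider "i < n" | "i > Suc n" by force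
      then show "coeff p i * coeff q (Suc n + m - i) = 0"
      proof cases
        case 1
        then have "coeff q (Suc n + m - i) = 0" by (intro coeff_eq_0) (use assms in simp)
        then show ?thesis by simp
      next
        case 2
        then have "coeff p i = 0" by (intro coeff_eq_0) (use assms in simp)
        then show ?thesis by simp
      qed
    qed
  qed auto
  finally show ?thesis by (simp add: Suc_diff_le)
qed

lemma coeff_pcompose_shift_top:
  fixes q :: "complex poly"
  shows "degree q \<le> m \<Longrightarrow> coeff (q \<circ>\<^sub>p [:c, 1:]) m = coeff q m"
proof (cases "degree q = m")
  case True
  have "lead_coeff (q \<circ>\<^sub>p [:c, 1:]) = lead_coeff q"
    using lead_coeff_comp[of "[:c, 1:]" q] by simp
  then show ?thesis using True by (simp add: degree_pcompose)
qed (auto simp: coeff_eq_0 degree_pcompose)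

text \<open>
  The first correction in \<open>q(u + c) = q(u) + c q'(u) + \<dots>\<close>.
\<close>

lemma coeff_pcompose_shift_second:
  fixes q :: "complex poly"
  assumes "degree q \<le> Suc m"
  shows "coeff (q \<circ>\<^sub>p [:c, 1:]) m = coeff q m + of_nat (Suc m) * c * coeff q (Suc m)"
  using assms
proof (induction q arbitrary: m)
  case (pCons a q)
  have deg: "degree q \<le> m"
    using pCons.prems by (cases "q = 0") auto
  show ?case
  proof (cases m)
    case 0
    with deg have "degree q = 0" by simp
    then obtain b where "q = [:b:]" by (rule degree_eq_zeroE)
    then show ?thesis using 0 by (simp add: pcompose_pCons algebra_simps)
  next
    case (Suc l)
    have "coeff (q \<circ>\<^sub>p [:c, 1:]) l = coeff q l + of_nat (Suc l) * c * coeff q (Suc l)"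
      by (rule pCons.IH) (use deg Suc in simp)
    moreover have "coeff (q \<circ>\<^sub>p [:c, 1:]) (Suc l) = coeff q (Suc l)"
      by (rule coeff_pcompose_shift_top) (use deg Suc in simp)
    ultimately show ?thesis
      using Suc by (simp add: pcompose_pCons algebra_simps)
  qed
qed simp

text \<open>
  Dividing the equation \<open>\<Sum>\<^sub>j C\<^sub>j(u) z\<^bsup>u + j\<^esup> q(u + j) = 0\<close> by \<open>z\<^sup>u u\<^sup>d q(u)\<close> and letting \<open>u\<close> tend to
  infinity leaves the leading coefficients, because \<open>q(u + j) / q(u)\<close> tends to \<open>1\<close>.
\<close>

lemma quasi_exponential_leading_coeff:
  fixes C :: "nat \<Rightarrow> complex poly"
  assumes "q \<noteq> 0" and eq: "(\<Sum>j\<in>J. C j * Polynomial.smult (z ^ j) (q \<circ>\<^sub>p [:of_nat j, 1:])) = 0"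
    and deg: "\<And>j. j \<in> J \<Longrightarrow> degree (C j) \<le> d"
  shows "(\<Sum>j\<in>J. coeff (C j) d * z ^ j) = 0"
proof -
  let ?m = "degree q"
  have "0 = (\<Sum>j\<in>J. coeff (C j * Polynomial.smult (z ^ j) (q \<circ>\<^sub>p [:of_nat j, 1:])) (d + ?m))"
    unfolding coeff_sum[symmetric] eq by simp
  also have "\<dots> = (\<Sum>j\<in>J. coeff (C j) d * (z ^ j * coeff q ?m))"
  proof (rule sum.cong)
    fix j assume j: "j \<in> J"
    have "coeff (C j * Polynomial.smult (z ^ j) (q \<circ>\<^sub>p [:of_nat j, 1:])) (d + ?m)
        = coeff (C j) d * coeff (Polynomial.smult (z ^ j) (q \<circ>\<^sub>p [:of_nat j, 1:])) ?m"
      by (rule coeff_mult_top) (use deg[OF j] in \<open>auto simp: degree_smult_eq degree_pcompose\<close>)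
    then show "coeff (C j * Polynomial.smult (z ^ j) (q \<circ>\<^sub>p [:of_nat j, 1:])) (d + ?m)
        = coeff (C j) d * (z ^ j * coeff q ?m)"
      by (simp add: coeff_pcompose_shift_top)
  qed simp
  also have "\<dots> = (\<Sum>j\<in>J. coeff (C j) d * z ^ j) * coeff q ?m"
    by (simp add: sum_distrib_right mult.assoc)
  finally show ?thesis using assms(1) by simp
qed

text \<open>
  The next order of the same expansion. The contribution of \<open>q(u + j) - q(u) \<approx> j q'(u)\<close> is \<open>j deg q\<close>
  times the leading coefficient; the second coefficient of \<open>q\<close> itself multiplies the sum that
  vanishes by the leading order.
\<close>

lemma quasi_exponential_subleading_coeff:
  fixes C :: "nat \<Rightarrow> complex poly"
  assumes "q \<noteq> 0" and eq: "(\<Sum>j\<in>J. C j * Polynomial.smult (z ^ j) (q \<circ>\<^sub>p [:of_nat j, 1:])) = 0"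
    and deg: "\<And>j. j \<in> J \<Longrightarrow> degree (C j) \<le> Suc d"
  shows "(\<Sum>j\<in>J. (coeff (C j) d + of_nat (degree q) * of_nat j * coeff (C j) (Suc d)) * z ^ j) = 0"
proof (cases "degree q")
  case 0
  then obtain b where b: "q = [:b:]" by (rule degree_eq_zeroE)
  have "0 = (\<Sum>j\<in>J. coeff (C j * Polynomial.smult (z ^ j) (q \<circ>\<^sub>p [:of_nat j, 1:])) d)"
    unfolding coeff_sum[symmetric] eq by simp
  also have "\<dots> = (\<Sum>j\<in>J. coeff (C j) d * z ^ j) * b"
    by (simp add: b sum_distrib_left mult_ac)
  finally show ?thesis using assms(1) b by simp
next
  case (Suc m)
  have "0 = (\<Sum>j\<in>J. coeff (C j * Polynomial.smult (z ^ j) (q \<circ>\<^sub>p [:of_nat j, 1:])) (Suc d + m))"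
    unfolding coeff_sum[symmetric] eq by simp
  also have "\<dots> = (\<Sum>j\<in>J. coeff (C j) (Suc d) * z ^ j * coeff q m +
      (coeff (C j) d + of_nat (Suc m) * of_nat j * coeff (C j) (Suc d)) * z ^ j * coeff q (Suc m))"
  proof (rule sum.cong)
    fix j assume j: "j \<in> J"
    have "coeff (C j * Polynomial.smult (z ^ j) (q \<circ>\<^sub>p [:of_nat j, 1:])) (Suc d + m)
        = coeff (C j) d * coeff (Polynomial.smult (z ^ j) (q \<circ>\<^sub>p [:of_nat j, 1:])) (Suc m)
          + coeff (C j) (Suc d) * coeff (Polynomial.smult (z ^ j) (q \<circ>\<^sub>p [:of_nat j, 1:])) m"
      by (rule coeff_mult_second) (use deg[OF j] Suc in \<open>auto simp: degree_smult_eq degree_pcompose\<close>)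
    then show "coeff (C j * Polynomial.smult (z ^ j) (q \<circ>\<^sub>p [:of_nat j, 1:])) (Suc d + m)
        = coeff (C j) (Suc d) * z ^ j * coeff q m +
      (coeff (C j) d + of_nat (Suc m) * of_nat j * coeff (C j) (Suc d)) * z ^ j * coeff q (Suc m)"
      using Suc by (simp add: coeff_pcompose_shift_top coeff_pcompose_shift_second algebra_simps)
  qed simp
  also have "\<dots> = (\<Sum>j\<in>J. coeff (C j) (Suc d) * z ^ j) * coeff q m +
      (\<Sum>j\<in>J. (coeff (C j) d + of_nat (Suc m) * of_nat j * coeff (C j) (Suc d)) * z ^ j)
        * coeff q (Suc m)"
    by (simp only: sum.distrib sum_distrib_right)
  also have "(\<Sum>j\<in>J. coeff (C j) (Suc d) * z ^ j) = 0"
    by (rule quasi_exponential_leading_coeff[OF assms])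
  finally have "(\<Sum>j\<in>J. (coeff (C j) d + of_nat (Suc m) * of_nat j * coeff (C j) (Suc d)) * z ^ j)
        * coeff q (Suc m) = 0"
    by simp
  moreover have "coeff q (Suc m) \<noteq> 0"
    using assms(1) Suc by (metis leading_coeff_0_iff)
  ultimately show ?thesis unfolding Suc by (simp only: mult_eq_0_iff) blast
qed

section \<open>Auxiliary facts on polynomials, exponentials and residues\<close>

lemma eventually_cosparse_poly_nonzero:
  fixes p :: "complex poly"
  assumes "p \<noteq> 0"
  shows "eventually (\<lambda>u. poly p u \<noteq> 0) (cosparse UNIV)"
  using poly_roots_finite[OF assms]
  by (simp add: eventually_cosparse sparse_in_open islimpt_finite)

lemma poly_eq_0_if_cosparse:
  fixes p :: "complex poly"
  assumes "eventually (\<lambda>u. poly p u = 0) (cosparse UNIV)"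
  shows "p = 0"
proof (rule ccontr)
  assume "p \<noteq> 0"
  from assms eventually_cosparse_poly_nonzero[OF this]
  have "eventually (\<lambda>u::complex. False) (cosparse UNIV)"
    by eventually_elim auto
  then show False by simp
qed

lemma poly_meromorphic_on: "poly (p :: complex poly) meromorphic_on A"
proof -
  have "(\<lambda>u. poly p u) analytic_on UNIV"
    by (auto simp: analytic_on_open intro!: holomorphic_intros)
  then show ?thesis
    by (intro analytic_on_imp_meromorphic_on) (auto intro: analytic_on_subset)
qed

lemma shift_funpow: "(shift ^^ k) f u = f (u + of_nat k)"
  by (induction k arbitrary: u) (simp_all add: shift_def add_ac)

lemma arg_powr_nonzero: "arg_powr z \<theta> u \<noteq> 0"
  by (simp add: arg_powr_def)

lemma arg_powr_add_nat:
  assumes "is_Arg z \<theta>" and "z \<noteq> 0"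
  shows "arg_powr z \<theta> (u + of_nat j) = z ^ j * arg_powr z \<theta> u"
proof -
  have "exp (of_real (ln (cmod z)) + \<i> * of_real \<theta>) = z"
    using assms by (simp add: exp_add is_Arg_def exp_of_real)
  then have "exp (of_nat j * (of_real (ln (cmod z)) + \<i> * of_real \<theta>)) = z ^ j"
    by (simp add: exp_of_nat_mult)
  then show ?thesis
    by (simp add: arg_powr_def distrib_right exp_add)
qed

lemma arg_powr_holomorphic: "arg_powr z \<theta> holomorphic_on A"
  unfolding arg_powr_def by (intro holomorphic_intros)

text \<open>
  The polynomial with coefficients \<open>c j\<close> has more roots than its degree allows.
\<close>

lemma vandermonde_kernel:
  fixes z c :: "nat \<Rightarrow> complex"
  assumes "inj_on z {..<M}" and "\<And>a. a < M \<Longrightarrow> (\<Sum>j<M. c j * z a ^ j) = 0" and "j < M"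
  shows "c j = 0"
proof -
  define r where "r = (\<Sum>j<M. monom (c j) j)"
  have root: "poly r (z a) = 0" if "a < M" for a
    using assms(2)[OF that] by (simp add: r_def poly_sum poly_monom)
  have coeff: "coeff r i = (if i < M then c i else 0)" for i
    by (simp add: r_def coeff_sum)
  have "r = 0"
  proof (rule ccontr)
    assume "r \<noteq> 0"
    then have deg: "degree r < M" using coeff by (metis leading_coeff_0_iff)
    have "card (z ` {..<M}) \<le> card {x. poly r x = 0}"
      by (intro card_mono poly_roots_finite \<open>r \<noteq> 0\<close>) (use root in auto)
    also have "\<dots> \<le> degree r" by (rule card_poly_roots_bound[OF \<open>r \<noteq> 0\<close>])
    finally show False using deg assms(1) by (simp add: card_image)
  qed
  then show ?thesis using coeff[of j] assms(3) by simp
qed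

lemma discrete_wronskian_eq_detn: "discrete_wronskian k f u = detn k (\<lambda>i j. f i (u + of_nat j))"
  by (simp add: discrete_wronskian_def detn_def)

lemma contour_integral_simple_poles:
  assumes g: "g holomorphic_on UNIV" and fin: "finite P" and S: "S \<subseteq> P"
    and path: "valid_path \<gamma>" "pathfinish \<gamma> = pathstart \<gamma>" "path_image \<gamma> \<inter> P = {}"
    and in_S: "\<And>p. p \<in> S \<Longrightarrow> winding_number \<gamma> p = 1"
    and out_S: "\<And>p. p \<in> P - S \<Longrightarrow> winding_number \<gamma> p = 0"
  shows "contour_integral \<gamma> (\<lambda>u. g u / (\<Prod>p\<in>P. u - p))
    = 2 * pi * \<i> * (\<Sum>p\<in>S. g p / (\<Prod>r\<in>P - {p}. p - r))"
proof -
  let ?f = "\<lambda>u. g u / (\<Prod>p\<in>P. u - p)"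
  have hol: "?f holomorphic_on UNIV - P"
    using fin by (intro holomorphic_intros holomorphic_on_subset[OF g]) auto
  have res: "residue ?f p = g p / (\<Prod>r\<in>P - {p}. p - r)" if p: "p \<in> P" for p
  proof (rule residue_simple')
    show "open (- (P - {p}))" using fin by (intro open_Compl finite_imp_closed) auto
    show "p \<in> - (P - {p})" by simp
    show "?f holomorphic_on - (P - {p}) - {p}"
      by (rule holomorphic_on_subset[OF hol]) auto
    have "continuous_on UNIV g" by (rule holomorphic_on_imp_continuous_on[OF g])
    then have "g \<midarrow>p\<rightarrow> g p" by (simp add: continuous_on_eq_continuous_at isCont_def)
    then have "((\<lambda>u. g u / (\<Prod>r\<in>P - {p}. u - r)) \<longlongrightarrow> g p / (\<Prod>r\<in>P - {p}. p - r)) (at p)"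
      using fin by (intro tendsto_intros) auto
    moreover have "eventually (\<lambda>u. g u / (\<Prod>r\<in>P - {p}. u - r) = ?f u * (u - p)) (at p)"
    proof -
      have "eventually (\<lambda>u. u \<noteq> p) (at p)" by (simp add: eventually_at_filter)
      then show ?thesis
        by eventually_elim (simp add: prod.remove[OF fin p])
    qed
    ultimately show "((\<lambda>u. ?f u * (u - p)) \<longlongrightarrow> g p / (\<Prod>r\<in>P - {p}. p - r)) (at p)"
      by (rule Lim_transform_eventually)
  qed
  have "contour_integral \<gamma> ?f = 2 * pi * \<i> * (\<Sum>p\<in>P. winding_number \<gamma> p * residue ?f p)"
    by (rule Residue_theorem[of UNIV]) (use fin hol path in auto)
  also have "(\<Sum>p\<in>P. winding_number \<gamma> p * residue ?f p)
      = (\<Sum>p\<in>S. winding_number \<gamma> p * residue ?f p)"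
    by (rule sum.mono_neutral_right) (use fin S out_S in auto)
  also have "\<dots> = (\<Sum>p\<in>S. g p / (\<Prod>r\<in>P - {p}. p - r))"
    by (rule sum.cong) (use S in \<open>auto simp: in_S res\<close>)
  finally show ?thesis .
qed

text \<open>
  Every set of integers is closed, so \<open>t - c\<close> itself is the only integer that can be approached.
\<close>

lemma eventually_diff_not_Ints: "eventually (\<lambda>u. u - c \<notin> \<int>) (at (t :: complex))"
proof -
  have "closed ((\<lambda>u. u - c) -` (\<int> - {t - c}))"
    by (intro continuous_closed_vimage closed_subset_Ints continuous_intros) auto
  then have "eventually (\<lambda>u. u \<in> - ((\<lambda>u. u - c) -` (\<int> - {t - c}))) (at t)"
    by (intro eventually_at_in_open') (auto simp: open_Compl)
  moreover have "eventually (\<lambda>u. u \<noteq> t) (at t)" by (simp add: eventually_at_filter)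
  ultimately show ?thesis by eventually_elim auto
qed

section \<open>Spaces of quasi-exponentials and their difference operators\<close>

text \<open>
  The data of a space of quasi-exponentials, with the polynomials \<open>q\<^sub>a\<close> fixed once and for all.
\<close>

locale quasi_exponentials =
  fixes U :: "(complex \<Rightarrow> complex) set" and M N :: nat and m :: "nat \<Rightarrow> nat"
    and z :: "nat \<Rightarrow> complex" and \<theta> :: "nat \<Rightarrow> real" and n :: "nat \<Rightarrow> nat"
    and lam :: "nat \<Rightarrow> complex" and q :: "nat \<Rightarrow> complex poly"
  assumes M_gt_1: "1 < M" and N_gt_1: "1 < N"
    and z_inj: "inj_on z {..<M}"
    and z_nonzero: "\<And>a. a < M \<Longrightarrow> z a \<noteq> 0"
    and z_Arg: "\<And>a. a < M \<Longrightarrow> is_Arg (z a) (\<theta> a)"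
    and q_nonzero: "\<And>a. a < M \<Longrightarrow> q a \<noteq> 0"
    and degree_q: "\<And>a. a < M \<Longrightarrow> degree (q a) = m a"
    and U_eq: "U = cfun.span ((\<lambda>a u. arg_powr (z a) (\<theta> a) u * poly (q a) u) ` {..<M})"
    and lam_diff: "\<And>i j. i < N \<Longrightarrow> j < N \<Longrightarrow> i \<noteq> j \<Longrightarrow> lam i - lam j \<notin> \<int>"
    and exponents:
      "\<And>i. i < N \<Longrightarrow> has_discrete_exponents U M (lam i) (\<lambda>k. if k = M - 1 then M - 1 + n i else k)"
    and sum_n_eq_sum_m: "(\<Sum>i<N. n i) = (\<Sum>a<M. m a)"
begin

definition E :: "nat \<Rightarrow> complex \<Rightarrow> complex" where
  "E a u = arg_powr (z a) (\<theta> a) u"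

definition F :: "nat \<Rightarrow> complex \<Rightarrow> complex" where
  "F a u = E a u * poly (q a) u"

text \<open>
  The polynomial that remains of \<open>f\<^sub>a(u + j)\<close>, where \<open>f\<^sub>a = z\<^sub>a\<^sup>u q\<^sub>a(u)\<close>, after division by \<open>z\<^sub>a\<^sup>u\<close>. All
  determinants built from \<open>U\<close> are thereby determinants over the polynomial ring, up to the
  nowhere vanishing function \<open>G\<close>.
\<close>

definition Q :: "nat \<Rightarrow> nat \<Rightarrow> complex poly" where
  "Q a j = Polynomial.smult (z a ^ j) (q a \<circ>\<^sub>p [:of_nat j, 1:])"

definition W :: "complex poly" where
  "W = detn M Q"

definition G :: "complex \<Rightarrow> complex" where
  "G u = (\<Prod>a<M. E a u)"

lemma U_span: "U = cfun.span (F ` {..<M})"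
  unfolding U_eq by (rule arg_cong[of _ _ cfun.span], rule image_cong) (auto simp: F_def E_def fun_eq_iff)

lemma E_nonzero: "E a u \<noteq> 0"
  by (simp add: E_def arg_powr_nonzero)

lemma G_nonzero: "G u \<noteq> 0"
  by (simp add: G_def E_nonzero)

lemma E_shift: "a < M \<Longrightarrow> E a (u + of_nat j) = z a ^ j * E a u"
  unfolding E_def by (rule arg_powr_add_nat) (auto simp: z_Arg z_nonzero)

lemma poly_Q: "poly (Q a j) u = z a ^ j * poly (q a) (u + of_nat j)"
  by (simp add: Q_def poly_pcompose add.commute)

lemma F_shift: "a < M \<Longrightarrow> F a (u + of_nat j) = E a u * poly (Q a j) u"
  by (simp add: F_def E_shift poly_Q)

lemma degree_Q_le: "a < M \<Longrightarrow> degree (Q a j) \<le> m a"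
  unfolding Q_def by (rule order.trans[OF degree_smult_le]) (simp add: degree_pcompose degree_q)

lemma G_shift: "G (u + of_nat j) = (\<Prod>a<M. z a) ^ j * G u"
  by (simp add: G_def E_shift prod.distrib prod_power_distrib)

lemma casoratian_F: "detn M (\<lambda>a j. F a (u + of_nat j)) = G u * poly W u"
  unfolding G_def W_def poly_detn detn_scale_rows[symmetric] by (rule detn_cong) (simp add: F_shift)

text \<open>
  A relation between the columns with polynomial coefficients would, by looking at the coefficients of
  the highest occurring power of \<open>u\<close>, give a relation between the columns of the Vandermonde matrix
  of the \<open>z\<^sub>a\<close>.
\<close>

lemma W_nonzero: "W \<noteq> 0"
proof
  assume "W = 0"
  then obtain v l where v: "l < M" "v l \<noteq> 0" "\<And>a. a < M \<Longrightarrow> (\<Sum>j<M. Q a j * v j) = 0"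
    by (auto simp: W_def detn_eq_0_iff)
  \<comment> \<open>the zero entries are excluded because their degree is \<open>0\<close> by convention\<close>
  define d where "d = Max ((\<lambda>j. degree (v j)) ` {j. j < M \<and> v j \<noteq> 0})"
  have fin: "finite {j. j < M \<and> v j \<noteq> 0}" by simp
  have "d \<in> (\<lambda>j. degree (v j)) ` {j. j < M \<and> v j \<noteq> 0}"
    unfolding d_def by (rule Max_in) (use v fin in auto)
  then obtain j0 where j0: "j0 < M" "v j0 \<noteq> 0" "degree (v j0) = d" by auto
  have deg: "degree (v j) \<le> d" if "j < M" for j
  proof (cases "v j = 0")
    case False
    then show ?thesis unfolding d_def by (intro Max_ge) (use that fin in auto)
  qed simp
  have "coeff (v j0) d = 0"
  proof (rule vandermonde_kernel[OF z_inj _ j0(1), where c = "\<lambda>j. coeff (v j) d"])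
    fix a assume a: "a < M"
    show "(\<Sum>j<M. coeff (v j) d * z a ^ j) = 0"
    proof (rule quasi_exponential_leading_coeff[OF q_nonzero[OF a]])
      show "(\<Sum>j<M. v j * Polynomial.smult (z a ^ j) (q a \<circ>\<^sub>p [:of_nat j, 1:])) = 0"
        using v(3)[OF a] by (simp add: Q_def mult.commute)
    qed (use deg in auto)
  qed
  then show False using j0 by (metis leading_coeff_0_iff)
qed

lemma degree_W_le: "degree W \<le> (\<Sum>a<M. m a)"
  unfolding W_def by (rule degree_detn_le) (rule degree_Q_le)

subsection \<open>Zeros of the discrete Wronskian\<close>

text \<open>
  A basis of \<open>U\<close> that realises the discrete exponents \<open>0, 1, \<dots>, M - 2, M - 1 + n\<^sub>i\<close> at \<open>\<lambda>\<^sub>i\<close>. Of the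
  last function only the vanishing is recorded.
\<close>

definition adapted :: "nat \<Rightarrow> (nat \<Rightarrow> complex \<Rightarrow> complex) \<Rightarrow> bool" where
  "adapted i h \<longleftrightarrow> basis_of U M h \<and>
     (\<forall>k<M - 1. (\<forall>j<k. h k (lam i + of_nat j) = 0) \<and> h k (lam i + of_nat k) \<noteq> 0) \<and>
     (\<forall>j<M - 1 + n i. h (M - 1) (lam i + of_nat j) = 0)"

lemma adapted_exists:
  assumes "i < N"
  shows "\<exists>h. adapted i h"
proof -
  let ?c = "\<lambda>k. if k = M - 1 then M - 1 + n i else k"
  obtain h where h: "basis_of U M h"
    "\<And>k. k < M \<Longrightarrow> (\<forall>j<?c k. h k (lam i + of_nat j) = 0) \<and> h k (lam i + of_nat (?c k)) \<noteq> 0"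
    using exponents[OF assms] unfolding has_discrete_exponents_def by blast
  have "(\<forall>j<k. h k (lam i + of_nat j) = 0) \<and> h k (lam i + of_nat k) \<noteq> 0" if "k < M - 1" for k
    using h(2)[of k] that by simp
  moreover have "\<forall>j<M - 1 + n i. h (M - 1) (lam i + of_nat j) = 0"
    using h(2)[of "M - 1"] M_gt_1 by simp
  ultimately have "adapted i h" using h(1) unfolding adapted_def by blast
  then show ?thesis by blast
qed

lemma adapted_basis_of: "adapted i h \<Longrightarrow> basis_of U M h"
  by (simp add: adapted_def)

lemma basis_mem: "basis_of U M h \<Longrightarrow> k < M \<Longrightarrow> h k \<in> U"
  unfolding basis_of_def by (auto intro: cfun.span_base)

text \<open>
  The last function of an adapted basis is a combination of the \<open>f\<^sub>a\<close> that vanishes at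
  \<open>\<lambda>\<^sub>i, \<dots>, \<lambda>\<^sub>i + M - 2 + n\<^sub>i\<close>. In a matrix with the entries \<open>f\<^sub>a(\<lambda>\<^sub>i + s + j)\<close> this is a relation between
  the rows, as long as \<open>s + j\<close> stays in that range for all columns \<open>j\<close>.
\<close>

lemma row_relation:
  assumes "i < N"
  obtains v where "\<exists>a<M. v a \<noteq> 0"
    and "\<And>s j. s + j < M - 1 + n i \<Longrightarrow>
           (\<Sum>a<M. v a * (E a (lam i + of_nat s) * poly (Q a j) (lam i + of_nat s))) = 0"
proof -
  obtain h where "adapted i h" using adapted_exists[OF assms] by blast
  then have h: "basis_of U M h" "\<And>j. j < M - 1 + n i \<Longrightarrow> h (M - 1) (lam i + of_nat j) = 0"
    by (simp_all only: adapted_def)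
  obtain T where T: "\<And>k u. k < M \<Longrightarrow> h k u = (\<Sum>a<M. T k a * F a u)" "detn M T \<noteq> 0"
    by (rule basis_of_transition[OF h(1) U_span]) blast
  show thesis
  proof (rule that[of "T (M - 1)"])
    show "\<exists>a<M. T (M - 1) a \<noteq> 0"
    proof (rule ccontr)
      assume "\<not> (\<exists>a<M. T (M - 1) a \<noteq> 0)"
      then have "detn M T = 0"
        unfolding detn_eq_0_iff_left using M_gt_1
        by (intro exI[of _ "\<lambda>i. if i = M - 1 then 1 else 0"])
           (auto intro!: sum.neutral)
      then show False using T(2) by simp
    qed
  next
    fix s j assume sj: "s + j < M - 1 + n i"
    have "(\<Sum>a<M. T (M - 1) a * (E a (lam i + of_nat s) * poly (Q a j) (lam i + of_nat s)))
        = (\<Sum>a<M. T (M - 1) a * F a (lam i + of_nat s + of_nat j))"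
      by (rule sum.cong) (simp_all add: F_shift)
    also have "\<dots> = h (M - 1) (lam i + of_nat (s + j))"
      using T(1)[of "M - 1"] M_gt_1 by (simp add: add.assoc)
    finally show "(\<Sum>a<M. T (M - 1) a * (E a (lam i + of_nat s) * poly (Q a j) (lam i + of_nat s))) = 0"
      using h(2)[OF sj] by simp
  qed
qed

lemma W_root:
  assumes "i < N" and "s < n i"
  shows "poly W (lam i + of_nat s) = 0"
proof -
  obtain v l where v: "l < M" "v l \<noteq> 0" and rel: "\<And>s j. s + j < M - 1 + n i \<Longrightarrow>
      (\<Sum>a<M. v a * (E a (lam i + of_nat s) * poly (Q a j) (lam i + of_nat s))) = 0"
    by (rule row_relation[OF assms(1)]) blast
  show ?thesis
    unfolding W_def poly_detn detn_eq_0_iff_left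
    by (rule exI[of _ "\<lambda>a. v a * E a (lam i + of_nat s)"])
       (use v rel[of s] assms(2) M_gt_1 in \<open>auto simp: E_nonzero mult.assoc\<close>)
qed

definition W_roots :: "complex set" where
  "W_roots = (\<lambda>(i, s). lam i + of_nat s) ` (SIGMA i:{..<N}. {..<n i})"

text \<open>
  The progressions through different \<open>\<lambda>\<^sub>i\<close> are disjoint, since differences of the \<open>\<lambda>\<^sub>i\<close> are not integers.
\<close>

lemma lam_progressions_distinct:
  assumes "i < N" "j < N" "lam i + of_int s = lam j + of_int t"
  shows "i = j \<and> s = t"
proof -
  have "lam i - lam j = of_int (t - s)" using assms(3) by (simp add: algebra_simps)
  then have "lam i - lam j \<in> \<int>" by (metis Ints_of_int)
  then have "i = j" using lam_diff[OF assms(1,2)] by blast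
  then show ?thesis using assms(3) by simp
qed

lemma W_roots_inj: "inj_on (\<lambda>(i, s). lam i + of_nat s) (SIGMA i:{..<N}. {..<n i})"
proof (rule inj_onI, clarsimp)
  fix i s j t assume "i < N" "j < N" "lam i + of_nat s = lam j + of_nat t"
  then show "i = j \<and> s = t"
    using lam_progressions_distinct[of i j "int s" "int t"] by simp
qed

lemma finite_W_roots: "finite W_roots"
  by (simp add: W_roots_def)

lemma card_W_roots: "card W_roots = (\<Sum>i<N. n i)"
  by (simp add: W_roots_def card_image[OF W_roots_inj])

lemma poly_W_roots: "r \<in> W_roots \<Longrightarrow> poly W r = 0"
  by (auto simp: W_roots_def W_root)

text \<open>
  The forced zeros already exhaust the degree: there are \<open>\<Sum>\<^sub>i n\<^sub>i\<close> of them, and this equals the bound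
  \<open>\<Sum>\<^sub>a m\<^sub>a\<close> for the degree of \<open>W\<close>. In particular all zeros of \<open>W\<close> are simple.
\<close>

lemma W_factor:
  obtains c where "c \<noteq> 0" and "W = Polynomial.smult c (\<Prod>r\<in>W_roots. [:-r, 1:])"
  by (rule poly_eq_smult_prod_linear_factors[OF finite_W_roots poly_W_roots W_nonzero])
     (use degree_W_le sum_n_eq_sum_m card_W_roots in auto)

lemma degree_W: "degree W = (\<Sum>a<M. m a)"
proof -
  obtain c where "c \<noteq> 0" "W = Polynomial.smult c (\<Prod>r\<in>W_roots. [:-r, 1:])"
    by (rule W_factor)
  then show ?thesis
    using sum_n_eq_sum_m by (simp add: degree_prod_linear_factors card_W_roots)
qed

lemma poly_W:
  obtains c where "c \<noteq> 0" and "\<And>u. poly W u = c * (\<Prod>i<N. \<Prod>s<n i. u - lam i - of_nat s)"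
proof -
  obtain c where c: "c \<noteq> 0" "W = Polynomial.smult c (\<Prod>r\<in>W_roots. [:-r, 1:])"
    by (rule W_factor)
  have "poly W u = c * (\<Prod>i<N. \<Prod>s<n i. u - lam i - of_nat s)" for u
  proof -
    have "poly W u = c * (\<Prod>r\<in>W_roots. u - r)"
      by (simp add: c(2) poly_prod)
    also have "(\<Prod>r\<in>W_roots. u - r) = (\<Prod>(i, s)\<in>(SIGMA i:{..<N}. {..<n i}). u - lam i - of_nat s)"
      unfolding W_roots_def by (subst prod.reindex[OF W_roots_inj]) (auto intro!: prod.cong)
    also have "\<dots> = (\<Prod>i<N. \<Prod>s<n i. u - lam i - of_nat s)"
      by (rule prod.Sigma[symmetric]) auto
    finally show ?thesis .
  qed
  with c(1) show thesis by (rule that)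
qed

subsection \<open>The fundamental difference operator\<close>

text \<open>
  Up to the factor \<open>\<Prod>\<^sub>a z\<^sub>a\<^sup>u\<close> and a sign, the minor of the \<open>M \<times> (M + 1)\<close> matrix \<open>f\<^sub>a(u + j)\<close> in which
  column \<open>k\<close> is omitted.
\<close>

definition cramer_minor :: "nat \<Rightarrow> complex poly" where
  "cramer_minor k = detn M (replace_column Q k (\<lambda>a. Q a M))"

text \<open>
  Compared with \<open>W_root\<close> the last zero of each progression is lost, because column \<open>M\<close> takes part.
\<close>

lemma cramer_minor_root:
  assumes "i < N" and "Suc s < n i"
  shows "poly (cramer_minor k) (lam i + of_nat s) = 0"
proof -
  obtain v l where v: "l < M" "v l \<noteq> 0" and rel: "\<And>s j. s + j < M - 1 + n i \<Longrightarrow>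
      (\<Sum>a<M. v a * (E a (lam i + of_nat s) * poly (Q a j) (lam i + of_nat s))) = 0"
    by (rule row_relation[OF assms(1)]) blast
  show ?thesis
    unfolding cramer_minor_def poly_detn detn_eq_0_iff_left
  proof (rule exI[of _ "\<lambda>a. v a * E a (lam i + of_nat s)"], intro conjI allI impI)
    show "\<exists>k<M. v k * E k (lam i + of_nat s) \<noteq> 0" using v by (auto simp: E_nonzero)
    fix j assume "j < M"
    then show "(\<Sum>a<M. v a * E a (lam i + of_nat s) *
        poly (if j = k then Q a M else Q a j) (lam i + of_nat s)) = 0"
      using rel[of s j] rel[of s M] assms(2) M_gt_1 by (cases "j = k") (simp_all add: mult.assoc)
  qed
qed

lemma degree_cramer_minor_le: "degree (cramer_minor k) \<le> (\<Sum>a<M. m a)"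
  unfolding cramer_minor_def by (rule degree_detn_le) (simp add: degree_Q_le)

text \<open>
  The coefficient of \<open>\<tau>\<^sup>M\<close> in the special fundamental difference operator. Its zeros are the zeros of
  \<open>W\<close> that the minors may lack; for \<open>n i = 0\<close> the factor is \<open>u - \<lambda>\<^sub>i + 1\<close> and cancels nothing.
\<close>

definition lead :: "complex poly" where
  "lead = (\<Prod>i<N. [:1 - lam i - of_nat (n i), 1:])"

lemma poly_lead: "poly lead u = (\<Prod>i<N. u - lam i - of_nat (n i) + 1)"
  by (simp add: lead_def poly_prod algebra_simps)

lemma lead_nonzero: "lead \<noteq> 0"
  by (simp add: lead_def)

lemma degree_lead: "degree lead = N"
  by (simp add: lead_def degree_prod_eq_sum_degree)

lemma coeff_lead: "coeff lead N = 1"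
proof -
  have "lead_coeff lead = (\<Prod>i<N. lead_coeff [:1 - lam i - of_nat (n i), 1:])"
    unfolding lead_def by (rule lead_coeff_prod)
  then show ?thesis by (simp add: degree_lead)
qed

lemma W_dvd: "W dvd lead * cramer_minor k"
proof -
  obtain c where c: "c \<noteq> 0" "W = Polynomial.smult c (\<Prod>r\<in>W_roots. [:-r, 1:])"
    by (rule W_factor)
  have "(\<Prod>r\<in>W_roots. [:-r, 1:]) dvd lead * cramer_minor k"
  proof (rule prod_linear_factors_dvd[OF finite_W_roots])
    fix r assume "r \<in> W_roots"
    then obtain i s where ix: "i < N" "s < n i" "r = lam i + of_nat s"
      by (auto simp: W_roots_def)
    show "poly (lead * cramer_minor k) r = 0"
    proof (cases "Suc s = n i")
      \<comment> \<open>the last zero of the progression is supplied by \<open>lead\<close>, the others by the minor\<close>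
      case True
      have "poly lead r = 0"
        unfolding poly_lead
        by (rule prod_zero) (use ix in \<open>auto intro!: bexI[of _ i] simp flip: True\<close>)
      then show ?thesis by simp
    next
      case False
      then show ?thesis using cramer_minor_root[of i s k] ix by simp
    qed
  qed
  then show ?thesis by (simp add: c smult_dvd_iff)
qed

text \<open>
  The coefficient of \<open>\<tau>\<^bsup>M - k\<^esup>\<close> as given by Cramer's rule. The division is exact by \<open>W_dvd\<close>.
\<close>

definition B :: "nat \<Rightarrow> complex poly" where
  "B k = (if k = 0 then lead else if k \<le> M then - (lead * cramer_minor (M - k) div W) else 0)"

lemma B_mult_W:
  assumes "0 < k" "k \<le> M"
  shows "B k * W = - (lead * cramer_minor (M - k))"
  using assms W_dvd[of "M - k"] by (simp add: B_def)

text \<open>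
  Numerator and denominator of Cramer's rule have degrees at most \<open>\<Sum>\<^sub>a m\<^sub>a\<close> and exactly \<open>\<Sum>\<^sub>a m\<^sub>a\<close>.
\<close>

lemma degree_B_le: "degree (B k) \<le> N"
proof (cases "k = 0 \<or> k > M \<or> B k = 0")
  case True
  then show ?thesis by (auto simp: B_def degree_lead)
next
  case False
  then have k: "0 < k" "k \<le> M" "B k \<noteq> 0" by auto
  have "degree (B k) + degree W = degree (B k * W)"
    using k(3) W_nonzero by (simp add: degree_mult_eq)
  also have "\<dots> \<le> N + (\<Sum>a<M. m a)"
    unfolding B_mult_W[OF k(1,2)] degree_minus
    by (rule order.trans[OF degree_mult_le]) (use degree_lead degree_cramer_minor_le in \<open>simp add: add_mono\<close>)
  finally show ?thesis using degree_W by simp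
qed

lemma sum_B_Q:
  assumes "a < M"
  shows "(\<Sum>j\<le>M. B (M - j) * Q a j) = 0"
proof -
  have "(\<Sum>k<M. Q a k * cramer_minor k) = W * Q a M"
    unfolding cramer_minor_def W_def by (rule cramer_solution) (use W_nonzero assms in \<open>auto simp: W_def\<close>)
  then have "(\<Sum>j<M. lead * (Q a j * cramer_minor j)) = lead * (W * Q a M)"
    by (simp flip: sum_distrib_left)
  moreover have "(\<Sum>j<M. (B (M - j) * W) * Q a j) = - (\<Sum>j<M. lead * (Q a j * cramer_minor j))"
    unfolding sum_negf[symmetric]
  proof (rule sum.cong)
    fix j assume "j \<in> {..<M}"
    then have "B (M - j) * W = - (lead * cramer_minor j)" using B_mult_W[of "M - j"] by simp
    then show "(B (M - j) * W) * Q a j = - (lead * (Q a j * cramer_minor j))" by (simp add: mult_ac)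
  qed simp
  moreover have "(\<Sum>j\<le>M. (B (M - j) * W) * Q a j) = (\<Sum>j<M. (B (M - j) * W) * Q a j) + lead * W * Q a M"
    by (simp add: B_def[of 0] flip: lessThan_Suc_atMost)
  ultimately have "(\<Sum>j\<le>M. (B (M - j) * W) * Q a j) = 0" by (simp add: mult_ac)
  then have "W * (\<Sum>j\<le>M. B (M - j) * Q a j) = 0"
    by (simp add: sum_distrib_left mult_ac)
  then show ?thesis using W_nonzero by simp
qed

lemma sum_B_Q_unique:
  assumes "\<And>a. a < M \<Longrightarrow> (\<Sum>j\<le>M. C (M - j) * Q a j) = 0" and "C 0 = lead" and "k \<le> M"
  shows "C k = B k"
proof (rule ccontr)
  assume ne: "C k \<noteq> B k"
  then have k: "0 < k" using assms(2) by (cases k) (auto simp: B_def)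
  have "(\<Sum>j<M. Q a j * (C (M - j) - B (M - j))) = 0" if "a < M" for a
  proof -
    have "(\<Sum>j\<le>M. C (M - j) * Q a j) - (\<Sum>j\<le>M. B (M - j) * Q a j) = 0"
      using assms(1)[OF that] sum_B_Q[OF that] by simp
    then show ?thesis
      by (simp add: assms(2) B_def[of 0] sum_subtractf algebra_simps flip: lessThan_Suc_atMost)
  qed
  then have "W = 0"
    unfolding W_def detn_eq_0_iff using k ne assms(3)
    by (intro exI[of _ "\<lambda>j. C (M - j) - B (M - j)"] conjI exI[of _ "M - k"]) auto
  then show False using W_nonzero by simp
qed

lemma sum_B_F: "a < M \<Longrightarrow> (\<Sum>j\<le>M. poly (B (M - j)) u * F a (u + of_nat j)) = 0"
proof -
  assume a: "a < M"
  have "(\<Sum>j\<le>M. poly (B (M - j)) u * F a (u + of_nat j))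
      = E a u * poly (\<Sum>j\<le>M. B (M - j) * Q a j) u"
    by (simp add: F_shift[OF a] poly_sum sum_distrib_left mult_ac)
  then show ?thesis by (simp add: sum_B_Q[OF a])
qed

lemma sum_B_U:
  assumes "f \<in> U"
  shows "(\<Sum>j\<le>M. poly (B (M - j)) u * f (u + of_nat j)) = 0"
proof -
  obtain c where c: "f = (\<lambda>u. \<Sum>a<M. c a * F a u)"
    using assms by (auto simp: U_span cfun_span_image_iff)
  have "(\<Sum>j\<le>M. poly (B (M - j)) u * f (u + of_nat j))
      = (\<Sum>a<M. c a * (\<Sum>j\<le>M. poly (B (M - j)) u * F a (u + of_nat j)))"
    unfolding c sum_distrib_left by (subst sum.swap) (simp add: mult_ac)
  then show ?thesis by (simp add: sum_B_F)
qed

text \<open>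
  Any admissible choice of coefficients satisfies the linear system of \<open>sum_B_Q\<close> off a sparse set,
  hence as polynomials, and that system determines them because \<open>W\<close> does not vanish identically.
\<close>

lemma special_difference_op_eq_B: "special_fundamental_difference_op U M N n lam = B"
  unfolding special_fundamental_difference_op_def
proof (rule the_equality)
  \<comment> \<open>the quotient for \<open>k = 0\<close> is \<open>0\<close> at the zeros of \<open>lead\<close>, whereas the operator has to be monic everywhere\<close>
  define b where "b = (\<lambda>k u. if k = 0 then 1 else poly (B k) u / poly lead u)"
  have "b k meromorphic_on UNIV" for k
    unfolding b_def
    by (cases "k = 0")
       (auto intro!: meromorphic_intros poly_meromorphic_on)
  moreover have "eventually (\<lambda>u. (\<Sum>k\<le>M. b k u * (shift ^^ (M - k)) f u) = 0) (cosparse UNIV)"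
    if "f \<in> U" for f
    using eventually_cosparse_poly_nonzero[OF lead_nonzero]
  proof eventually_elim
    case (elim u)
    have "poly lead u * (\<Sum>k\<le>M. b k u * (shift ^^ (M - k)) f u)
        = (\<Sum>k\<le>M. poly (B k) u * f (u + of_nat (M - k)))"
      unfolding sum_distrib_left
      by (rule sum.cong) (use elim in \<open>auto simp: b_def shift_funpow B_def[of 0]\<close>)
    also have "\<dots> = (\<Sum>j\<le>M. poly (B (M - j)) u * f (u + of_nat j))"
      by (rule sum.reindex_bij_witness[of _ "\<lambda>j. M - j" "\<lambda>j. M - j"]) auto
    finally show ?case using elim sum_B_U[OF that] by simp
  qed
  ultimately have "fundamental_difference_op U M b"
    by (simp add: fundamental_difference_op_def b_def)
  moreover have "eventually (\<lambda>u. poly (B k) u = (\<Prod>i<N. u - lam i - of_nat (n i) + 1) * b k u)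
      (cosparse UNIV)" for k
    using eventually_cosparse_poly_nonzero[OF lead_nonzero]
    by eventually_elim (auto simp: b_def poly_lead[symmetric] B_def[of 0])
  ultimately show "(\<forall>k>M. B k = 0) \<and> (\<exists>b. fundamental_difference_op U M b \<and>
      (\<forall>k\<le>M. eventually (\<lambda>u. poly (B k) u =
         (\<Prod>i<N. u - lam i - of_nat (n i) + 1) * b k u) (cosparse UNIV)))"
    by (intro conjI exI[of _ b] allI impI) (simp_all add: B_def)
next
  fix C assume "(\<forall>k>M. C k = 0) \<and> (\<exists>b. fundamental_difference_op U M b \<and>
      (\<forall>k\<le>M. eventually (\<lambda>u. poly (C k) u =
         (\<Prod>i<N. u - lam i - of_nat (n i) + 1) * b k u) (cosparse UNIV)))"
  then obtain b where C0: "\<And>k. k > M \<Longrightarrow> C k = 0" and b: "fundamental_difference_op U M b"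
    and C: "\<And>k. k \<le> M \<Longrightarrow> eventually (\<lambda>u. poly (C k) u = poly lead u * b k u) (cosparse UNIV)"
    unfolding poly_lead[symmetric] by blast
  have ev: "eventually (\<lambda>u. \<forall>k\<in>{..M}. poly (C k) u = poly lead u * b k u) (cosparse UNIV)"
    by (rule eventually_ball_finite) (use C in auto)
  have "C 0 - lead = 0"
  proof (rule poly_eq_0_if_cosparse)
    show "eventually (\<lambda>u. poly (C 0 - lead) u = 0) (cosparse UNIV)"
      using C[OF le0] by eventually_elim (use b in \<open>auto simp: fundamental_difference_op_def\<close>)
  qed
  then have lead: "C 0 = lead" by simp
  have "(\<Sum>j\<le>M. C (M - j) * Q a j) = 0" if a: "a < M" for a
  proof (rule poly_eq_0_if_cosparse)
    have "F a \<in> U" unfolding U_span by (rule cfun.span_base) (use a in auto)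
    then have "eventually (\<lambda>u. (\<Sum>k\<le>M. b k u * (shift ^^ (M - k)) (F a) u) = 0) (cosparse UNIV)"
      using b by (auto simp: fundamental_difference_op_def)
    with ev show "eventually (\<lambda>u. poly (\<Sum>j\<le>M. C (M - j) * Q a j) u = 0) (cosparse UNIV)"
    proof eventually_elim
      case (elim u)
      have "E a u * poly (\<Sum>j\<le>M. C (M - j) * Q a j) u
          = (\<Sum>j\<le>M. poly (C (M - j)) u * F a (u + of_nat j))"
        by (simp add: F_shift[OF a] poly_sum sum_distrib_left mult_ac)
      also have "\<dots> = (\<Sum>k\<le>M. poly (C k) u * F a (u + of_nat (M - k)))"
        by (rule sum.reindex_bij_witness[of _ "\<lambda>j. M - j" "\<lambda>j. M - j"]) auto
      also have "\<dots> = poly lead u * (\<Sum>k\<le>M. b k u * (shift ^^ (M - k)) (F a) u)"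
        unfolding sum_distrib_left
        by (rule sum.cong) (use elim(1) in \<open>auto simp: shift_funpow\<close>)
      finally show ?case using elim(2) E_nonzero[of a u] by simp
    qed
  qed
  then have "C k = B k" if "k \<le> M" for k
    using sum_B_Q_unique[of C k] lead that by blast
  then show "C = B"
    using C0 by (auto simp: fun_eq_iff B_def not_le)
qed

subsection \<open>Poles of the conjugate space\<close>

definition poles :: "complex set" where
  "poles = (\<Union>i<N. pole_set n lam i)"

text \<open>
  The common denominator of the conjugate space; see \<open>conjugate_denominator\<close>.
\<close>

definition pole_product :: "complex \<Rightarrow> complex" where
  "pole_product u = (\<Prod>p\<in>poles. u - p)"

lemma pole_set_eq: "pole_set n lam i = (\<lambda>s. lam i - 1 + of_nat s) ` {..n i}"
  by (auto simp: pole_set_def)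

lemma finite_pole_set: "finite (pole_set n lam i)"
  by (simp add: pole_set_eq)

lemma finite_poles: "finite poles"
  by (simp add: poles_def finite_pole_set)

lemma pole_sets_disjoint:
  assumes "i < N" "j < N" "i \<noteq> j"
  shows "pole_set n lam i \<inter> pole_set n lam j = {}"
proof (rule ccontr)
  assume "pole_set n lam i \<inter> pole_set n lam j \<noteq> {}"
  then obtain s t where "lam i + of_int (int s) = lam j + of_int (int t)"
    by (auto simp: pole_set_eq)
  then show False using lam_progressions_distinct[OF assms(1,2)] assms(3) by blast
qed

text \<open>
  The index is an integer rather than a natural number, since the adjoint equation refers to points
  before the first element of \<open>S\<^sub>i\<close>.
\<close>

lemma mem_poles_iff:
  assumes "i < N"
  shows "lam i - 1 + of_int k \<in> poles \<longleftrightarrow> 0 \<le> k \<and> k \<le> int (n i)"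
proof
  assume "lam i - 1 + of_int k \<in> poles"
  then obtain j s where j: "j < N" "s \<le> n j" "lam i + of_int k = lam j + of_int (int s)"
    by (auto simp: poles_def pole_set_eq)
  then show "0 \<le> k \<and> k \<le> int (n i)"
    using lam_progressions_distinct[OF assms j(1,3)] by auto
next
  assume "0 \<le> k \<and> k \<le> int (n i)"
  then have "lam i - 1 + of_int k = lam i - 1 + of_nat (nat k)" "nat k \<le> n i" by auto
  then show "lam i - 1 + of_int k \<in> poles"
    using assms unfolding poles_def pole_set_eq by blast
qed

lemma pole_product_eq: "pole_product u = (\<Prod>i<N. \<Prod>s\<le>n i. u - (lam i - 1 + of_nat s))"
proof -
  have "pole_product u = (\<Prod>i<N. \<Prod>p\<in>pole_set n lam i. u - p)"
    unfolding pole_product_def poles_def by (rule prod.UNION_disjoint) (auto simp: finite_pole_set pole_sets_disjoint)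
  also have "\<dots> = (\<Prod>i<N. \<Prod>s\<le>n i. u - (lam i - 1 + of_nat s))"
    unfolding pole_set_eq by (subst prod.reindex) (auto simp: inj_on_def)
  finally show ?thesis .
qed

text \<open>
  The zeros of \<open>W(u + 1)\<close> are \<open>\<lambda>\<^sub>i - 1, \<dots>, \<lambda>\<^sub>i + n\<^sub>i - 2\<close>, and the leading coefficient adds the point
  \<open>\<lambda>\<^sub>i + n\<^sub>i - 1\<close>.
\<close>

lemma lead_mult_W_shift:
  obtains c where "c \<noteq> 0" and "\<And>u. poly lead u * poly W (u + 1) = c * pole_product u"
proof -
  obtain c where c: "c \<noteq> 0" "\<And>u. poly W u = c * (\<Prod>i<N. \<Prod>s<n i. u - lam i - of_nat s)"
    by (rule poly_W) blast
  have "poly lead u * poly W (u + 1) = c * pole_product u" for u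
  proof -
    have "pole_product u = (\<Prod>i<N. (u - lam i - of_nat (n i) + 1) * (\<Prod>s<n i. u + 1 - lam i - of_nat s))"
      unfolding pole_product_eq
      by (rule prod.cong) (auto simp: algebra_simps simp flip: lessThan_Suc_atMost)
    then show ?thesis by (simp add: c(2) poly_lead prod.distrib mult_ac)
  qed
  with c(1) show thesis by (rule that)
qed

text \<open>
  The minor without column \<open>0\<close> is the discrete Wronskian of the shifted functions \<open>f\<^sub>a(u + 1)\<close>.
\<close>

lemma B_M_mult_W:
  obtains c where "c \<noteq> 0" and "\<And>u. poly (B M) u * poly W u = c * (poly lead u * poly W (u + 1))"
proof -
  have cramer_minor_0: "cramer_minor 0 = (-1) ^ (M - 1) * detn M (\<lambda>a j. Q a (Suc j))"
    unfolding cramer_minor_def by (rule detn_rotate_columns) (use M_gt_1 in simp)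
  have shifted: "poly (detn M (\<lambda>a j. Q a (Suc j))) u = (\<Prod>a<M. z a) * poly W (u + 1)" for u
    unfolding W_def poly_detn detn_scale_rows[symmetric]
    by (rule detn_cong) (simp add: poly_Q add_ac)
  have eq: "poly (B M) u * poly W u
      = - ((-1) ^ (M - 1) * (\<Prod>a<M. z a)) * (poly lead u * poly W (u + 1))" for u
  proof -
    have "poly (B M * W) u = poly (- (lead * cramer_minor 0)) u"
      using B_mult_W[of M] M_gt_1 by simp
    then show ?thesis by (simp add: cramer_minor_0 shifted poly_power mult_ac)
  qed
  show thesis
    by (rule that[OF _ eq]) (use z_nonzero in auto)
qed

lemma casoratian_basis:
  assumes "basis_of U M h"
  obtains c where "c \<noteq> 0" and "\<And>u. discrete_wronskian M h u = c * G u * poly W u"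
proof -
  obtain T where T: "\<And>k u. k < M \<Longrightarrow> h k u = (\<Sum>a<M. T k a * F a u)" "detn M T \<noteq> 0"
    by (rule basis_of_transition[OF assms U_span]) blast
  have "discrete_wronskian M h u = detn M T * G u * poly W u" for u
  proof -
    have "discrete_wronskian M h u = detn M (\<lambda>k j. \<Sum>a<M. T k a * F a (u + of_nat j))"
      unfolding discrete_wronskian_eq_detn by (rule detn_cong) (simp add: T)
    also have "\<dots> = detn M T * (G u * poly W u)"
      by (simp add: detn_mult casoratian_F)
    finally show ?thesis by simp
  qed
  with T(2) show thesis by (rule that)
qed

text \<open>
  Dividing by this denominator produces at most simple poles, which lie in the sets \<open>S\<^sub>i\<close>.
\<close>

lemma conjugate_denominator:
  assumes "basis_of U M h"
  obtains c where "c \<noteq> 0" and "\<And>u. poly (B M) u * discrete_wronskian M h u = c * (G u * pole_product u)"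
proof -
  obtain c1 where c1: "c1 \<noteq> 0" "\<And>u. discrete_wronskian M h u = c1 * G u * poly W u"
    by (rule casoratian_basis[OF assms]) blast
  obtain c2 where c2: "c2 \<noteq> 0" "\<And>u. poly (B M) u * poly W u = c2 * (poly lead u * poly W (u + 1))"
    by (rule B_M_mult_W) blast
  obtain c3 where c3: "c3 \<noteq> 0" "\<And>u. poly lead u * poly W (u + 1) = c3 * pole_product u"
    by (rule lead_mult_W_shift) blast
  have "poly (B M) u * discrete_wronskian M h u = (c1 * c2 * c3) * (G u * pole_product u)" for u
  proof -
    have "poly (B M) u * discrete_wronskian M h u = c1 * G u * (poly (B M) u * poly W u)"
      unfolding c1(2) by (simp only: mult_ac)
    then show ?thesis unfolding c2(2) c3(2) by (simp only: mult_ac)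
  qed
  then show thesis by (intro that[of "c1 * c2 * c3"]) (use c1 c2 c3 in auto)
qed

subsection \<open>Discrete Wronskians of adapted bases\<close>

lemma U_holomorphic: "f \<in> U \<Longrightarrow> f holomorphic_on A"
proof -
  assume "f \<in> U"
  then obtain c where c: "f = (\<lambda>u. \<Sum>a<M. c a * F a u)"
    by (auto simp: U_span cfun_span_image_iff)
  show ?thesis
    unfolding c F_def E_def by (intro holomorphic_intros arg_powr_holomorphic)
qed

lemma G_holomorphic: "G holomorphic_on A"
  unfolding G_def E_def by (intro holomorphic_intros arg_powr_holomorphic)

lemma discrete_wronskian_holomorphic:
  assumes "\<And>i. i < k \<Longrightarrow> f i \<in> U"
  shows "(\<lambda>u. discrete_wronskian k f (u + c)) holomorphic_on A"
  unfolding discrete_wronskian_eq_detn detn_leibniz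
proof (intro holomorphic_intros)
  fix p i assume "p \<in> {p. p permutes {0..<k}}" "i \<in> {0..<k}"
  then have "f i holomorphic_on UNIV" using assms U_holomorphic by auto
  then have "(f i \<circ> (\<lambda>u. u + c + of_nat (p i))) holomorphic_on A"
    by (intro holomorphic_on_compose_gen[of _ _ _ UNIV] holomorphic_intros) auto
  then show "(\<lambda>u. f i (u + c + of_nat (p i))) holomorphic_on A" by (simp add: o_def)
qed

text \<open>
  At the points \<open>\<lambda>\<^sub>i + s\<close> with \<open>s \<le> n\<^sub>i\<close> only the arguments \<open>\<lambda>\<^sub>i, \<dots>, \<lambda>\<^sub>i + M - 2 + n\<^sub>i\<close> occur, where the last
  function of the adapted basis vanishes. So the matrix of \<open>f\<close> factors through the first \<open>M - 1\<close>
  functions, with a matrix of coefficients that does not depend on \<open>s\<close>. This is why the residues of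
  a function of the conjugate space on \<open>S\<^sub>i\<close> are determined up to a common factor.
\<close>

lemma discrete_wronskian_adapted:
  assumes h: "adapted i h" and f: "\<And>k. k < M - 1 \<Longrightarrow> f k \<in> U"
  obtains d where "\<And>s. s \<le> n i \<Longrightarrow> discrete_wronskian (M - 1) f (lam i + of_nat s)
    = d * discrete_wronskian (M - 1) h (lam i + of_nat s)"
proof -
  have U_h: "U = cfun.span (h ` {..<M})"
    using h by (simp add: adapted_def basis_of_def)
  then have "\<forall>k\<in>{..<M - 1}. \<exists>c. f k = (\<lambda>u. \<Sum>a<M. c a * h a u)"
    using f by (auto simp: U_h cfun_span_image_iff)
  then obtain c where "\<forall>k\<in>{..<M - 1}. f k = (\<lambda>u. \<Sum>a<M. c k a * h a u)"
    by (rule bchoice[THEN exE])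
  then have c: "f k u = (\<Sum>a<M. c k a * h a u)" if "k < M - 1" for k u
    using that by simp
  show thesis
  proof (rule that[of "detn (M - 1) c"])
    fix s assume s: "s \<le> n i"
    have "f k (lam i + of_nat s + of_nat j)
        = (\<Sum>a<M - 1. c k a * h a (lam i + of_nat s + of_nat j))" if "k < M - 1" "j < M - 1" for k j
    proof -
      have "s + j < M - 1 + n i" using s that by simp
      then have "h (M - 1) (lam i + of_nat (s + j)) = 0"
        using h unfolding adapted_def by blast
      then have "h (M - 1) (lam i + of_nat s + of_nat j) = 0"
        by (simp only: of_nat_add add.assoc)
      moreover have "{..<M} = insert (M - 1) {..<M - 1}" using M_gt_1 by auto
      ultimately show ?thesis using that by (simp add: c)
    qed
    then show "discrete_wronskian (M - 1) f (lam i + of_nat s)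
        = detn (M - 1) c * discrete_wronskian (M - 1) h (lam i + of_nat s)"
      unfolding discrete_wronskian_eq_detn detn_mult[symmetric] by (rule detn_cong)
  qed
qed

lemma adapted_wronskian_first:
  assumes "adapted i h"
  shows "discrete_wronskian (M - 1) h (lam i) \<noteq> 0"
proof -
  have "discrete_wronskian (M - 1) h (lam i) = (\<Prod>k<M - 1. h k (lam i + of_nat k))"
    unfolding discrete_wronskian_eq_detn
    by (rule detn_upper_triangular) (use assms in \<open>auto simp: adapted_def\<close>)
  then show ?thesis using assms by (simp add: adapted_def)
qed

lemma W_nonzero_if_not_root:
  assumes "u \<notin> W_roots"
  shows "poly W u \<noteq> 0"
proof -
  obtain c where c: "c \<noteq> 0" "W = Polynomial.smult c (\<Prod>r\<in>W_roots. [:-r, 1:])"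
    by (rule W_factor)
  have "poly W u = c * (\<Prod>r\<in>W_roots. u - r)"
    by (simp add: c(2) poly_prod)
  then show ?thesis using c(1) assms finite_W_roots by auto
qed

text \<open>
  The point \<open>\<lambda>\<^sub>i + n\<^sub>i\<close> is not a zero of \<open>W\<close>. There the last row of the full Wronskian matrix has only its
  last entry different from zero, so the Wronskian of the first \<open>M - 1\<close> functions is a factor.
\<close>

lemma adapted_wronskian_last:
  assumes "i < N" and h: "adapted i h"
  shows "discrete_wronskian (M - 1) h (lam i + of_nat (n i)) \<noteq> 0"
proof -
  let ?u = "lam i + of_nat (n i)"
  obtain c where c: "c \<noteq> 0" "\<And>u. discrete_wronskian M h u = c * G u * poly W u"
    by (rule casoratian_basis[OF adapted_basis_of[OF h]]) blast
  have "?u \<notin> W_roots"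
  proof
    assume "?u \<in> W_roots"
    then obtain j s where j: "j < N" "s < n j" "lam i + of_int (int (n i)) = lam j + of_int (int s)"
      by (auto simp: W_roots_def)
    then show False using lam_progressions_distinct[OF assms(1) j(1,3)] by auto
  qed
  then have "discrete_wronskian M h ?u \<noteq> 0"
    using c W_nonzero_if_not_root by (simp add: G_nonzero)
  moreover have "discrete_wronskian (Suc (M - 1)) h ?u
      = h (M - 1) (?u + of_nat (M - 1)) * discrete_wronskian (M - 1) h ?u"
    unfolding discrete_wronskian_eq_detn
  proof (rule detn_last_row)
    fix j assume "j < M - 1"
    then have "n i + j < M - 1 + n i" by simp
    then have "h (M - 1) (lam i + of_nat (n i + j)) = 0"
      using h unfolding adapted_def by blast
    then show "h (M - 1) (?u + of_nat j) = 0" by (simp only: of_nat_add add.assoc)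
  qed
  ultimately show ?thesis using M_gt_1 by auto
qed

subsection \<open>The adjoint difference equation\<close>

text \<open>
  Outside the progressions \<open>\<lambda>\<^sub>i + \<int>\<close> no zero or pole occurs. This set is invariant under integer
  shifts, and any point can be approached from within it.
\<close>

definition generic :: "complex \<Rightarrow> bool" where
  "generic u \<longleftrightarrow> (\<forall>i<N. u - lam i \<notin> \<int>)"

lemma generic_add_int: "generic (u + of_int k) \<longleftrightarrow> generic u"
proof -
  have "u + of_int k - lam i \<in> \<int> \<longleftrightarrow> u - lam i \<in> \<int>" for i
  proof -
    have eq: "u + of_int k - lam i = (u - lam i) + of_int k" "u - lam i = (u + of_int k - lam i) - of_int k"
      by simp_all
    show ?thesis
      using Ints_add[of "u - lam i" "of_int k"] Ints_diff[of "u + of_int k - lam i" "of_int k"]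
      unfolding eq(1)[symmetric] eq(2)[symmetric] by auto
  qed
  then show ?thesis by (simp add: generic_def)
qed

lemma generic_shift:
  "generic u \<Longrightarrow> generic (u + of_nat k)" "generic u \<Longrightarrow> generic (u + 1)"
  "generic u \<Longrightarrow> generic (u - of_nat k)"
  using generic_add_int[of u "int k"] generic_add_int[of u 1] generic_add_int[of u "- int k"]
  by auto

lemma eventually_generic: "eventually generic (at t)"
proof -
  have "eventually (\<lambda>u. \<forall>i\<in>{..<N}. u - lam i \<notin> \<int>) (at t)"
    by (intro eventually_ball_finite ballI eventually_diff_not_Ints) auto
  then show ?thesis by (rule eventually_mono) (simp add: generic_def)
qed

lemma generic_nonzero:
  assumes "generic u"
  shows "poly W u \<noteq> 0" "poly lead u \<noteq> 0" "pole_product u \<noteq> 0"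
proof -
  show "poly W u \<noteq> 0"
  proof (rule W_nonzero_if_not_root)
    show "u \<notin> W_roots"
    proof
      assume "u \<in> W_roots"
      then obtain i s where "i < N" "u - lam i = of_nat s" by (auto simp: W_roots_def)
      then show False using assms by (auto simp: generic_def)
    qed
  qed
  have "u - lam i - of_nat (n i) + 1 \<noteq> 0" if "i < N" for i
  proof
    assume "u - lam i - of_nat (n i) + 1 = 0"
    then have "u - lam i = of_int (int (n i) - 1)" by (simp add: algebra_simps)
    then show False using assms that by (auto simp: generic_def)
  qed
  then show "poly lead u \<noteq> 0" by (auto simp: poly_lead)
  have "u \<notin> poles"
  proof
    assume "u \<in> poles"
    then obtain i s where "i < N" "u = lam i - 1 + of_nat s" by (auto simp: poles_def pole_set_eq)
    then have "u - lam i = of_int (int s - 1)" by simp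
    then show False using assms \<open>i < N\<close> by (auto simp: generic_def)
  qed
  then show "pole_product u \<noteq> 0" by (auto simp: pole_product_def finite_poles)
qed

text \<open>
  Let \<open>H(u)\<close> be the matrix \<open>h\<^sub>a(u + k)\<close> and let \<open>Y(u)\<close> be a solution of \<open>H(u) Y(u) = e\<close> with a constant
  right-hand side. The columns \<open>1, \<dots>, M - 1\<close> of \<open>H(u)\<close> are the columns \<open>0, \<dots>, M - 2\<close> of \<open>H(u + 1)\<close>, and
  the last column of \<open>H(u + 1)\<close> is expressed by the columns of \<open>H(u)\<close> through the difference equation.
  Comparing the coefficients of the columns of \<open>H(u)\<close> in \<open>H(u) Y(u) = H(u + 1) Y(u + 1)\<close> gives the
  recursion.
\<close>

lemma companion_recursion:
  fixes Y :: "nat \<Rightarrow> complex \<Rightarrow> complex"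
  assumes h: "basis_of U M h"
    and Y: "\<And>u a. generic u \<Longrightarrow> a < M \<Longrightarrow> (\<Sum>k<M. h a (u + of_nat k) * Y k u) = e a"
    and u: "generic u" and k: "k < M"
  shows "poly lead u * Y k u
    = (if k = 0 then 0 else poly lead u * Y (k - 1) (u + 1)) - poly (B (M - k)) u * Y (M - 1) (u + 1)"
proof (rule ccontr)
  assume ne: "\<not> ?thesis"
  define d where "d = (\<lambda>k. poly lead u * Y k u
    - ((if k = 0 then 0 else poly lead u * Y (k - 1) (u + 1)) - poly (B (M - k)) u * Y (M - 1) (u + 1)))"
  obtain M' where M': "M = Suc M'" using M_gt_1 by (cases M) auto
  have "(\<Sum>k<M. h a (u + of_nat k) * d k) = 0" if a: "a < M" for a
  proof -
    have "e a = (\<Sum>k<M. h a (u + 1 + of_nat k) * Y k (u + 1))"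
      using Y[OF generic_shift(2)[OF u] a] by simp
    also have "\<dots> = (\<Sum>k<M'. h a (u + of_nat (Suc k)) * Y k (u + 1))
        + h a (u + of_nat M) * Y (M - 1) (u + 1)"
      by (simp add: M' add_ac)
    also have "(\<Sum>k<M'. h a (u + of_nat (Suc k)) * Y k (u + 1))
        = (\<Sum>k<M. h a (u + of_nat k) * (if k = 0 then 0 else Y (k - 1) (u + 1)))"
      unfolding M' sum.lessThan_Suc_shift by simp
    finally have 1: "(\<Sum>k<M. h a (u + of_nat k) * (if k = 0 then 0 else Y (k - 1) (u + 1)))
        = e a - h a (u + of_nat M) * Y (M - 1) (u + 1)"
      by simp
    have "(\<Sum>j\<le>M. poly (B (M - j)) u * h a (u + of_nat j)) = 0"
      by (rule sum_B_U) (rule basis_mem[OF h a])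
    then have 2: "(\<Sum>j<M. poly (B (M - j)) u * h a (u + of_nat j)) = - poly lead u * h a (u + of_nat M)"
      by (simp add: B_def[of 0] add_eq_0_iff2 flip: lessThan_Suc_atMost)
    have "(\<Sum>k<M. h a (u + of_nat k) * d k)
      = poly lead u * (\<Sum>k<M. h a (u + of_nat k) * Y k u)
        - poly lead u * (\<Sum>k<M. h a (u + of_nat k) * (if k = 0 then 0 else Y (k - 1) (u + 1)))
        + (\<Sum>j<M. poly (B (M - j)) u * h a (u + of_nat j)) * Y (M - 1) (u + 1)"
      unfolding sum_distrib_left sum_distrib_right sum_subtractf[symmetric] sum.distrib[symmetric]
      by (rule sum.cong) (simp_all add: d_def algebra_simps)
    also have "\<dots> = 0"
      unfolding 1 2 Y[OF u a] by (simp add: algebra_simps)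
    finally show ?thesis .
  qed
  moreover have "d k \<noteq> 0" using ne by (auto simp: d_def)
  ultimately have "detn M (\<lambda>a k. h a (u + of_nat k)) = 0"
    unfolding detn_eq_0_iff using k by blast
  moreover obtain c where "c \<noteq> 0" "\<And>u. discrete_wronskian M h u = c * G u * poly W u"
    by (rule casoratian_basis[OF h]) blast
  ultimately show False
    using generic_nonzero(1)[OF u] G_nonzero[of u] by (auto simp: discrete_wronskian_eq_detn)
qed

text \<open>
  For a basis \<open>h\<close>, a multiple of the element of the conjugate space built from \<open>h 0, \<dots>, h (M - 2)\<close>.
\<close>

definition conj_fun :: "(nat \<Rightarrow> complex \<Rightarrow> complex) \<Rightarrow> complex \<Rightarrow> complex" where
  "conj_fun h u = discrete_wronskian (M - 1) h (u + 1) / (G u * pole_product u)"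

text \<open>
  Take \<open>e\<close> to be the last unit vector in \<open>companion_recursion\<close>. By Cramer's rule the last entry of
  \<open>Y(u)\<close> is the quotient of the Wronskian of the first \<open>M - 1\<close> functions by the full Wronskian, which
  up to known factors is the function of the conjugate space at \<open>u - 1\<close>. Iterating the recursion from
  the last entry down to the first eliminates the other entries.
\<close>

lemma adjoint_equation_generic:
  assumes h: "basis_of U M h" and x: "generic x"
  shows "(\<Sum>j\<le>M. poly (B (M - j)) (x - of_nat j) * conj_fun h (x - of_nat j)) = 0"
proof -
  obtain c1 where c1: "c1 \<noteq> 0" "\<And>u. discrete_wronskian M h u = c1 * G u * poly W u"
    by (rule casoratian_basis[OF h]) blast
  obtain c2 where c2: "c2 \<noteq> 0" "\<And>u. poly lead u * poly W (u + 1) = c2 * pole_product u"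
    by (rule lead_mult_W_shift) blast
  \<comment> \<open>the constant right-hand side that singles out the cofactors of the last row\<close>
  define e :: "nat \<Rightarrow> complex" where "e a = (if a = M - 1 then 1 else 0)" for a
  define H where "H = (\<lambda>u a k. h a (u + of_nat k))"
  have det_H: "detn M (H u) = discrete_wronskian M h u" for u
    by (simp add: H_def discrete_wronskian_eq_detn)
  have det_nz: "detn M (H u) \<noteq> 0" if "generic u" for u
    using c1 generic_nonzero(1)[OF that] by (simp add: det_H G_nonzero)
  define Y where "Y = (\<lambda>k u. detn M (replace_column (H u) k e) / detn M (H u))"
  have Y: "(\<Sum>k<M. h a (u + of_nat k) * Y k u) = e a" if u: "generic u" and a: "a < M" for u a
  proof -
    have "(\<Sum>k<M. H u a k * detn M (replace_column (H u) k e)) = detn M (H u) * e a"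
      by (rule cramer_solution[OF det_nz[OF u] a])
    then show ?thesis
      using det_nz[OF u] by (simp add: Y_def H_def field_simps flip: sum_divide_distrib)
  qed
  define K where "K = 1 / (c1 * (\<Prod>a<M. z a) * c2)"
  have K: "K \<noteq> 0" using c1 c2 z_nonzero by (auto simp: K_def)
  have Y_last: "Y (M - 1) (u + 1) = K * (poly lead u * conj_fun h u)" if u: "generic u" for u
  proof -
    have "detn (Suc (M - 1)) (replace_column (H (u + 1)) (M - 1) e)
        = e (M - 1) * detn (M - 1) (replace_column (H (u + 1)) (M - 1) e)"
      by (subst detn_last_column) (auto simp: e_def)
    also have "detn (M - 1) (replace_column (H (u + 1)) (M - 1) e) = detn (M - 1) (H (u + 1))"
      by (rule detn_cong) auto
    finally have num: "detn M (replace_column (H (u + 1)) (M - 1) e)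
        = discrete_wronskian (M - 1) h (u + 1)"
      using M_gt_1 by (simp add: e_def H_def discrete_wronskian_eq_detn)
    have "G (u + 1) = (\<Prod>a<M. z a) * G u" using G_shift[of u 1] by simp
    then have "poly lead u * detn M (H (u + 1)) = c1 * ((\<Prod>a<M. z a) * G u) * (poly lead u * poly W (u + 1))"
      by (simp add: det_H c1)
    then have "poly lead u * detn M (H (u + 1)) = (c1 * (\<Prod>a<M. z a) * c2) * (G u * pole_product u)"
      by (simp add: c2 mult_ac)
    then have den: "detn M (H (u + 1)) = (c1 * (\<Prod>a<M. z a) * c2) * (G u * pole_product u) / poly lead u"
      using generic_nonzero(2)[OF u] by (simp add: field_simps)
    show ?thesis
      unfolding Y_def num den conj_fun_def K_def by simp
  qed
  have rec: "poly lead u * Y k u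
    = (if k = 0 then 0 else poly lead u * Y (k - 1) (u + 1)) - poly (B (M - k)) u * Y (M - 1) (u + 1)"
    if "generic u" "k < M" for u k
    by (rule companion_recursion[OF h Y that])
  have rec': "Y k u = (if k = 0 then 0 else Y (k - 1) (u + 1)) - K * (poly (B (M - k)) u * conj_fun h u)"
    if u: "generic u" and k: "k < M" for u k
  proof -
    have "poly lead u * Y k u
      = poly lead u * ((if k = 0 then 0 else Y (k - 1) (u + 1)) - K * (poly (B (M - k)) u * conj_fun h u))"
      unfolding rec[OF that] Y_last[OF u] by (simp add: algebra_simps)
    then show ?thesis using generic_nonzero(2)[OF u] by simp
  qed
  have iter: "Y k u = - K * (\<Sum>l\<le>k. poly (B (M - l)) (u + of_nat (k - l)) * conj_fun h (u + of_nat (k - l)))"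
    if "generic u" "k < M" for u k
    using that
  proof (induction k arbitrary: u)
    case 0
    then show ?case using rec'[of u 0] by simp
  next
    case (Suc k)
    have "Y (Suc k) u = Y k (u + 1) - K * (poly (B (M - Suc k)) u * conj_fun h u)"
      using rec'[OF Suc.prems] by simp
    also have "Y k (u + 1) = - K * (\<Sum>l\<le>k. poly (B (M - l)) (u + 1 + of_nat (k - l)) *
        conj_fun h (u + 1 + of_nat (k - l)))"
      by (rule Suc.IH) (use Suc.prems in \<open>auto intro: generic_shift\<close>)
    also have "(\<Sum>l\<le>k. poly (B (M - l)) (u + 1 + of_nat (k - l)) * conj_fun h (u + 1 + of_nat (k - l)))
        = (\<Sum>l\<le>k. poly (B (M - l)) (u + of_nat (Suc k - l)) * conj_fun h (u + of_nat (Suc k - l)))"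
      by (rule sum.cong) (auto simp: Suc_diff_le add_ac)
    finally have "Y (Suc k) u = - K * ((\<Sum>l\<le>k. poly (B (M - l)) (u + of_nat (Suc k - l)) *
        conj_fun h (u + of_nat (Suc k - l))) + poly (B (M - Suc k)) u * conj_fun h u)"
      by (simp only: distrib_left) simp
    then show ?case by (simp only: sum.atMost_Suc diff_self_eq_0 of_nat_0 add_0_right)
  qed
  \<comment> \<open>the iterated recursion involves the points \<open>u, \<dots>, u + M - 1 = x\<close>, and \<open>Y_last\<close> expresses \<open>Y (M - 1) u\<close> by values at \<open>u - 1 = x - M\<close>\<close>
  define u where "u = x - of_nat (M - 1)"
  have u: "generic u" unfolding u_def by (rule generic_shift(3)[OF x])
  have u1: "generic (x - of_nat M)" by (rule generic_shift(3)[OF x])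
  have ux: "u = x - of_nat M + 1" using M_gt_1 by (simp add: u_def of_nat_diff)
  have "K * (poly lead (x - of_nat M) * conj_fun h (x - of_nat M)) = Y (M - 1) u"
    unfolding ux by (rule Y_last[OF u1, symmetric])
  also have "\<dots> = - K * (\<Sum>l\<le>M - 1. poly (B (M - l)) (u + of_nat (M - 1 - l)) *
      conj_fun h (u + of_nat (M - 1 - l)))"
    by (rule iter[OF u]) (use M_gt_1 in simp)
  also have "(\<Sum>l\<le>M - 1. poly (B (M - l)) (u + of_nat (M - 1 - l)) * conj_fun h (u + of_nat (M - 1 - l)))
      = (\<Sum>l<M. poly (B (M - l)) (x - of_nat l) * conj_fun h (x - of_nat l))"
    by (rule sum.cong) (use M_gt_1 in \<open>auto simp: u_def of_nat_diff\<close>)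
  finally have "K * ((\<Sum>l<M. poly (B (M - l)) (x - of_nat l) * conj_fun h (x - of_nat l))
      + poly lead (x - of_nat M) * conj_fun h (x - of_nat M)) = 0"
    by (simp add: algebra_simps)
  then show ?thesis
    using K by (simp add: B_def[of 0] flip: lessThan_Suc_atMost)
qed

text \<open>
  The residue of \<open>conj_fun h\<close> at \<open>p\<close>; see \<open>conj_fun_residue\<close>.
\<close>

definition conj_residue :: "(nat \<Rightarrow> complex \<Rightarrow> complex) \<Rightarrow> complex \<Rightarrow> complex" where
  "conj_residue h p = (if p \<in> poles then discrete_wronskian (M - 1) h (p + 1) / (G p * (\<Prod>r\<in>poles - {p}. p - r))
              else 0)"

lemma conj_fun_residue:
  assumes h: "basis_of U M h"
  shows "((\<lambda>u. (u - p) * conj_fun h u) \<longlongrightarrow> conj_residue h p) (at p)"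
proof -
  have "(\<lambda>u. discrete_wronskian (M - 1) h (u + 1)) holomorphic_on UNIV"
    by (rule discrete_wronskian_holomorphic) (use basis_mem[OF h] in auto)
  then have num: "((\<lambda>u. discrete_wronskian (M - 1) h (u + 1)) \<longlongrightarrow> discrete_wronskian (M - 1) h (p + 1)) (at p)"
    by (metis UNIV_I holomorphic_on_imp_continuous_on continuous_on_def)
  have G: "(G \<longlongrightarrow> G p) (at p)"
    by (metis UNIV_I G_holomorphic holomorphic_on_imp_continuous_on continuous_on_def)
  show ?thesis
  proof (cases "p \<in> poles")
    case True
    have "((\<lambda>u. discrete_wronskian (M - 1) h (u + 1) / (G u * (\<Prod>r\<in>poles - {p}. u - r)))
        \<longlongrightarrow> discrete_wronskian (M - 1) h (p + 1) / (G p * (\<Prod>r\<in>poles - {p}. p - r))) (at p)"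
      using finite_poles by (intro tendsto_intros num G) (auto simp: G_nonzero)
    moreover have "eventually (\<lambda>u. discrete_wronskian (M - 1) h (u + 1) / (G u * (\<Prod>r\<in>poles - {p}. u - r))
        = (u - p) * conj_fun h u) (at p)"
    proof -
      have "eventually (\<lambda>u. u \<noteq> p) (at p)" by (simp add: eventually_at_filter)
      then show ?thesis
        by eventually_elim (simp add: conj_fun_def pole_product_def prod.remove[OF finite_poles True])
    qed
    ultimately show ?thesis
      unfolding conj_residue_def using True by (auto intro: Lim_transform_eventually)
  next
    case False
    have "((\<lambda>u. (u - p) * conj_fun h u) \<longlongrightarrow>
        (p - p) * (discrete_wronskian (M - 1) h (p + 1) / (G p * pole_product p))) (at p)"
      unfolding conj_fun_def pole_product_def using False finite_poles
      by (intro tendsto_intros num G) (auto simp: G_nonzero)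
    then show ?thesis using False by (simp add: conj_residue_def)
  qed
qed

text \<open>
  Multiply the adjoint equation at \<open>u\<close> by \<open>u - t\<close> and let \<open>u\<close> tend to \<open>t\<close>.
\<close>

lemma adjoint_equation_residues:
  assumes h: "basis_of U M h"
  shows "(\<Sum>j\<le>M. poly (B (M - j)) (t - of_nat j) * conj_residue h (t - of_nat j)) = 0"
proof -
  have "((\<lambda>u. \<Sum>j\<le>M. poly (B (M - j)) (u - of_nat j) *
        ((u - of_nat j - (t - of_nat j)) * conj_fun h (u - of_nat j)))
      \<longlongrightarrow> (\<Sum>j\<le>M. poly (B (M - j)) (t - of_nat j) * conj_residue h (t - of_nat j))) (at t)"
  proof (intro tendsto_intros)
    fix j
    have "filterlim (\<lambda>u. u - of_nat j) (at (t - of_nat j)) (at t)"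
      by (auto simp: filterlim_at eventually_at_filter intro!: tendsto_intros)
    from filterlim_compose[OF conj_fun_residue[OF h] this]
    show "((\<lambda>u. (u - of_nat j - (t - of_nat j)) * conj_fun h (u - of_nat j)) \<longlongrightarrow> conj_residue h (t - of_nat j)) (at t)" .
  qed
  moreover have "eventually (\<lambda>u. (\<Sum>j\<le>M. poly (B (M - j)) (u - of_nat j) *
        ((u - of_nat j - (t - of_nat j)) * conj_fun h (u - of_nat j))) = 0) (at t)"
    using eventually_generic
  proof eventually_elim
    case (elim u)
    have "(\<Sum>j\<le>M. poly (B (M - j)) (u - of_nat j) *
        ((u - of_nat j - (t - of_nat j)) * conj_fun h (u - of_nat j)))
      = (u - t) * (\<Sum>j\<le>M. poly (B (M - j)) (u - of_nat j) * conj_fun h (u - of_nat j))"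
      unfolding sum_distrib_left by (rule sum.cong) (auto simp: algebra_simps)
    then show ?case by (simp add: adjoint_equation_generic[OF h elim])
  qed
  ultimately have "((\<lambda>u. 0) \<longlongrightarrow> (\<Sum>j\<le>M. poly (B (M - j)) (t - of_nat j) * conj_residue h (t - of_nat j))) (at t)"
    by (rule Lim_transform_eventually)
  then show ?thesis by (rule LIM_const_eq[symmetric])
qed

subsection \<open>Integral transforms of the conjugate space\<close>

lemma conj_residue_nonzero_ends:
  assumes "i < N" and "adapted i h"
  shows "conj_residue h (lam i - 1) \<noteq> 0" "conj_residue h (lam i - 1 + of_nat (n i)) \<noteq> 0"
proof -
  have "lam i - 1 + of_int (int s) \<in> poles" if "s \<le> n i" for s
    using mem_poles_iff[OF assms(1), of "int s"] that by simp
  then have "lam i - 1 + of_nat s \<in> poles" if "s \<le> n i" for s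
    using that by (metis of_int_of_nat_eq)
  from this[of 0] this[of "n i"]
  have poles: "lam i - 1 \<in> poles" "lam i - 1 + of_nat (n i) \<in> poles" by simp_all
  show "conj_residue h (lam i - 1) \<noteq> 0"
    using poles(1) adapted_wronskian_first[OF assms(2)] finite_poles
    by (auto simp: conj_residue_def G_nonzero)
  show "conj_residue h (lam i - 1 + of_nat (n i)) \<noteq> 0"
    using poles(2) adapted_wronskian_last[OF assms] finite_poles
    by (auto simp: conj_residue_def G_nonzero)
qed

text \<open>
  The polynomial \<open>p\<^sub>i\<close> of the space of quasi-polynomials, up to a constant factor.
\<close>

definition transform_poly :: "nat \<Rightarrow> (nat \<Rightarrow> complex \<Rightarrow> complex) \<Rightarrow> complex poly" where
  "transform_poly i h = (\<Sum>s\<le>n i. monom (conj_residue h (lam i - 1 + of_nat s)) s)"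

lemma coeff_transform_poly:
  "coeff (transform_poly i h) s = (if s \<le> n i then conj_residue h (lam i - 1 + of_nat s) else 0)"
  by (simp add: transform_poly_def coeff_sum)

lemma degree_transform_poly:
  assumes "i < N" and "adapted i h"
  shows "degree (transform_poly i h) = n i"
  by (rule antisym)
     (auto intro!: degree_le le_degree simp: coeff_transform_poly conj_residue_nonzero_ends[OF assms])

lemma poly_transform_poly_0:
  assumes "i < N" and "adapted i h"
  shows "poly (transform_poly i h) 0 \<noteq> 0"
  using conj_residue_nonzero_ends(1)[OF assms] by (simp add: poly_0_coeff_0 coeff_transform_poly)

definition transform_fun :: "nat \<Rightarrow> (nat \<Rightarrow> complex \<Rightarrow> complex) \<Rightarrow> complex \<Rightarrow> complex" where
  "transform_fun i h t = exp ((lam i - 1) * t) * poly (transform_poly i h) (exp t)"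

lemma sum_pole_set: "(\<Sum>p\<in>pole_set n lam i. f p) = (\<Sum>s\<le>n i. f (lam i - 1 + of_nat s))"
  unfolding pole_set_eq by (subst sum.reindex) (auto simp: inj_on_def)

lemma transform_fun_eq:
  "transform_fun i h t = (\<Sum>p\<in>pole_set n lam i. conj_residue h p * exp (p * t))"
  unfolding transform_fun_def transform_poly_def sum_pole_set poly_sum poly_monom sum_distrib_left
proof (rule sum.cong)
  fix s
  have "exp ((lam i - 1 + of_nat s) * t) = exp ((lam i - 1) * t) * exp t ^ s"
    by (simp add: distrib_right exp_add exp_of_nat_mult)
  then show "exp ((lam i - 1) * t) * (conj_residue h (lam i - 1 + of_nat s) * exp t ^ s)
      = conj_residue h (lam i - 1 + of_nat s) * exp ((lam i - 1 + of_nat s) * t)"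
    by simp
qed simp

lemma admissible_contour_facts:
  assumes i: "i < N" and adm: "admissible_contour N n lam i \<gamma>"
  shows "valid_path \<gamma>" "pathfinish \<gamma> = pathstart \<gamma>" "path_image \<gamma> \<inter> poles = {}"
    and "\<And>p. p \<in> pole_set n lam i \<Longrightarrow> winding_number \<gamma> p = 1"
    and "\<And>p. p \<in> poles - pole_set n lam i \<Longrightarrow> winding_number \<gamma> p = 0"
proof -
  have path: "valid_path \<gamma>" "pathfinish \<gamma> = pathstart \<gamma>"
    and wn: "\<And>p. p \<in> inside (path_image \<gamma>) \<Longrightarrow> winding_number \<gamma> p = 1"
    and ins: "pole_set n lam i \<subseteq> inside (path_image \<gamma>)"
    and dis: "\<And>j. j < N \<Longrightarrow> j \<noteq> i \<Longrightarrow> pole_set n lam j \<inter> (inside (path_image \<gamma>) \<union> path_image \<gamma>) = {}"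
    using adm by (auto simp: admissible_contour_def)
  show "valid_path \<gamma>" "pathfinish \<gamma> = pathstart \<gamma>" by (fact path)+
  have off: "p \<notin> path_image \<gamma>" if "p \<in> pole_set n lam i" for p
    using that ins inside_no_overlap[of "path_image \<gamma>"] by blast
  show "path_image \<gamma> \<inter> poles = {}"
  proof (rule ccontr)
    assume "path_image \<gamma> \<inter> poles \<noteq> {}"
    then obtain p j where p: "p \<in> path_image \<gamma>" "j < N" "p \<in> pole_set n lam j"
      by (auto simp: poles_def)
    then show False using dis[of j] off[of p] by (cases "j = i") auto
  qed
  show "winding_number \<gamma> p = 1" if "p \<in> pole_set n lam i" for p
    using that ins wn by blast
  show "winding_number \<gamma> p = 0" if p: "p \<in> poles - pole_set n lam i" for p
  proof (rule winding_number_zero_in_outside)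
    show "path \<gamma>" using path by (simp add: valid_path_imp_path)
    show "pathfinish \<gamma> = pathstart \<gamma>" by (fact path)
    obtain j where j: "j < N" "p \<in> pole_set n lam j" using p by (auto simp: poles_def)
    then have "j \<noteq> i" using p by auto
    then have "p \<notin> inside (path_image \<gamma>) \<union> path_image \<gamma>" using dis[OF j(1)] j(2) by blast
    then show "p \<in> outside (path_image \<gamma>)"
      using inside_Un_outside[of "path_image \<gamma>"] by blast
  qed
qed

text \<open>
  The integral is evaluated by residues, and \<open>discrete_wronskian_adapted\<close> compares these with the
  residues that define \<open>transform_fun i h\<close>. The constant \<open>c\<close> depends only on the basis \<open>h'\<close> in the
  denominator, and \<open>d\<close> is the factor between the two Wronskians.
\<close>

lemma transform_generator:
  assumes i: "i < N" and h: "adapted i h" and adm: "admissible_contour N n lam i \<gamma>"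
    and f: "\<And>k. k < M - 1 \<Longrightarrow> f k \<in> U" and h': "basis_of U M h'"
  defines "g \<equiv> (\<lambda>u. shift (discrete_wronskian (M - 1) f) u /
                  (poly (special_fundamental_difference_op U M N n lam M) u * discrete_wronskian M h' u))"
  obtains c d where "c \<noteq> 0" and "g holomorphic_on - poles"
    and "\<And>s. s \<le> n i \<Longrightarrow> discrete_wronskian (M - 1) f (lam i + of_nat s)
           = d * discrete_wronskian (M - 1) h (lam i + of_nat s)"
    and "integral_transform \<gamma> g = cfun_scale (c * d) (transform_fun i h)"
proof -
  obtain c where c: "c \<noteq> 0" "\<And>u. poly (B M) u * discrete_wronskian M h' u = c * (G u * pole_product u)"
    by (rule conjugate_denominator[OF h']) blast
  obtain d where d: "\<And>s. s \<le> n i \<Longrightarrow> discrete_wronskian (M - 1) f (lam i + of_nat s)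
      = d * discrete_wronskian (M - 1) h (lam i + of_nat s)"
    by (rule discrete_wronskian_adapted[OF h f]) blast+
  let ?num = "\<lambda>u. discrete_wronskian (M - 1) f (u + 1) / (c * G u)"
  have g: "g u = ?num u / (\<Prod>p\<in>poles. u - p)" for u
    unfolding g_def special_difference_op_eq_B c(2) shift_def pole_product_def by (simp add: mult.assoc)
  have num: "?num holomorphic_on A" for A
    using c(1) G_nonzero
    by (intro holomorphic_intros discrete_wronskian_holomorphic f G_holomorphic) auto
  have hol_num: "(\<lambda>u. exp (u * t) * ?num u) holomorphic_on UNIV" for t
    by (rule holomorphic_on_mult[OF _ num]) (intro holomorphic_intros)
  have hol: "g holomorphic_on - poles"
    unfolding g[abs_def] using finite_poles by (intro holomorphic_intros num) auto
  have S: "pole_set n lam i \<subseteq> poles" using i by (auto simp: poles_def)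
  have "integral_transform \<gamma> g t = (2 * pi * \<i> / c * d) * transform_fun i h t" for t
  proof -
    have "integral_transform \<gamma> g t
        = contour_integral \<gamma> (\<lambda>u. (exp (u * t) * ?num u) / (\<Prod>p\<in>poles. u - p))"
      unfolding integral_transform_def g by simp
    also have "\<dots> = 2 * pi * \<i> *
        (\<Sum>p\<in>pole_set n lam i. (exp (p * t) * ?num p) / (\<Prod>r\<in>poles - {p}. p - r))"
      by (rule contour_integral_simple_poles[OF _ finite_poles S])
         (use admissible_contour_facts[OF i adm] hol_num in \<open>simp_all del: times_divide_eq_right\<close>)
    also have "(\<Sum>p\<in>pole_set n lam i. (exp (p * t) * ?num p) / (\<Prod>r\<in>poles - {p}. p - r))
        = (\<Sum>p\<in>pole_set n lam i. d / c * (conj_residue h p * exp (p * t)))"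
    proof (rule sum.cong)
      fix p assume p: "p \<in> pole_set n lam i"
      then obtain s where s: "s \<le> n i" "p + 1 = lam i + of_nat s" by (auto simp: pole_set_eq)
      have "p \<in> poles" using p S by blast
      then show "(exp (p * t) * ?num p) / (\<Prod>r\<in>poles - {p}. p - r) = d / c * (conj_residue h p * exp (p * t))"
        unfolding s(2) d[OF s(1)] by (simp add: conj_residue_def s(2) mult_ac)
    qed simp
    finally show ?thesis
      unfolding sum_distrib_left[symmetric] transform_fun_eq[symmetric] by simp
  qed
  then have "integral_transform \<gamma> g = cfun_scale ((2 * pi * \<i> / c) * d) (transform_fun i h)"
    by (simp add: fun_eq_iff cfun_scale_def)
  with d hol c(1) show thesis by (intro that[of "2 * pi * \<i> / c" d]) auto
qed

text \<open>
  Holomorphy off the poles is carried along in the induction, since additivity of the contour integral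
  requires integrability.
\<close>

lemma conjugate_space_transform:
  assumes i: "i < N" and h: "adapted i h" and adm: "admissible_contour N n lam i \<gamma>"
    and f: "f \<in> special_conjugate_space U M N n lam"
  shows "f holomorphic_on - poles \<and> (\<exists>c. integral_transform \<gamma> f = cfun_scale c (transform_fun i h))"
  using f unfolding special_conjugate_space_def
proof (induction rule: cfun.span_induct_alt)
  case base
  have "integral_transform \<gamma> 0 = cfun_scale 0 (transform_fun i h)"
    by (simp add: fun_eq_iff integral_transform_def cfun_scale_def)
  moreover have "(0 :: complex \<Rightarrow> complex) holomorphic_on - poles" by (simp add: zero_fun_def)
  ultimately show ?case by blast
next
  case (step x g y)
  obtain a where a: "integral_transform \<gamma> y = cfun_scale a (transform_fun i h)" and y: "y holomorphic_on - poles"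
    using step.IH by blast
  obtain b where b: "integral_transform \<gamma> g = cfun_scale b (transform_fun i h)" and g: "g holomorphic_on - poles"
  proof -
    obtain f h' where fh: "\<forall>k<M - 1. f k \<in> U" "basis_of U M h'"
      and g: "g = (\<lambda>u. shift (discrete_wronskian (M - 1) f) u /
        (poly (special_fundamental_difference_op U M N n lam M) u * discrete_wronskian M h' u))"
      using step.hyps by blast
    show thesis
      by (rule transform_generator[OF i h adm _ fh(2), of f])
         (use fh(1) that in \<open>auto simp: g\<close>)
  qed
  have hol: "cfun_scale x g + y holomorphic_on - poles"
    unfolding cfun_scale_def plus_fun_def using g y by (intro holomorphic_intros)
  have int: "(\<lambda>u. exp (u * t) * k u) contour_integrable_on \<gamma>" if k: "k holomorphic_on - poles" for k t
  proof (rule contour_integrable_holomorphic_simple)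
    show "(\<lambda>u. exp (u * t) * k u) holomorphic_on - poles" by (intro holomorphic_intros k)
    show "open (- poles)" using finite_poles by (intro open_Compl finite_imp_closed)
  qed (use admissible_contour_facts[OF i adm] in auto)
  have "integral_transform \<gamma> (cfun_scale x g + y) t = (x * b + a) * transform_fun i h t" for t
  proof -
    have "integral_transform \<gamma> (cfun_scale x g + y) t
        = contour_integral \<gamma> (\<lambda>u. x * (exp (u * t) * g u) + exp (u * t) * y u)"
      by (simp add: integral_transform_def cfun_scale_def algebra_simps)
    also have "\<dots> = x * integral_transform \<gamma> g t + integral_transform \<gamma> y t"
      unfolding integral_transform_def
      by (simp add: contour_integral_add contour_integrable_lmul contour_integral_lmul int g y)
    finally show ?thesis by (simp add: a b cfun_scale_def algebra_simps)
  qed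
  then have "integral_transform \<gamma> (cfun_scale x g + y) = cfun_scale (x * b + a) (transform_fun i h)"
    by (simp add: fun_eq_iff cfun_scale_def)
  with hol show ?case by blast
qed

text \<open>
  For the function built from the adapted basis itself the factor between the Wronskians is \<open>1\<close>.
\<close>

lemma conjugate_space_transform_nonzero:
  assumes i: "i < N" and h: "adapted i h" and adm: "admissible_contour N n lam i \<gamma>"
  obtains f c where "f \<in> special_conjugate_space U M N n lam" and "c \<noteq> 0"
    and "integral_transform \<gamma> f = cfun_scale c (transform_fun i h)"
proof -
  let ?g = "\<lambda>u. shift (discrete_wronskian (M - 1) h) u /
      (poly (special_fundamental_difference_op U M N n lam M) u * discrete_wronskian M h u)"
  have bas: "basis_of U M h" and h_U: "\<And>k. k < M - 1 \<Longrightarrow> h k \<in> U"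
    using h basis_mem by (auto simp: adapted_def)
  obtain c d where cd: "c \<noteq> 0"
    "\<And>s. s \<le> n i \<Longrightarrow> discrete_wronskian (M - 1) h (lam i + of_nat s)
           = d * discrete_wronskian (M - 1) h (lam i + of_nat s)"
    "integral_transform \<gamma> ?g = cfun_scale (c * d) (transform_fun i h)"
    by (rule transform_generator[OF i h adm h_U bas]) blast+
  have "d = 1"
    using cd(2)[of 0] adapted_wronskian_first[OF h] by simp
  moreover have "?g \<in> special_conjugate_space U M N n lam"
    unfolding special_conjugate_space_def
    by (rule cfun.span_base) (use bas h_U in blast)
  ultimately show thesis using cd that by simp
qed

lemma span_transforms_eq:
  assumes h: "\<And>i. i < N \<Longrightarrow> adapted i (h i)"
    and adm: "\<And>i. i < N \<Longrightarrow> admissible_contour N n lam i (\<gamma> i)"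
  shows "cfun.span {integral_transform (\<gamma> i) f | i f. i < N \<and> f \<in> special_conjugate_space U M N n lam}
    = cfun.span ((\<lambda>i. transform_fun i (h i)) ` {..<N})"
proof (rule cfun.span_eq[THEN iffD2], intro conjI subsetI)
  fix F assume "F \<in> {integral_transform (\<gamma> i) f | i f. i < N \<and> f \<in> special_conjugate_space U M N n lam}"
  then obtain i f where i: "i < N" and f: "f \<in> special_conjugate_space U M N n lam"
    and F: "F = integral_transform (\<gamma> i) f" by blast
  obtain c where "F = cfun_scale c (transform_fun i (h i))"
    using conjugate_space_transform[OF i h[OF i] adm[OF i] f] F by blast
  then show "F \<in> cfun.span ((\<lambda>i. transform_fun i (h i)) ` {..<N})"
    using i by (simp add: cfun.span_scale cfun.span_base)
next
  fix F assume "F \<in> (\<lambda>i. transform_fun i (h i)) ` {..<N}"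
  then obtain i where i: "i < N" "F = transform_fun i (h i)" by blast
  obtain f c where f: "f \<in> special_conjugate_space U M N n lam" "c \<noteq> 0"
    "integral_transform (\<gamma> i) f = cfun_scale c (transform_fun i (h i))"
    by (rule conjugate_space_transform_nonzero[OF i(1) h[OF i(1)] adm[OF i(1)]])
  then have "F = cfun_scale (1 / c) (integral_transform (\<gamma> i) f)"
    by (simp add: i cfun_scale_def)
  also have "\<dots> \<in> cfun.span {integral_transform (\<gamma> i) f | i f. i < N \<and> f \<in> special_conjugate_space U M N n lam}"
    by (intro cfun.span_scale cfun.span_base) (use i f in blast)
  finally show "F \<in> \<dots>" .
qed

text \<open>
  The coefficient of \<open>x\<^bsup>\<lambda>\<^sub>i - 1 + r\<^esup>\<close>, with \<open>x = exp t\<close>, is the left-hand side of the adjoint equation for the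
  residues at \<open>\<lambda>\<^sub>i - 1 + r\<close>. Terms outside \<open>S\<^sub>i\<close> may be included because the residues vanish there.
\<close>

lemma adjoint_annihilates_exponential_sum:
  assumes i: "i < N" and h: "basis_of U M h"
  shows "(\<Sum>j\<le>M. exp (of_nat j * t) *
    (\<Sum>p\<in>pole_set n lam i. poly (B (M - j)) p * (conj_residue h p * exp (p * t)))) = 0"
proof -
  define x where "x = (\<lambda>k. lam i - 1 + of_int k)"
  define b where "b = (\<lambda>j k. poly (B (M - j)) (x k) * conj_residue h (x k))"
  have b0: "b j k = 0" if "k < 0 \<or> k > int (n i)" for j k
    using mem_poles_iff[OF i, of k] that by (auto simp: b_def conj_residue_def x_def)
  have "exp (of_nat j * t) * (\<Sum>p\<in>pole_set n lam i. poly (B (M - j)) p * (conj_residue h p * exp (p * t)))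
      = (\<Sum>r\<le>n i + M. exp (x (int r) * t) * b j (int r - int j))" if "j \<le> M" for j
  proof -
    have "(\<Sum>r\<le>n i + M. exp (x (int r) * t) * b j (int r - int j))
        = (\<Sum>r\<in>{j..n i + j}. exp (x (int r) * t) * b j (int r - int j))"
      by (rule sum.mono_neutral_right) (use that b0 in auto)
    also have "\<dots> = (\<Sum>s\<le>n i. exp (x (int (s + j)) * t) * b j (int s))"
      using sum.shift_bounds_cl_nat_ivl[of "\<lambda>r. exp (x (int r) * t) * b j (int r - int j)" 0 j "n i"]
      by (simp add: atMost_atLeast0)
    also have "\<dots> = exp (of_nat j * t) *
        (\<Sum>p\<in>pole_set n lam i. poly (B (M - j)) p * (conj_residue h p * exp (p * t)))"
      unfolding sum_pole_set sum_distrib_left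
    proof (rule sum.cong)
      fix s
      have "exp (x (int (s + j)) * t) = exp (of_nat j * t) * exp ((lam i - 1 + of_nat s) * t)"
        unfolding exp_add[symmetric] by (simp add: x_def algebra_simps)
      then show "exp (x (int (s + j)) * t) * b j (int s) = exp (of_nat j * t) *
          (poly (B (M - j)) (lam i - 1 + of_nat s) * (conj_residue h (lam i - 1 + of_nat s) *
             exp ((lam i - 1 + of_nat s) * t)))"
        by (simp add: b_def x_def)
    qed simp
    finally show ?thesis by simp
  qed
  then have "(\<Sum>j\<le>M. exp (of_nat j * t) *
        (\<Sum>p\<in>pole_set n lam i. poly (B (M - j)) p * (conj_residue h p * exp (p * t))))
      = (\<Sum>r\<le>n i + M. exp (x (int r) * t) * (\<Sum>j\<le>M. b j (int r - int j)))"
    unfolding sum_distrib_left by (subst sum.swap) (simp add: sum_distrib_left)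
  also have "\<dots> = 0"
  proof (rule sum.neutral, rule ballI)
    fix r
    have "(\<Sum>j\<le>M. b j (int r - int j))
        = (\<Sum>j\<le>M. poly (B (M - j)) (x (int r) - of_nat j) * conj_residue h (x (int r) - of_nat j))"
      by (rule sum.cong) (auto simp: b_def x_def add_diff_eq)
    also have "\<dots> = 0" by (rule adjoint_equation_residues[OF h])
    finally show "exp (x (int r) * t) * (\<Sum>j\<le>M. b j (int r - int j)) = 0" by simp
  qed
  finally show ?thesis .
qed

subsection \<open>Leading coefficients of the difference operator\<close>

text \<open>
  The coefficient of \<open>(x \<partial>\<^sub>x)\<^sup>i\<close> in the transformed operator, as a polynomial in \<open>x\<close>.
\<close>

definition theta_coeff :: "nat \<Rightarrow> complex poly" where
  "theta_coeff i = (\<Sum>j\<le>M. monom (coeff (B (M - j)) i) j)"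

lemma poly_theta_coeff: "poly (theta_coeff i) x = (\<Sum>j\<le>M. coeff (B (M - j)) i * x ^ j)"
  by (simp add: theta_coeff_def poly_sum poly_monom)

lemma theta_coeff_N_root: "a < M \<Longrightarrow> poly (theta_coeff N) (z a) = 0"
  unfolding poly_theta_coeff
  by (rule quasi_exponential_leading_coeff[OF q_nonzero])
     (use sum_B_Q degree_B_le in \<open>auto simp: Q_def\<close>)

lemma coeff_theta_coeff_N: "coeff (theta_coeff N) M = 1"
  by (simp add: theta_coeff_def coeff_sum B_def coeff_lead)

lemma theta_coeff_N_eq: "theta_coeff N = (\<Prod>a<M. [:- z a, 1:])"
proof -
  have deg: "degree (theta_coeff N) \<le> M"
    unfolding theta_coeff_def by (rule degree_sum_le) (auto intro: order.trans[OF degree_monom_le])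
  have nz: "theta_coeff N \<noteq> 0" using coeff_theta_coeff_N by auto
  obtain c where "c \<noteq> 0"
    and c: "theta_coeff N = Polynomial.smult c (\<Prod>r\<in>z ` {..<M}. [:-r, 1:])"
  proof (rule poly_eq_smult_prod_linear_factors[of "z ` {..<M}" "theta_coeff N"])
    show "poly (theta_coeff N) r = 0" if "r \<in> z ` {..<M}" for r using that theta_coeff_N_root by auto
  qed (use deg nz card_image[OF z_inj] in auto)
  then have eq: "theta_coeff N = Polynomial.smult c (\<Prod>a<M. [:- z a, 1:])"
    by (simp add: prod.reindex[OF z_inj])
  have "degree (\<Prod>a<M. [:- z a, 1:]) = M" by (simp add: degree_prod_eq_sum_degree)
  moreover have "lead_coeff (\<Prod>a<M. [:- z a, 1:]) = 1" by (simp add: lead_coeff_prod)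
  ultimately have "coeff (\<Prod>a<M. [:- z a, 1:]) M = 1" by simp
  then have "c = 1" using coeff_theta_coeff_N eq by simp
  then show ?thesis using eq by simp
qed

lemma theta_coeff_N_simple_root:
  assumes "a < M"
  shows "poly (pderiv (theta_coeff N)) (z a) \<noteq> 0"
proof -
  have "theta_coeff N = [:- z a, 1:] * (\<Prod>b\<in>{..<M} - {a}. [:- z b, 1:])"
    unfolding theta_coeff_N_eq by (rule prod.remove) (use assms in auto)
  then have "poly (pderiv (theta_coeff N)) (z a) = poly (\<Prod>b\<in>{..<M} - {a}. [:- z b, 1:]) (z a)"
    by (simp only: pderiv_mult poly_add poly_mult) (simp add: pderiv_pCons)
  also have "\<dots> = (\<Prod>b\<in>{..<M} - {a}. z a - z b)" by (simp add: poly_prod)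
  also have "\<dots> \<noteq> 0" using z_inj assms by (auto simp: inj_on_def)
  finally show ?thesis .
qed

text \<open>
  This value is what makes \<open>N - 1 + m a\<close> a root of the indicial equation at \<open>z a\<close>.
\<close>

lemma theta_coeff_subleading:
  assumes "a < M"
  shows "poly (theta_coeff (N - 1)) (z a) = - of_nat (m a) * (z a * poly (pderiv (theta_coeff N)) (z a))"
proof -
  have N: "N = Suc (N - 1)" using N_gt_1 by simp
  have "(\<Sum>j\<le>M. (coeff (B (M - j)) (N - 1) +
      of_nat (degree (q a)) * of_nat j * coeff (B (M - j)) (Suc (N - 1))) * z a ^ j) = 0"
    by (rule quasi_exponential_subleading_coeff[OF q_nonzero])
       (use sum_B_Q degree_B_le N assms in \<open>auto simp: Q_def\<close>)
  then have "poly (theta_coeff (N - 1)) (z a)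
      + of_nat (m a) * (\<Sum>j\<le>M. of_nat j * coeff (B (M - j)) N * z a ^ j) = 0"
    unfolding degree_q[OF assms] N[symmetric]
    unfolding poly_theta_coeff sum_distrib_left sum.distrib[symmetric] by (simp add: algebra_simps)
  moreover have "pderiv (sum f J) = (\<Sum>j\<in>J. pderiv (f j))" for f :: "nat \<Rightarrow> complex poly" and J
    by (induction J rule: infinite_finite_induct) (auto simp: pderiv_add)
  then have "z a * poly (pderiv (theta_coeff N)) (z a)
      = (\<Sum>j\<le>M. of_nat j * coeff (B (M - j)) N * z a ^ j)"
    unfolding theta_coeff_def
  proof (simp add: poly_sum sum_distrib_left, intro sum.cong)
    fix j show "z a * poly (pderiv (monom (coeff (B (M - j)) N) j)) (z a)
        = of_nat j * coeff (B (M - j)) N * z a ^ j"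
      by (cases j) (simp_all add: pderiv_monom poly_monom)
  qed simp
  ultimately show ?thesis by (simp add: add_eq_0_iff2)
qed

end

section \<open>Differential operators on the universal cover\<close>

lemma branch_has_derivative:
  assumes "F holomorphic_on UNIV"
  shows "(branch F t has_field_derivative deriv F t / exp t) (at (exp t))"
proof -
  have L: "((\<lambda>x. t + Ln (x / exp t)) has_field_derivative 1 / exp t) (at (exp t))"
    by (auto intro!: derivative_eq_intros)
  have "(F has_field_derivative deriv F t) (at (t + Ln (exp t / exp t)))"
    using holomorphic_derivI[OF assms, of t] by simp
  from DERIV_chain2[OF this L] show ?thesis
    by (simp add: branch_def[abs_def])
qed

text \<open>
  The branch is inverse to the exponential function near the base point, so this is \<open>\<partial>\<^sub>x = e\<^bsup>-t\<^esup> \<partial>\<^sub>t\<close>.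
\<close>

lemma mv_deriv_eq: "F holomorphic_on UNIV \<Longrightarrow> mv_deriv F t = deriv F t / exp t"
  unfolding mv_deriv_def by (rule DERIV_imp_deriv[OF branch_has_derivative])

lemma mv_euler_eq: "F holomorphic_on UNIV \<Longrightarrow> mv_euler F = deriv F"
  by (simp add: fun_eq_iff mv_euler_def mv_deriv_eq)

lemma mv_euler_funpow: "F holomorphic_on UNIV \<Longrightarrow> (mv_euler ^^ k) F = (deriv ^^ k) F"
  by (induction k) (simp_all add: mv_euler_eq holomorphic_higher_deriv)

lemma mv_deriv_funpow_holomorphic:
  assumes "F holomorphic_on UNIV"
  shows "(mv_deriv ^^ k) F holomorphic_on UNIV"
proof (induction k)
  case (Suc k)
  have "mv_deriv ((mv_deriv ^^ k) F) = (\<lambda>t. deriv ((mv_deriv ^^ k) F) t / exp t)"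
    by (simp add: fun_eq_iff mv_deriv_eq[OF Suc.IH])
  then show ?case by (simp add: holomorphic_intros Suc.IH)
qed (use assms in simp)

text \<open>
  The expansion of \<open>(x \<partial>\<^sub>x)\<^sup>i\<close> into the operators \<open>x\<^sup>k \<partial>\<^sub>x\<^sup>k\<close>, whose coefficients are the Stirling numbers of the
  second kind.
\<close>

lemma higher_deriv_eq_sum_mv_deriv:
  assumes F: "F holomorphic_on UNIV"
  shows "(deriv ^^ i) F t = (\<Sum>k\<le>i. of_nat (Stirling i k) * exp t ^ k * (mv_deriv ^^ k) F t)"
proof (induction i arbitrary: t)
  case (Suc i)
  define D where "D k = (mv_deriv ^^ k) F" for k
  have D: "(D k has_field_derivative exp t * D (Suc k) t) (at t)" for k
  proof -
    have hol: "D k holomorphic_on UNIV" unfolding D_def by (rule mv_deriv_funpow_holomorphic[OF F])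
    have "D (Suc k) t = deriv (D k) t / exp t" using mv_deriv_eq[OF hol, of t] by (simp add: D_def)
    then show ?thesis using holomorphic_derivI[OF hol, of t] by simp
  qed
  have eq: "(deriv ^^ i) F = (\<lambda>t. \<Sum>k\<le>i. of_nat (Stirling i k) * exp t ^ k * D k t)"
    using Suc.IH by (simp add: fun_eq_iff D_def)
  have "((\<lambda>t. \<Sum>k\<le>i. of_nat (Stirling i k) * exp t ^ k * D k t) has_field_derivative
      (\<Sum>k\<le>i. of_nat (Stirling i k) * (of_nat k * exp t ^ k) * D k t
        + of_nat (Stirling i k) * exp t ^ Suc k * D (Suc k) t)) (at t)"
  proof (rule DERIV_sum)
    fix k
    have "((\<lambda>t. exp t ^ k) has_field_derivative of_nat k * exp t ^ k) (at t)"
    proof -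
      have "((\<lambda>t. exp (of_nat k * t)) has_field_derivative of_nat k * exp (of_nat k * t)) (at t)"
        by (auto intro!: derivative_eq_intros)
      then show ?thesis by (simp add: exp_of_nat_mult)
    qed
    from DERIV_mult[OF DERIV_cmult[OF this, of "of_nat (Stirling i k)"] D[of k]]
    show "((\<lambda>t. of_nat (Stirling i k) * exp t ^ k * D k t) has_field_derivative
        of_nat (Stirling i k) * (of_nat k * exp t ^ k) * D k t
        + of_nat (Stirling i k) * exp t ^ Suc k * D (Suc k) t) (at t)"
      by (simp add: mult_ac)
  qed
  then have "(deriv ^^ Suc i) F t = (\<Sum>k\<le>i. of_nat (Stirling i k) * (of_nat k * exp t ^ k) * D k t
        + of_nat (Stirling i k) * exp t ^ Suc k * D (Suc k) t)"
    using eq by (simp add: DERIV_imp_deriv)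
  also have "\<dots> = (\<Sum>k\<le>i. of_nat k * of_nat (Stirling i k) * exp t ^ k * D k t)
      + (\<Sum>k\<le>i. of_nat (Stirling i k) * exp t ^ Suc k * D (Suc k) t)"
    by (simp add: sum.distrib mult_ac)
  also have "(\<Sum>k\<le>i. of_nat k * of_nat (Stirling i k) * exp t ^ k * D k t)
      = (\<Sum>k\<le>Suc i. of_nat k * of_nat (Stirling i k) * exp t ^ k * D k t)"
    by simp
  also have "\<dots> = (\<Sum>k\<le>i. of_nat (Suc k) * of_nat (Stirling i (Suc k)) * exp t ^ Suc k * D (Suc k) t)"
    by (subst sum.atMost_Suc_shift) simp
  also have "\<dots> + (\<Sum>k\<le>i. of_nat (Stirling i k) * exp t ^ Suc k * D (Suc k) t)
      = (\<Sum>k\<le>i. of_nat (Stirling (Suc i) (Suc k)) * exp t ^ Suc k * D (Suc k) t)"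
    unfolding sum.distrib[symmetric] by (rule sum.cong) (simp_all add: algebra_simps)
  also have "\<dots> = (\<Sum>k\<le>Suc i. of_nat (Stirling (Suc i) k) * exp t ^ k * D k t)"
    by (subst sum.atMost_Suc_shift) simp
  finally show ?case by (simp add: D_def)
qed simp

lemma eventually_cosparse_exp_poly_nonzero:
  fixes p :: "complex poly"
  assumes "p \<noteq> 0"
  shows "eventually (\<lambda>t. poly p (exp t) \<noteq> 0) (cosparse UNIV)"
proof -
  have "eventually (\<lambda>t. poly p (exp t) \<noteq> 0) (at t0)" for t0
  proof -
    have "filterlim exp (at (exp t0)) (at t0)"
      unfolding filterlim_at
    proof (intro conjI)
      show "(exp \<longlongrightarrow> exp t0) (at t0)" by (intro tendsto_intros)
      have "eventually (\<lambda>t. t \<in> ball t0 (2 * pi)) (at t0)"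
        by (rule eventually_at_in_open') auto
      moreover have "eventually (\<lambda>t. t \<noteq> t0) (at t0)" by (simp add: eventually_at_filter)
      ultimately show "eventually (\<lambda>t. exp t \<in> UNIV \<and> exp t \<noteq> exp t0) (at t0)"
      proof eventually_elim
        case (elim t)
        show ?case
        proof
          show "exp t \<noteq> exp t0"
          proof
            assume "exp t = exp t0"
            moreover have "\<bar>Im t - Im t0\<bar> < 2 * pi"
              using elim(1) abs_Im_le_cmod[of "t - t0"] by (simp add: dist_norm norm_minus_commute)
            ultimately show False using elim(2) exp_complex_eqI by blast
          qed
        qed simp
      qed
    qed
    moreover have "eventually (\<lambda>x. poly p x \<noteq> 0) (at (exp t0))"
      using eventually_cosparse_imp_eventually_at[OF eventually_cosparse_poly_nonzero[OF assms], of "exp t0"]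
      by simp
    ultimately show ?thesis by (rule eventually_compose_filterlim[rotated])
  qed
  then show ?thesis by (simp add: eventually_cosparse_open_eq)
qed

text \<open>
  Rewriting the powers of \<open>x \<partial>\<^sub>x\<close> by \<open>x\<^sup>k \<partial>\<^sub>x\<^sup>k\<close> and dividing by \<open>x\<^sup>N a\<^sub>N(x)\<close> yields a monic operator with rational
  coefficients that annihilates \<open>V\<close>; only the top power contributes to \<open>\<partial>\<^sub>x\<^sup>N\<close>.
\<close>

lemma special_differential_op_euler_form:
  fixes a :: "nat \<Rightarrow> complex poly" and z :: "nat \<Rightarrow> complex"
  assumes lead: "a N = (\<Prod>b<M. [:- z b, 1:])"
    and hol: "\<And>f. f \<in> V \<Longrightarrow> f holomorphic_on UNIV"
    and ann: "\<And>f t. f \<in> V \<Longrightarrow> (\<Sum>i\<le>N. poly (a i) (exp t) * (deriv ^^ i) f t) = 0"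
    and D: "\<And>F t. F holomorphic_on UNIV \<Longrightarrow> D F t = (\<Sum>i\<le>N. poly (a i) (exp t) * (deriv ^^ i) F t)"
  shows "special_fundamental_differential_op V N M z D"
proof -
  define r where "r k = (\<Sum>i\<le>N. Polynomial.smult (of_nat (Stirling i k)) (a i))" for k
  have r_N: "r N = a N"
  proof -
    have "r N = (\<Sum>i\<le>N. if i = N then a N else 0)"
      unfolding r_def by (rule sum.cong) auto
    then show ?thesis by simp
  qed
  \<comment> \<open>for \<open>k = 0\<close> the quotient is \<open>1\<close> only where its denominator does not vanish\<close>
  define c where "c k = (\<lambda>x. if k = 0 then 1
    else poly (r (N - k)) x * x ^ (N - k) / (x ^ N * poly (a N) x))" for k
  have aN: "a N \<noteq> 0" by (simp add: lead)
  have mer: "c k meromorphic_on UNIV" for k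
  proof (cases "k = 0")
    case False
    then have "c k = (\<lambda>x. poly (r (N - k) * monom 1 (N - k)) x / poly (monom 1 N * a N) x)"
      by (simp add: c_def poly_monom fun_eq_iff)
    then show ?thesis
      by (simp only:) (intro meromorphic_intros poly_meromorphic_on)
  qed (auto simp: c_def)
  have key: "(\<Sum>i\<le>N. poly (a i) (exp t) * (deriv ^^ i) F t)
      = exp t ^ N * poly (a N) (exp t) * (\<Sum>k\<le>N. c k (exp t) * (mv_deriv ^^ (N - k)) F t)"
    if F: "F holomorphic_on UNIV" and nz: "poly (a N) (exp t) \<noteq> 0" for F t
  proof -
    have "(\<Sum>i\<le>N. poly (a i) (exp t) * (deriv ^^ i) F t)
        = (\<Sum>i\<le>N. \<Sum>k\<le>N. poly (a i) (exp t) * (of_nat (Stirling i k) * exp t ^ k * (mv_deriv ^^ k) F t))"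
    proof (rule sum.cong)
      fix i assume i: "i \<in> {..N}"
      have "(deriv ^^ i) F t = (\<Sum>k\<le>i. of_nat (Stirling i k) * exp t ^ k * (mv_deriv ^^ k) F t)"
        by (rule higher_deriv_eq_sum_mv_deriv[OF F])
      also have "\<dots> = (\<Sum>k\<le>N. of_nat (Stirling i k) * exp t ^ k * (mv_deriv ^^ k) F t)"
        by (rule sum.mono_neutral_left) (use i in auto)
      finally show "poly (a i) (exp t) * (deriv ^^ i) F t
          = (\<Sum>k\<le>N. poly (a i) (exp t) * (of_nat (Stirling i k) * exp t ^ k * (mv_deriv ^^ k) F t))"
        by (simp add: sum_distrib_left)
    qed simp
    also have "\<dots> = (\<Sum>k\<le>N. poly (r k) (exp t) * exp t ^ k * (mv_deriv ^^ k) F t)"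
      by (subst sum.swap) (simp add: r_def poly_sum sum_distrib_left sum_distrib_right mult_ac)
    also have "\<dots> = (\<Sum>k\<le>N. poly (r (N - k)) (exp t) * exp t ^ (N - k) * (mv_deriv ^^ (N - k)) F t)"
      by (rule sum.reindex_bij_witness[of _ "\<lambda>j. N - j" "\<lambda>j. N - j"]) auto
    also have "\<dots> = (\<Sum>k\<le>N. exp t ^ N * poly (a N) (exp t) * (c k (exp t) * (mv_deriv ^^ (N - k)) F t))"
      by (rule sum.cong) (use nz in \<open>auto simp: c_def r_N\<close>)
    finally show ?thesis by (simp add: sum_distrib_left)
  qed
  have P: "(\<Prod>b<M. x - z b) = poly (a N) x" for x
    by (simp add: lead poly_prod)
  note ev = eventually_cosparse_exp_poly_nonzero[OF aN]
  have "fundamental_differential_op V N c"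
    unfolding fundamental_differential_op_def
  proof (intro conjI allI impI ballI)
    fix f assume f: "f \<in> V"
    show "eventually (\<lambda>t. (\<Sum>k\<le>N. c k (exp t) * (mv_deriv ^^ (N - k)) f t) = 0) (cosparse UNIV)"
      using ev by eventually_elim (use key[OF hol[OF f]] ann[OF f] in auto)
  qed (use mer in \<open>auto simp: c_def\<close>)
  moreover have "eventually (\<lambda>t. D F t = exp t ^ N * (\<Prod>a<M. exp t - z a) *
      (\<Sum>k\<le>N. c k (exp t) * (mv_deriv ^^ (N - k)) F t)) (cosparse UNIV)"
    if F: "F holomorphic_on UNIV" for F
    using ev by eventually_elim (simp add: D[OF F] P key[OF F])
  ultimately show ?thesis
    unfolding special_fundamental_differential_op_def by blast
qed

section \<open>Exponents of the solutions of a linear differential equation\<close>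

text \<open>
  Up to factors that are holomorphic near \<open>t\<close>, each \<open>(w - t)\<^sup>i \<partial>\<^sup>i\<close> preserves the order of vanishing, and the
  value at \<open>t\<close> is multiplied by the falling factorial \<open>k (k - 1) \<cdots> (k - i + 1)\<close>. Working with
  \<open>(w - t)\<^sup>i \<partial>\<^sup>i\<close> avoids negative exponents when \<open>i\<close> exceeds \<open>k\<close>.
\<close>

lemma euler_factorization:
  assumes S: "open S" and f: "f holomorphic_on S" and g: "g holomorphic_on S"
    and eq: "\<And>w. w \<in> S \<Longrightarrow> f w = (w - t) ^ k * g w"
  shows "\<exists>h. h holomorphic_on S \<and> h t = (\<Prod>l<i. of_nat k - of_nat l) * g t \<and>
      (\<forall>w\<in>S. (w - t) ^ i * (deriv ^^ i) f w = (w - t) ^ k * h w)"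
proof (induction i)
  case 0
  show ?case by (rule exI[of _ g]) (use g eq in auto)
next
  case (Suc i)
  obtain h where h: "h holomorphic_on S" "h t = (\<Prod>l<i. of_nat k - of_nat l) * g t"
    "\<And>w. w \<in> S \<Longrightarrow> (w - t) ^ i * (deriv ^^ i) f w = (w - t) ^ k * h w"
    using Suc.IH by blast
  show ?case
  proof (intro exI[of _ "\<lambda>w. (of_nat k - of_nat i) * h w + (w - t) * deriv h w"] conjI ballI)
    show "(\<lambda>w. (of_nat k - of_nat i) * h w + (w - t) * deriv h w) holomorphic_on S"
      by (intro holomorphic_intros h(1) S)
    show "(of_nat k - of_nat i) * h t + (t - t) * deriv h t
        = (\<Prod>l<Suc i. of_nat k - of_nat l) * g t"
      by (simp add: h(2))
    fix w assume w: "w \<in> S"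
    have pw: "((\<lambda>w. (w - t) ^ j) has_field_derivative of_nat j * (w - t) ^ (j - 1)) (at w)" for j
      by (auto intro!: derivative_eq_intros)
    have pw': "(w - t) * (of_nat j * (w - t) ^ (j - 1)) = of_nat j * (w - t) ^ j" for j
      by (cases j) auto
    have "((deriv ^^ i) f has_field_derivative (deriv ^^ Suc i) f w) (at w)"
      using holomorphic_derivI[OF holomorphic_higher_deriv[OF f S] S w] by simp
    from DERIV_mult[OF pw[of i] this]
    have 1: "((\<lambda>w. (w - t) ^ i * (deriv ^^ i) f w) has_field_derivative
        of_nat i * (w - t) ^ (i - 1) * (deriv ^^ i) f w + (deriv ^^ Suc i) f w * (w - t) ^ i) (at w)" .
    have "(h has_field_derivative deriv h w) (at w)"
      by (rule holomorphic_derivI[OF h(1) S w])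
    from DERIV_mult[OF pw[of k] this]
    have 2: "((\<lambda>w. (w - t) ^ k * h w) has_field_derivative
        of_nat k * (w - t) ^ (k - 1) * h w + deriv h w * (w - t) ^ k) (at w)" .
    have "((\<lambda>w. (w - t) ^ i * (deriv ^^ i) f w) has_field_derivative
        of_nat k * (w - t) ^ (k - 1) * h w + deriv h w * (w - t) ^ k) (at w)"
      by (rule has_field_derivative_transform_within_open[OF 2 S w]) (simp add: h(3))
    from DERIV_unique[OF 1 this]
    have e1: "(w - t) * (of_nat i * (w - t) ^ (i - 1) * (deriv ^^ i) f w + (deriv ^^ Suc i) f w * (w - t) ^ i)
        = (w - t) * (of_nat k * (w - t) ^ (k - 1) * h w + deriv h w * (w - t) ^ k)"
      by simp
    have e2: "(w - t) * (of_nat i * (w - t) ^ (i - 1) * (deriv ^^ i) f w + (deriv ^^ Suc i) f w * (w - t) ^ i)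
        = of_nat i * ((w - t) ^ i * (deriv ^^ i) f w) + (w - t) ^ Suc i * (deriv ^^ Suc i) f w"
      using arg_cong[OF pw'[of i], of "\<lambda>x. x * (deriv ^^ i) f w"]
      by (simp only: distrib_left power_Suc mult_ac)
    have e3: "(w - t) * (of_nat k * (w - t) ^ (k - 1) * h w + deriv h w * (w - t) ^ k)
        = of_nat k * (w - t) ^ k * h w + (w - t) ^ k * ((w - t) * deriv h w)"
      using arg_cong[OF pw'[of k], of "\<lambda>x. x * h w"]
      by (simp only: distrib_left mult_ac)
    have "of_nat i * ((w - t) ^ i * (deriv ^^ i) f w) + (w - t) ^ Suc i * (deriv ^^ Suc i) f w
        = of_nat k * (w - t) ^ k * h w + (w - t) ^ k * ((w - t) * deriv h w)"
      by (rule trans[OF e2[symmetric] trans[OF e1 e3]])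
    then have "(w - t) ^ Suc i * (deriv ^^ Suc i) f w
        = of_nat k * (w - t) ^ k * h w + (w - t) ^ k * ((w - t) * deriv h w) - of_nat i * ((w - t) ^ k * h w)"
      unfolding h(3)[OF w] by (simp only: eq_diff_eq add.commute)
    then show "(w - t) ^ Suc i * (deriv ^^ Suc i) f w
        = (w - t) ^ k * ((of_nat k - of_nat i) * h w + (w - t) * deriv h w)"
      by (simp only: algebra_simps)
  qed
qed

lemma falling_eq_0_iff:
  "(\<Prod>l<i. of_nat k - of_nat l :: complex) = 0 \<longleftrightarrow> k < i"
  by auto

text \<open>
  The local data of a nonzero entire function at \<open>t\<close> from which the indicial equation is computed.
\<close>

lemma entire_order:
  fixes f :: "complex \<Rightarrow> complex"
  assumes f: "f holomorphic_on UNIV" and nz: "f \<noteq> 0"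
  obtains k h where "zorder f t = int k" and "(deriv ^^ k) f t \<noteq> 0"
    and "\<And>i. isCont (h i) t"
    and "\<And>i. h i t = (\<Prod>l<i. of_nat k - of_nat l) * h 0 t" and "h 0 t \<noteq> 0"
    and "\<And>i. eventually (\<lambda>w. (w - t) ^ i * (deriv ^^ i) f w = (w - t) ^ k * h i w) (at t)"
proof -
  define k where "k = nat (zorder f t)"
  have "\<exists>w\<in>UNIV. f w \<noteq> 0" using nz by (auto simp: fun_eq_iff)
  note ord = zorder_exist_zero[OF f open_UNIV connected_UNIV UNIV_I[of t] this]
  have "zorder f t \<ge> 0" using conjunct1[OF ord] by (simp split: if_splits)
  from conjunct2[OF ord]
  obtain r where r: "r > 0" "zor_poly f t holomorphic_on cball t r"
    "\<And>w. w \<in> cball t r \<Longrightarrow> f w = zor_poly f t w * (w - t) ^ k \<and> zor_poly f t w \<noteq> 0"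
    unfolding k_def by blast
  define g where "g = zor_poly f t"
  have k: "zorder f t = int k" using \<open>zorder f t \<ge> 0\<close> by (simp add: k_def)
  let ?S = "ball t r"
  have g: "g holomorphic_on ?S" "\<And>w. w \<in> ?S \<Longrightarrow> f w = (w - t) ^ k * g w" "g t \<noteq> 0"
    using r by (auto simp: g_def intro: holomorphic_on_subset)
  have "\<forall>i. \<exists>h. h holomorphic_on ?S \<and> h t = (\<Prod>l<i. of_nat k - of_nat l) * g t \<and>
      (\<forall>w\<in>?S. (w - t) ^ i * (deriv ^^ i) f w = (w - t) ^ k * h w)"
  proof
    fix i
    show "\<exists>h. h holomorphic_on ?S \<and> h t = (\<Prod>l<i. of_nat k - of_nat l) * g t \<and>
      (\<forall>w\<in>?S. (w - t) ^ i * (deriv ^^ i) f w = (w - t) ^ k * h w)"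
    proof (rule euler_factorization[of ?S f g t k i])
      show "f holomorphic_on ?S" using f by (rule holomorphic_on_subset) simp
      show "g holomorphic_on ?S" by (rule g(1))
      show "f w = (w - t) ^ k * g w" if "w \<in> ?S" for w by (rule g(2)[OF that])
    qed simp
  qed
  from choice[OF this] obtain h where "\<forall>i. h i holomorphic_on ?S \<and>
      h i t = (\<Prod>l<i. of_nat k - of_nat l) * g t \<and>
      (\<forall>w\<in>?S. (w - t) ^ i * (deriv ^^ i) f w = (w - t) ^ k * h i w)" by blast
  then have h: "\<And>i. h i holomorphic_on ?S"
    "\<And>i. h i t = (\<Prod>l<i. of_nat k - of_nat l) * g t"
    "\<And>i w. w \<in> ?S \<Longrightarrow> (w - t) ^ i * (deriv ^^ i) f w = (w - t) ^ k * h i w"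
    by blast+
  have cont: "isCont (h i) t" for i
    using holomorphic_on_imp_continuous_on[OF h(1)[of i]] r(1)
    by (simp add: continuous_on_eq_continuous_at)
  have ev: "eventually (\<lambda>w. (w - t) ^ i * (deriv ^^ i) f w = (w - t) ^ k * h i w) (at t)" for i
  proof -
    have "eventually (\<lambda>w. w \<in> ?S) (at t)" by (rule eventually_at_in_open') (use r(1) in auto)
    then show ?thesis by eventually_elim (rule h(3))
  qed
  have "(deriv ^^ k) f t \<noteq> 0"
  proof -
    have "eventually (\<lambda>w. h k w = (deriv ^^ k) f w) (at t)"
    proof -
      have "eventually (\<lambda>w. w \<noteq> t) (at t)" by (simp add: eventually_at_filter)
      with ev[of k] show ?thesis by eventually_elim auto
    qed
    moreover have "(h k \<longlongrightarrow> h k t) (at t)" using cont[of k] by (simp add: isCont_def)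
    ultimately have "((deriv ^^ k) f \<longlongrightarrow> h k t) (at t)" by (rule Lim_transform_eventually[rotated])
    moreover have "((deriv ^^ k) f \<longlongrightarrow> (deriv ^^ k) f t) (at t)"
      using holomorphic_on_imp_continuous_on[OF holomorphic_higher_deriv[OF f open_UNIV, of k]]
      by (simp add: continuous_on_def)
    ultimately have "(deriv ^^ k) f t = h k t" using tendsto_unique[of "at t"] by auto
    then show ?thesis using h(2)[of k] g(3) falling_eq_0_iff[of k k] by auto
  qed
  then show thesis
  proof (rule that[OF k _ cont _ _ ev])
    show "h i t = (\<Prod>l<i. of_nat k - of_nat l) * h 0 t" for i using h(2)[of i] h(2)[of 0] by simp
    show "h 0 t \<noteq> 0" using h(2)[of 0] g(3) by simp
  qed
qed

text \<open>
  If \<open>f\<close> vanishes to order \<open>k\<close>, then \<open>(w - t)\<^bsup>N - k\<^esup>\<close> times the equation tends to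
  \<open>a\<^sub>N(t) k (k - 1) \<cdots> (k - N + 1)\<close> times a nonzero number, so one of the factors of the falling factorial is \<open>0\<close>.
\<close>

lemma order_at_regular_point:
  fixes f :: "complex \<Rightarrow> complex"
  assumes f: "f holomorphic_on UNIV" "f \<noteq> 0"
    and ode: "\<And>w. (\<Sum>i\<le>N. a i w * (deriv ^^ i) f w) = 0"
    and cont: "\<And>i. i \<le> N \<Longrightarrow> isCont (a i) t" and lead: "a N t \<noteq> 0"
  shows "nat (zorder f t) < N"
proof -
  obtain k h where k: "zorder f t = int k" and cont_h: "\<And>i. isCont (h i) t"
    and h: "\<And>i. h i t = (\<Prod>l<i. of_nat k - of_nat l) * h 0 t" "h 0 t \<noteq> 0"
    and ev: "\<And>i. eventually (\<lambda>w. (w - t) ^ i * (deriv ^^ i) f w = (w - t) ^ k * h i w) (at t)"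
    by (rule entire_order[OF f, of t]) blast
  have "((\<lambda>w. \<Sum>i\<le>N. a i w * (w - t) ^ (N - i) * h i w)
      \<longlongrightarrow> (\<Sum>i\<le>N. a i t * (t - t) ^ (N - i) * h i t)) (at t)"
    using cont cont_h by (intro tendsto_intros) (auto simp: isCont_def)
  moreover have "eventually (\<lambda>w. (\<Sum>i\<le>N. a i w * (w - t) ^ (N - i) * h i w) = 0) (at t)"
  proof -
    have "eventually (\<lambda>w. \<forall>i\<in>{..N}. (w - t) ^ i * (deriv ^^ i) f w = (w - t) ^ k * h i w) (at t)"
      by (rule eventually_ball_finite) (use ev in auto)
    moreover have "eventually (\<lambda>w. w \<noteq> t) (at t)" by (simp add: eventually_at_filter)
    ultimately show ?thesis
    proof eventually_elim
      case (elim w)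
      have "(w - t) ^ k * (\<Sum>i\<le>N. a i w * (w - t) ^ (N - i) * h i w)
          = (\<Sum>i\<le>N. a i w * (w - t) ^ (N - i) * ((w - t) ^ k * h i w))"
        by (simp add: sum_distrib_left mult_ac)
      also have "\<dots> = (\<Sum>i\<le>N. (w - t) ^ N * (a i w * (deriv ^^ i) f w))"
      proof (rule sum.cong)
        fix i assume i: "i \<in> {..N}"
        then have "(w - t) ^ N = (w - t) ^ (N - i) * (w - t) ^ i" by (simp flip: power_add)
        moreover have "(w - t) ^ k * h i w = (w - t) ^ i * (deriv ^^ i) f w" using elim(1) i by simp
        ultimately show "a i w * (w - t) ^ (N - i) * ((w - t) ^ k * h i w)
            = (w - t) ^ N * (a i w * (deriv ^^ i) f w)"
          by (simp only: mult_ac)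
      qed simp
      also have "\<dots> = 0" by (simp add: ode flip: sum_distrib_left)
      finally show ?case using elim(2) by simp
    qed
  qed
  ultimately have "((\<lambda>w. 0) \<longlongrightarrow> (\<Sum>i\<le>N. a i t * (t - t) ^ (N - i) * h i t)) (at t)"
    by (rule Lim_transform_eventually)
  then have "(\<Sum>i\<le>N. a i t * (t - t) ^ (N - i) * h i t) = 0"
    by (rule LIM_const_eq[symmetric])
  moreover have "(\<Sum>i\<le>N. a i t * (t - t) ^ (N - i) * h i t) = (\<Sum>i\<le>N. if i = N then a N t * h N t else 0)"
    by (rule sum.cong) auto
  ultimately have "h N t = 0" using lead by simp
  then have "k < N" using h falling_eq_0_iff[of k N] by (metis mult_eq_0_iff)
  then show ?thesis by (simp add: k)
qed

text \<open>
  Now the leading coefficient contributes a factor \<open>w - t\<close>, so that the two highest derivatives are of the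
  same size. With \<open>N + 1\<close> the order of the equation, the indicial equation is
  \<open>k (k - 1) \<cdots> (k - N + 1) (d (k - N) + a\<^sub>N(t)) = 0\<close>.
\<close>

lemma order_at_simple_singular_point:
  fixes f :: "complex \<Rightarrow> complex"
  assumes f: "f holomorphic_on UNIV" "f \<noteq> 0"
    and ode: "\<And>w. (\<Sum>i\<le>Suc N. a i w * (deriv ^^ i) f w) = 0"
    and cont: "\<And>i. i \<le> N \<Longrightarrow> isCont (a i) t"
    and lead: "a (Suc N) t = 0" "(a (Suc N) has_field_derivative d) (at t)" "d \<noteq> 0"
    and sub: "a N t = - of_nat m * d"
  shows "nat (zorder f t) < N \<or> nat (zorder f t) = N + m"
proof -
  obtain k h where k: "zorder f t = int k" and cont_h: "\<And>i. isCont (h i) t"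
    and h: "\<And>i. h i t = (\<Prod>l<i. of_nat k - of_nat l) * h 0 t" "h 0 t \<noteq> 0"
    and ev: "\<And>i. eventually (\<lambda>w. (w - t) ^ i * (deriv ^^ i) f w = (w - t) ^ k * h i w) (at t)"
    by (rule entire_order[OF f, of t]) blast
  define b where "b w = a (Suc N) w / (w - t)" for w
  have b: "(b \<longlongrightarrow> d) (at t)"
    using lead(2) unfolding has_field_derivative_iff b_def[abs_def] by (simp add: lead(1))
  have "((\<lambda>w. (\<Sum>i\<le>N. a i w * (w - t) ^ (N - i) * h i w) + b w * h (Suc N) w)
      \<longlongrightarrow> (\<Sum>i\<le>N. a i t * (t - t) ^ (N - i) * h i t) + d * h (Suc N) t) (at t)"
    using cont cont_h b by (intro tendsto_intros) (auto simp: isCont_def)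
  moreover have "eventually (\<lambda>w. (\<Sum>i\<le>N. a i w * (w - t) ^ (N - i) * h i w) + b w * h (Suc N) w = 0) (at t)"
  proof -
    have "eventually (\<lambda>w. \<forall>i\<in>{..Suc N}. (w - t) ^ i * (deriv ^^ i) f w = (w - t) ^ k * h i w) (at t)"
      by (rule eventually_ball_finite) (use ev in auto)
    moreover have "eventually (\<lambda>w. w \<noteq> t) (at t)" by (simp add: eventually_at_filter)
    ultimately show ?thesis
    proof eventually_elim
      case (elim w)
      have "(\<Sum>i\<le>N. a i w * (w - t) ^ (N - i) * ((w - t) ^ k * h i w))
          = (\<Sum>i\<le>N. (w - t) ^ N * (a i w * (deriv ^^ i) f w))"
      proof (rule sum.cong)
        fix i assume i: "i \<in> {..N}"
        then have "(w - t) ^ N = (w - t) ^ (N - i) * (w - t) ^ i" by (simp flip: power_add)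
        moreover have "(w - t) ^ k * h i w = (w - t) ^ i * (deriv ^^ i) f w" using elim(1) i by simp
        ultimately show "a i w * (w - t) ^ (N - i) * ((w - t) ^ k * h i w)
            = (w - t) ^ N * (a i w * (deriv ^^ i) f w)"
          by (simp only: mult_ac)
      qed simp
      moreover have "b w * ((w - t) ^ k * h (Suc N) w)
          = (w - t) ^ N * (a (Suc N) w * (deriv ^^ Suc N) f w)"
      proof -
        have "b w * ((w - t) ^ k * h (Suc N) w) = b w * ((w - t) ^ Suc N * (deriv ^^ Suc N) f w)"
          using bspec[OF elim(1), of "Suc N"] by simp
        then show ?thesis using elim(2) by (simp add: b_def)
      qed
      ultimately have "(w - t) ^ k * ((\<Sum>i\<le>N. a i w * (w - t) ^ (N - i) * h i w) + b w * h (Suc N) w)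
          = (\<Sum>i\<le>Suc N. (w - t) ^ N * (a i w * (deriv ^^ i) f w))"
        by (simp add: sum_distrib_left distrib_left mult_ac)
      also have "\<dots> = 0" by (simp add: ode del: sum.atMost_Suc flip: sum_distrib_left)
      finally show ?case using elim(2) by simp
    qed
  qed
  ultimately have "((\<lambda>w. 0) \<longlongrightarrow> (\<Sum>i\<le>N. a i t * (t - t) ^ (N - i) * h i t) + d * h (Suc N) t) (at t)"
    by (rule Lim_transform_eventually)
  then have "(\<Sum>i\<le>N. a i t * (t - t) ^ (N - i) * h i t) + d * h (Suc N) t = 0"
    by (rule LIM_const_eq[symmetric])
  moreover have "(\<Sum>i\<le>N. a i t * (t - t) ^ (N - i) * h i t) = (\<Sum>i\<le>N. if i = N then a N t * h N t else 0)"
    by (rule sum.cong) auto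
  ultimately have "a N t * h N t + d * h (Suc N) t = 0" by simp
  moreover have "h (Suc N) t = (of_nat k - of_nat N) * h N t"
    using h(1)[of "Suc N"] h(1)[of N] by (simp add: mult_ac)
  ultimately have "d * h N t * (of_nat k - of_nat N - of_nat m) = 0"
    by (simp add: sub algebra_simps)
  then have "h N t = 0 \<or> of_nat k - of_nat N - of_nat m = (0 :: complex)"
    using lead(3) by simp
  then have "k < N \<or> k = N + m"
  proof
    assume "h N t = 0"
    then show ?thesis using h falling_eq_0_iff[of k N] by (metis mult_eq_0_iff)
  next
    assume "of_nat k - of_nat N - of_nat m = (0 :: complex)"
    then have "of_nat k = (of_nat (N + m) :: complex)" by (simp add: algebra_simps)
    then show ?thesis by (simp only: of_nat_eq_iff) simp
  qed
  then show ?thesis by (simp add: k)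
qed

lemma higher_deriv_sum:
  fixes v :: "nat \<Rightarrow> complex \<Rightarrow> complex"
  assumes "\<And>i. i < n \<Longrightarrow> v i holomorphic_on UNIV"
  shows "(deriv ^^ k) (\<lambda>t. \<Sum>i<n. c i * v i t) = (\<lambda>t. \<Sum>i<n. c i * (deriv ^^ k) (v i) t)"
proof (induction k)
  case (Suc k)
  have "((\<lambda>t. \<Sum>i<n. c i * (deriv ^^ k) (v i) t) has_field_derivative
      (\<Sum>i<n. c i * (deriv ^^ Suc k) (v i) t)) (at t)" for t
  proof (rule DERIV_sum)
    fix i assume "i \<in> {..<n}"
    then have "((deriv ^^ k) (v i) has_field_derivative (deriv ^^ Suc k) (v i) t) (at t)"
      using holomorphic_derivI[OF holomorphic_higher_deriv[OF assms open_UNIV] open_UNIV UNIV_I] by simp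
    then show "((\<lambda>t. c i * (deriv ^^ k) (v i) t) has_field_derivative c i * (deriv ^^ Suc k) (v i) t) (at t)"
      by (rule DERIV_cmult)
  qed
  then show ?case
    by (simp add: Suc.IH fun_eq_iff DERIV_imp_deriv)
qed simp

text \<open>
  If the order \<open>e l\<close> did not occur, the \<open>n - 1\<close> functionals \<open>f \<mapsto> f\<^bsup>(e i)\<^esup>(t)\<close> with \<open>i \<noteq> l\<close> would separate the
  functions of an \<open>n\<close>-dimensional space. In the proof, a common zero of these functionals is
  found from a matrix whose row \<open>l\<close> is zero; its order can only be \<open>e l\<close>.
\<close>

lemma orders_of_function_space:
  fixes v :: "nat \<Rightarrow> complex \<Rightarrow> complex"
  assumes hol: "\<And>i. i < n \<Longrightarrow> v i holomorphic_on UNIV"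
    and ind: "\<And>c i. (\<And>t. (\<Sum>i<n. c i * v i t) = 0) \<Longrightarrow> i < n \<Longrightarrow> c i = 0"
    and e: "\<And>f. f \<in> cfun.span (v ` {..<n}) \<Longrightarrow> f \<noteq> 0 \<Longrightarrow> \<exists>i<n. zorder f t = int (e i)"
    and inj: "inj_on e {..<n}" and l: "l < n"
  obtains f where "f \<in> cfun.span (v ` {..<n})" and "f \<noteq> 0" and "zorder f t = int (e l)"
proof -
  define A where "A i j = (if i = l then 0 else (deriv ^^ e i) (v j) t)" for i j
  have "detn n A = 0"
    unfolding detn_eq_0_iff_left
    by (rule exI[of _ "\<lambda>i. if i = l then 1 else 0"]) (use l in \<open>auto simp: A_def intro!: sum.neutral\<close>)
  then obtain c k where c: "k < n" "c k \<noteq> 0" "\<And>i. i < n \<Longrightarrow> (\<Sum>j<n. A i j * c j) = 0"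
    unfolding detn_eq_0_iff by blast
  define f where "f = (\<lambda>t. \<Sum>i<n. c i * v i t)"
  have f_span: "f \<in> cfun.span (v ` {..<n})"
    by (auto simp: f_def cfun_span_image_iff)
  have f_nz: "f \<noteq> 0"
    using ind[of c k] c(1,2) by (auto simp: f_def fun_eq_iff)
  have f_hol: "f holomorphic_on UNIV"
    unfolding f_def by (intro holomorphic_intros hol) auto
  obtain k' where k': "zorder f t = int k'" "(deriv ^^ k') f t \<noteq> 0"
    by (rule entire_order[OF f_hol f_nz, of t]) blast
  obtain i where i: "i < n" "zorder f t = int (e i)" using e[OF f_span f_nz] by blast
  have "i = l"
  proof (rule ccontr)
    assume "i \<noteq> l"
    then have "(deriv ^^ e i) f t = (\<Sum>j<n. A i j * c j)"
      using fun_cong[OF higher_deriv_sum[of n v "e i" c], of t] hol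
      by (simp add: f_def A_def mult.commute)
    then show False using c(3)[OF i(1)] k' i(2) by simp
  qed
  then show thesis using f_span f_nz i(2) that by blast
qed

text \<open>
  The logarithm has a simple zero at \<open>1\<close>, so passing from \<open>t\<close> to \<open>x = exp t\<close> does not change orders.
\<close>

lemma zorder_branch:
  assumes f: "f holomorphic_on UNIV" and nz: "f \<noteq> 0"
  shows "zorder (branch f t) (exp t) = zorder f t"
proof -
  let ?L = "\<lambda>x. t + Ln (x / exp t)"
  have L_an: "?L analytic_on {exp t}"
    by (intro analytic_intros) auto
  have L_t: "?L (exp t) = t" by simp
  have L_deriv: "((\<lambda>x. ?L x - t) has_field_derivative 1 / exp t) (at (exp t))"
    by (auto intro!: derivative_eq_intros)
  have "zorder (\<lambda>x. ?L x - ?L (exp t)) (exp t) = 1"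
  proof (rule zorder_zero_eqI')
    show "(\<lambda>x. ?L x - ?L (exp t)) analytic_on {exp t}"
      by (intro analytic_on_diff L_an analytic_on_const)
    show "(deriv ^^ nat 1) (\<lambda>x. ?L x - ?L (exp t)) (exp t) \<noteq> 0"
      unfolding L_t using DERIV_imp_deriv[OF L_deriv] by simp
  qed auto
  moreover have "zorder (f \<circ> ?L) (exp t) = zorder f (?L (exp t)) * zorder (\<lambda>x. ?L x - ?L (exp t)) (exp t)"
  proof (rule zorder_compose')
    have an: "f analytic_on {t}" using f by (rule holomorphic_on_imp_analytic_at) auto
    show "isolated_singularity_at f (?L (exp t))" unfolding L_t
      by (rule isolated_singularity_at_analytic[OF an])
    show "not_essential f (?L (exp t))" unfolding L_t
      by (rule not_essential_analytic[OF an])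
    show "?L analytic_on {exp t}" by (rule L_an)
    obtain k h where k: "\<And>i. isCont (h i) t" "h (0::nat) t \<noteq> 0"
      "\<And>i. eventually (\<lambda>w. (w - t) ^ i * (deriv ^^ i) f w = (w - t) ^ k * h i w) (at t)"
      by (rule entire_order[OF f nz, of t]) blast
    have "eventually (\<lambda>w. h 0 w \<noteq> 0) (at t)"
      by (rule tendsto_imp_eventually_ne[of _ "h 0 t"]) (use k(1)[of 0] k(2) in \<open>auto simp: isCont_def\<close>)
    moreover have "eventually (\<lambda>w. w \<noteq> t) (at t)" by (simp add: eventually_at_filter)
    ultimately have "eventually (\<lambda>w. f w \<noteq> 0) (at t)"
      using k(3)[of 0] by eventually_elim auto
    then show "eventually (\<lambda>w. f w \<noteq> 0) (at (?L (exp t)))" unfolding L_t .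
    have "eventually (\<lambda>x. x \<in> - {0}) (at (exp t))"
      by (rule eventually_at_in_open') auto
    moreover have "eventually (\<lambda>x. x \<noteq> exp t) (at (exp t))" by (simp add: eventually_at_filter)
    ultimately show "eventually (\<lambda>x. ?L x \<noteq> ?L (exp t)) (at (exp t))"
    proof eventually_elim
      case (elim x)
      show ?case
      proof
        assume "?L x = ?L (exp t)"
        then have "Ln (x / exp t) = 0" by simp
        then have "x / exp t = 1" using elim(1) exp_Ln[of "x / exp t"] by simp
        then show False using elim(2) by simp
      qed
    qed
  qed
  ultimately show ?thesis by (simp add: branch_def[abs_def] o_def)
qed

section \<open>Sums of exponentials\<close>

lemma higher_deriv_exponential_sum:
  fixes c :: "complex \<Rightarrow> complex"
  shows "(deriv ^^ k) (\<lambda>t. \<Sum>p\<in>S. c p * exp (p * t)) = (\<lambda>t. \<Sum>p\<in>S. p ^ k * c p * exp (p * t))"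
proof (induction k)
  case (Suc k)
  have "((\<lambda>t. \<Sum>p\<in>S. p ^ k * c p * exp (p * t)) has_field_derivative
      (\<Sum>p\<in>S. p ^ Suc k * c p * exp (p * t))) (at t)" for t
    by (rule DERIV_sum) (auto intro!: derivative_eq_intros)
  then show ?case by (simp add: Suc.IH fun_eq_iff DERIV_imp_deriv)
qed simp

text \<open>
  The derivatives at \<open>0\<close> give \<open>\<Sum>\<^sub>s r(s) c\<^sub>s = 0\<close> for every polynomial \<open>r\<close>; choose \<open>r\<close> to vanish at all exponents
  but \<open>p\<close>.
\<close>

lemma exponentials_independent:
  assumes fin: "finite S" and zero: "\<And>t. (\<Sum>p\<in>S. c p * exp (p * t)) = 0" and p: "p \<in> S"
  shows "c p = (0 :: complex)"
proof -
  have powers: "(\<Sum>s\<in>S. s ^ k * c s) = 0" for k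
  proof -
    have z: "(\<lambda>t. \<Sum>p\<in>S. c p * exp (p * t)) = (\<lambda>t. 0)" using zero by (simp add: fun_eq_iff)
    have "(deriv ^^ k) (\<lambda>t. 0 :: complex) = (\<lambda>t. 0)" by (induction k) simp_all
    then have "(deriv ^^ k) (\<lambda>t. \<Sum>p\<in>S. c p * exp (p * t)) 0 = 0" by (simp add: z)
    then show ?thesis by (simp add: higher_deriv_exponential_sum)
  qed
  define r where "r = (\<Prod>s\<in>S - {p}. [:- s, 1:])"
  have "(\<Sum>s\<in>S. poly r s * c s) = (\<Sum>s\<in>S. \<Sum>i\<le>degree r. coeff r i * (s ^ i * c s))"
    by (simp add: poly_altdef sum_distrib_right mult.assoc)
  also have "\<dots> = (\<Sum>i\<le>degree r. coeff r i * (\<Sum>s\<in>S. s ^ i * c s))"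
    by (subst sum.swap) (simp add: sum_distrib_left)
  also have "\<dots> = 0" by (simp add: powers)
  finally have "(\<Sum>s\<in>S. poly r s * c s) = 0" .
  moreover have "(\<Sum>s\<in>S. poly r s * c s) = (\<Sum>s\<in>{p}. poly r s * c s)"
    by (rule sum.mono_neutral_right) (use fin p in \<open>auto simp: r_def poly_prod\<close>)
  moreover have "poly r p \<noteq> 0" using fin by (auto simp: r_def poly_prod)
  ultimately show ?thesis by simp
qed

section \<open>The space of integral transforms\<close>

lemma poly_eq_sum_coeff:
  fixes p :: "'a :: comm_semiring_1 poly"
  assumes "degree p \<le> d"
  shows "poly p x = (\<Sum>k\<le>d. coeff p k * x ^ k)"
proof -
  have "(\<Sum>k\<le>d. coeff p k * x ^ k) = (\<Sum>k\<le>degree p. coeff p k * x ^ k)"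
    by (rule sum.mono_neutral_right) (use assms in \<open>auto simp: coeff_eq_0\<close>)
  then show ?thesis by (simp add: poly_altdef)
qed

context quasi_exponentials
begin

lemma transform_fun_holomorphic: "transform_fun i h holomorphic_on A"
  unfolding transform_fun_def by (intro holomorphic_intros)

lemma transform_span_holomorphic:
  assumes "f \<in> cfun.span ((\<lambda>i. transform_fun i (h i)) ` {..<N})"
  shows "f holomorphic_on A"
proof -
  obtain c where "f = (\<lambda>t. \<Sum>i<N. c i * transform_fun i (h i) t)"
    using assms by (auto simp: cfun_span_image_iff)
  then show ?thesis by (simp add: holomorphic_intros transform_fun_holomorphic)
qed

text \<open>
  A combination of the transforms is a sum of exponentials whose exponents lie in the disjoint sets
  \<open>S\<^sub>i\<close>. The coefficient at the point \<open>\<lambda>\<^sub>i - 1\<close> is \<open>c\<^sub>i\<close> times a nonzero residue.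
\<close>

lemma transform_fun_independent:
  assumes h: "\<And>i. i < N \<Longrightarrow> adapted i (h i)"
    and zero: "\<And>t. (\<Sum>i<N. c i * transform_fun i (h i) t) = 0" and i: "i < N"
  shows "c i = 0"
proof -
  define d where "d p = (\<Sum>j<N. if p \<in> pole_set n lam j then c j * conj_residue (h j) p else 0)" for p
  have "(\<Sum>p\<in>poles. d p * exp (p * t)) = 0" for t
  proof -
    have "(\<Sum>p\<in>poles. d p * exp (p * t))
        = (\<Sum>j<N. \<Sum>p\<in>poles. if p \<in> pole_set n lam j then c j * conj_residue (h j) p * exp (p * t) else 0)"
      unfolding d_def sum_distrib_right by (subst sum.swap) (auto intro!: sum.cong)
    also have "\<dots> = (\<Sum>j<N. c j * transform_fun j (h j) t)"
    proof (rule sum.cong)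
      fix j assume j: "j \<in> {..<N}"
      then have "pole_set n lam j \<subseteq> poles" by (auto simp: poles_def)
      then have "poles \<inter> pole_set n lam j = pole_set n lam j" by blast
      then show "(\<Sum>p\<in>poles. if p \<in> pole_set n lam j then c j * conj_residue (h j) p * exp (p * t) else 0)
          = c j * transform_fun j (h j) t"
        by (simp add: sum.inter_restrict[OF finite_poles, symmetric] transform_fun_eq sum_distrib_left mult.assoc)
    qed simp
    finally show ?thesis by (simp add: zero)
  qed
  moreover have p: "lam i - 1 \<in> pole_set n lam i" by (auto simp: pole_set_eq intro!: image_eqI[of _ _ 0])
  moreover have "lam i - 1 \<in> poles" using p i by (auto simp: poles_def)
  ultimately have "d (lam i - 1) = 0"
    using exponentials_independent[OF finite_poles] by blast
  moreover have "d (lam i - 1) = (\<Sum>j<N. if j = i then c i * conj_residue (h i) (lam i - 1) else 0)"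
    unfolding d_def
  proof (rule sum.cong)
    fix j assume "j \<in> {..<N}"
    then show "(if lam i - 1 \<in> pole_set n lam j then c j * conj_residue (h j) (lam i - 1) else 0)
        = (if j = i then c i * conj_residue (h i) (lam i - 1) else 0)"
      using p pole_sets_disjoint[of i j] i by auto
  qed simp
  ultimately show ?thesis
    using i conj_residue_nonzero_ends(1)[OF i h[OF i]] by simp
qed

lemma transform_fun_ode:
  assumes i: "i < N" and h: "adapted i h"
  shows "(\<Sum>k\<le>N. poly (theta_coeff k) (exp t) * (deriv ^^ k) (transform_fun i h) t) = 0"
proof -
  let ?S = "pole_set n lam i"
  have v: "transform_fun i h = (\<lambda>t. \<Sum>p\<in>?S. conj_residue h p * exp (p * t))"
    by (simp add: fun_eq_iff transform_fun_eq)
  have "(\<Sum>k\<le>N. poly (theta_coeff k) (exp t) * (deriv ^^ k) (transform_fun i h) t)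
      = (\<Sum>k\<le>N. \<Sum>j\<le>M. exp (of_nat j * t) *
          (\<Sum>p\<in>?S. coeff (B (M - j)) k * p ^ k * (conj_residue h p * exp (p * t))))"
    unfolding v higher_deriv_exponential_sum poly_theta_coeff sum_distrib_right
    by (intro sum.cong) (auto simp: sum_distrib_left exp_of_nat_mult exp_of_nat2_mult mult_ac)
  also have "\<dots> = (\<Sum>j\<le>M. exp (of_nat j * t) *
      (\<Sum>p\<in>?S. (\<Sum>k\<le>N. coeff (B (M - j)) k * p ^ k) * (conj_residue h p * exp (p * t))))"
    unfolding sum_distrib_right
    by (subst sum.swap) (auto simp: sum_distrib_left intro!: sum.cong sum.swap)
  also have "\<dots> = (\<Sum>j\<le>M. exp (of_nat j * t) *
      (\<Sum>p\<in>?S. poly (B (M - j)) p * (conj_residue h p * exp (p * t))))"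
    by (simp add: poly_eq_sum_coeff[OF degree_B_le])
  also have "\<dots> = 0"
    by (rule adjoint_annihilates_exponential_sum[OF i adapted_basis_of[OF h]])
  finally show ?thesis .
qed

lemma transform_span_ode:
  assumes h: "\<And>i. i < N \<Longrightarrow> adapted i (h i)"
    and f: "f \<in> cfun.span ((\<lambda>i. transform_fun i (h i)) ` {..<N})"
  shows "(\<Sum>k\<le>N. poly (theta_coeff k) (exp t) * (deriv ^^ k) f t) = 0"
proof -
  obtain c where c: "f = (\<lambda>t. \<Sum>i<N. c i * transform_fun i (h i) t)"
    using f by (auto simp: cfun_span_image_iff)
  have "(\<Sum>k\<le>N. poly (theta_coeff k) (exp t) * (deriv ^^ k) f t)
      = (\<Sum>i<N. c i * (\<Sum>k\<le>N. poly (theta_coeff k) (exp t) * (deriv ^^ k) (transform_fun i (h i)) t))"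
    unfolding c higher_deriv_sum[of N "\<lambda>i. transform_fun i (h i)", OF transform_fun_holomorphic] sum_distrib_left
    by (subst sum.swap) (simp add: mult_ac)
  also have "\<dots> = 0"
    by (rule sum.neutral) (use transform_fun_ode h in auto)
  finally show ?thesis .
qed

lemma theta_coeff_exp_isCont: "isCont (\<lambda>t. poly (theta_coeff k) (exp t)) t"
  by (intro continuous_intros)

text \<open>
  It suffices to bound the possible orders by a list of length \<open>N\<close>: the dimension forces each of them to occur.
\<close>

lemma has_exponents_transform_span:
  assumes h: "\<And>i. i < N \<Longrightarrow> adapted i (h i)"
    and e: "strict_mono_on {..<N} e"
    and orders: "\<And>t f. exp t = x \<Longrightarrow> f \<in> cfun.span ((\<lambda>i. transform_fun i (h i)) ` {..<N}) \<Longrightarrow> f \<noteq> 0 \<Longrightarrow>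
      \<exists>i<N. nat (zorder f t) = e i"
  shows "has_exponents (cfun.span ((\<lambda>i. transform_fun i (h i)) ` {..<N})) N x (\<lambda>i. int (e i))"
  unfolding has_exponents_def
proof (intro conjI allI impI)
  show "strict_mono_on {..<N} (\<lambda>i. int (e i))"
    using e by (auto simp: strict_mono_on_def)
  fix t l assume t: "exp t = x" and l: "l < N"
  obtain f where f: "f \<in> cfun.span ((\<lambda>i. transform_fun i (h i)) ` {..<N})" "f \<noteq> 0" "zorder f t = int (e l)"
  proof (rule orders_of_function_space[of N "\<lambda>i. transform_fun i (h i)" t e l])
    show "c i = 0" if "\<And>t. (\<Sum>i<N. c i * transform_fun i (h i) t) = 0" "i < N" for c i
      by (rule transform_fun_independent[OF h that])
    show "\<exists>i<N. zorder f t = int (e i)"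
      if f: "f \<in> cfun.span ((\<lambda>i. transform_fun i (h i)) ` {..<N})" "f \<noteq> 0" for f
    proof -
      obtain k where "zorder f t = int k"
        by (rule entire_order[OF transform_span_holomorphic[OF f(1)] f(2), of t]) blast
      then show ?thesis using orders[OF t f] by auto
    qed
    show "inj_on e {..<N}" using e by (rule strict_mono_on_imp_inj_on)
  qed (use l transform_fun_holomorphic in auto)
  then show "\<exists>f\<in>cfun.span ((\<lambda>i. transform_fun i (h i)) ` {..<N}). f \<noteq> 0 \<and> zorder (branch f t) x = int (e l)"
    using zorder_branch[OF transform_span_holomorphic[OF f(1)] f(2), of t] t by auto
qed

lemma exponents_regular:
  assumes h: "\<And>i. i < N \<Longrightarrow> adapted i (h i)" and x: "x \<notin> z ` {..<M}"
  shows "has_exponents (cfun.span ((\<lambda>i. transform_fun i (h i)) ` {..<N})) N x int"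
proof (rule has_exponents_transform_span[OF h, where e = "\<lambda>i. i"])
  show "strict_mono_on {..<N} (\<lambda>i. i :: nat)" by (auto simp: strict_mono_on_def)
  fix t f assume t: "exp t = x" and f: "f \<in> cfun.span ((\<lambda>i. transform_fun i (h i)) ` {..<N})" "f \<noteq> 0"
  have "poly (theta_coeff N) (exp t) \<noteq> 0"
    using x by (auto simp: t theta_coeff_N_eq poly_prod)
  then have "nat (zorder f t) < N"
    by (intro order_at_regular_point[OF transform_span_holomorphic[OF f(1)] f(2) transform_span_ode[OF h f(1)]]
          theta_coeff_exp_isCont)
  then show "\<exists>i<N. nat (zorder f t) = i" by blast
qed

lemma exponents_at_z:
  assumes h: "\<And>i. i < N \<Longrightarrow> adapted i (h i)" and a: "a < M"
  shows "has_exponents (cfun.span ((\<lambda>i. transform_fun i (h i)) ` {..<N})) N (z a)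
    (\<lambda>i. int (if i = N - 1 then N - 1 + m a else i))"
proof (rule has_exponents_transform_span[OF h])
  show "strict_mono_on {..<N} (\<lambda>i. if i = N - 1 then N - 1 + m a else i)"
    by (auto simp: strict_mono_on_def)
  fix t f assume t: "exp t = z a" and f: "f \<in> cfun.span ((\<lambda>i. transform_fun i (h i)) ` {..<N})" "f \<noteq> 0"
  have N: "Suc (N - 1) = N" using N_gt_1 by simp
  have "nat (zorder f t) < N - 1 \<or> nat (zorder f t) = N - 1 + m a"
  proof (rule order_at_simple_singular_point[OF transform_span_holomorphic[OF f(1)] f(2),
        where a = "\<lambda>k t. poly (theta_coeff k) (exp t)"
          and d = "z a * poly (pderiv (theta_coeff N)) (z a)"], unfold N)
    show "(\<Sum>k\<le>N. poly (theta_coeff k) (exp w) * (deriv ^^ k) f w) = 0" for w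
      by (rule transform_span_ode[OF h f(1)])
    show "poly (theta_coeff N) (exp t) = 0" by (simp add: t theta_coeff_N_root[OF a])
    have "((\<lambda>t. poly (theta_coeff N) (exp t)) has_field_derivative poly (pderiv (theta_coeff N)) (exp t) * exp t) (at t)"
      by (rule DERIV_chain2[OF poly_DERIV DERIV_exp])
    then show "((\<lambda>t. poly (theta_coeff N) (exp t)) has_field_derivative
        z a * poly (pderiv (theta_coeff N)) (z a)) (at t)"
      by (simp add: t mult.commute)
    show "z a * poly (pderiv (theta_coeff N)) (z a) \<noteq> 0"
      using z_nonzero[OF a] theta_coeff_N_simple_root[OF a] by simp
    show "poly (theta_coeff (N - 1)) (exp t) = - of_nat (m a) * (z a * poly (pderiv (theta_coeff N)) (z a))"
      unfolding t by (rule theta_coeff_subleading[OF a])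
  qed (rule theta_coeff_exp_isCont)
  then show "\<exists>i<N. nat (zorder f t) = (if i = N - 1 then N - 1 + m a else i)"
  proof
    assume "nat (zorder f t) < N - 1"
    then show ?thesis by (intro exI[of _ "nat (zorder f t)"]) auto
  next
    assume "nat (zorder f t) = N - 1 + m a"
    then show ?thesis using N_gt_1 by (intro exI[of _ "N - 1"]) auto
  qed
qed

lemma transform_span_quasi_polynomial_space:
  assumes h: "\<And>i. i < N \<Longrightarrow> adapted i (h i)"
  shows "quasi_polynomial_space (cfun.span ((\<lambda>i. transform_fun i (h i)) ` {..<N})) N M n (\<lambda>i. lam i - 1) m z"
  unfolding quasi_polynomial_space_def
proof (intro conjI)
  show "\<forall>i<N. \<forall>j<N. i \<noteq> j \<longrightarrow> lam i - 1 - (lam j - 1) \<notin> \<int>"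
    using lam_diff by simp
  show "\<exists>p. (\<forall>i<N. degree (p i) = n i \<and> poly (p i) 0 \<noteq> 0) \<and>
      cfun.span ((\<lambda>i. transform_fun i (h i)) ` {..<N})
      = cfun.span ((\<lambda>i t. exp ((lam i - 1) * t) * poly (p i) (exp t)) ` {..<N})"
    by (rule exI[of _ "\<lambda>i. transform_poly i (h i)"])
       (use degree_transform_poly poly_transform_poly_0 h in \<open>auto simp: transform_fun_def[abs_def]\<close>)
  show "cfun.dim (cfun.span ((\<lambda>i. transform_fun i (h i)) ` {..<N})) = N"
    by (rule cfun_dim_span) (use transform_fun_independent[OF h] in blast)
  show "inj_on z {..<M}" by (rule z_inj)
  show "\<forall>a<M. z a \<noteq> 0" using z_nonzero by blast
  show "\<forall>x. x \<noteq> 0 \<and> singular_point (cfun.span ((\<lambda>i. transform_fun i (h i)) ` {..<N})) N x \<longrightarrow> x \<in> z ` {..<M}"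
  proof (intro allI impI, rule ccontr)
    fix x assume x: "x \<noteq> 0 \<and> singular_point (cfun.span ((\<lambda>i. transform_fun i (h i)) ` {..<N})) N x"
      "x \<notin> z ` {..<M}"
    have "int ` {..<N} \<noteq> {0..<int N}"
      using exponents_regular[OF h x(2)] x(1) by (auto simp: singular_point_def)
    moreover have "int ` {..<N} = {0..<int N}"
      by (simp add: image_int_atLeastLessThan lessThan_atLeast0)
    ultimately show False by simp
  qed
  show "\<forall>a<M. has_exponents (cfun.span ((\<lambda>i. transform_fun i (h i)) ` {..<N})) N (z a)
      (\<lambda>i. if i = N - 1 then int (N - 1 + m a) else int i)"
    using exponents_at_z[OF h] by (simp add: if_distrib cong: if_cong)
qed

lemma transform_span_special_differential_op:
  assumes h: "\<And>i. i < N \<Longrightarrow> adapted i (h i)"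
    and A: "\<And>j. j \<le> M \<Longrightarrow> B (M - j) = (\<Sum>i\<le>N. monom (A i j) i)"
  shows "special_fundamental_differential_op (cfun.span ((\<lambda>i. transform_fun i (h i)) ` {..<N})) N M z
    (\<lambda>F t. \<Sum>i\<le>N. \<Sum>j\<le>M. A i j * exp t ^ j * (mv_euler ^^ i) F t)"
proof (rule special_differential_op_euler_form[OF theta_coeff_N_eq transform_span_holomorphic transform_span_ode[OF h]])
  fix F :: "complex \<Rightarrow> complex" and t assume F: "F holomorphic_on UNIV"
  have coeff: "coeff (B (M - j)) i = A i j" if "i \<le> N" "j \<le> M" for i j
    using that by (simp add: A coeff_sum)
  show "(\<Sum>i\<le>N. \<Sum>j\<le>M. A i j * exp t ^ j * (mv_euler ^^ i) F t)
      = (\<Sum>i\<le>N. poly (theta_coeff i) (exp t) * (deriv ^^ i) F t)"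
    by (rule sum.cong) (simp_all add: mv_euler_funpow[OF F] poly_theta_coeff coeff sum_distrib_right)
qed

end

lemma quasi_exponential_space_locale:
  assumes "quasi_exponential_space U M N m z \<theta> n lam"
  obtains q where "quasi_exponentials U M N m z \<theta> n lam q"
proof -
  obtain q where "(\<forall>a<M. q a \<noteq> 0 \<and> degree (q a) = m a)"
    "U = cfun.span ((\<lambda>a u. arg_powr (z a) (\<theta> a) u * poly (q a) u) ` {..<M})"
    using assms unfolding quasi_exponential_space_def by blast
  then have "quasi_exponentials U M N m z \<theta> n lam q"
    using assms unfolding quasi_exponential_space_def by unfold_locales auto
  then show thesis by (rule that)
qed

theorem theorem5p2:
  fixes U V :: "(complex \<Rightarrow> complex) set"
    and M N :: nat
    and m n :: "nat \<Rightarrow> nat"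
    and z lam :: "nat \<Rightarrow> complex"
    and \<theta> :: "nat \<Rightarrow> real"
    and \<gamma> :: "nat \<Rightarrow> real \<Rightarrow> complex"
  assumes "quasi_exponential_space U M N m z \<theta> n lam"
    and "\<forall>i<N. admissible_contour N n lam i (\<gamma> i)"
    and "V = cfun.span {integral_transform (\<gamma> i) f | i f.
                          i < N \<and> f \<in> special_conjugate_space U M N n lam}"
  shows "quasi_polynomial_space V N M n (\<lambda>i. lam i - 1) m z \<and>
    (\<forall>A :: nat \<Rightarrow> nat \<Rightarrow> complex.
       (\<forall>j\<le>M. special_fundamental_difference_op U M N n lam (M - j)
                 = (\<Sum>i\<le>N. monom (A i j) i)) \<longrightarrow>
       special_fundamental_differential_op V N M z
         (\<lambda>F t. \<Sum>i\<le>N. \<Sum>j\<le>M. A i j * exp t ^ j * (mv_euler ^^ i) F t))"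
proof -
  obtain q where "quasi_exponentials U M N m z \<theta> n lam q"
    by (rule quasi_exponential_space_locale[OF assms(1)])
  then interpret quasi_exponentials U M N m z \<theta> n lam q .
  have "\<forall>i\<in>{..<N}. \<exists>h. adapted i h" using adapted_exists by simp
  then obtain h where "\<forall>i\<in>{..<N}. adapted i (h i)" by (rule bchoice[THEN exE])
  then have h: "adapted i (h i)" if "i < N" for i using that by simp
  have V: "V = cfun.span ((\<lambda>i. transform_fun i (h i)) ` {..<N})"
    unfolding assms(3) by (rule span_transforms_eq[OF h]) (use assms(2) in auto)
  show ?thesis
    unfolding V special_difference_op_eq_B
    using transform_span_quasi_polynomial_space[OF h] transform_span_special_differential_op[OF h] by blast
qed

end
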